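(* Let $C,\lambda:[0,\infty)\to(0,\infty)$ be nonincreasing with $C$ continuous, and put $A(t)=C(t)/\lambda(t)$. For $\nu>0$ let $\check u(x)=\int_0^{x_n}f_\nu(s)\,ds$, where $$f_\nu(t)=\nu^{e^{\int_0^tA(s)ds}}\ \text{ if }0<\nu\le1,\qquad f_\nu(t)=\nu^{e^{-\int_0^tA(s)ds}}\ \text{ if }\nu>1.$$ (a) The function $\check u$ is $p(x)$-harmonic in $\mathbb{R}^n_+$ with exponent $p(x)=\check p(x)$, where $$\check p(x)=1+M_0e^{-\int_0^{x_n}A(s)ds}\ \text{ if }\nu\in(0,1],\qquad \check p(x)=1+M_0e^{\int_0^{x_n}A(s)ds}\ \text{ if }\nu>1,$$ for every constant $M_0>0$. (b) Suppose that $\nu\in(0,1]$ and that $A^{-1}(s)=\lambda(s)$ is nonincreasing (i.e. $C\equiv1$). Then $\check u$ is the slowest growing $p(x)$-harmonic function in the following sense. Let $p\in C^1(\mathbb{R}^n_+)$, $1<p(x)<\infty$, with $\|Dp\|_{\infty,x}\ne0$ for all $x\in\mathbb{R}^n_+$, be such that $$\lambda(x_n)\le\frac{\min\{1,p(x)-1\}}{\|Dp\|_{\infty,x}}\quad\text{and}\quad\frac{\max\{1,p(x)-1\}}{\|Dp\|_{\infty,x}}\le\Lambda(x_n)\qquad\text{for all }x\in\mathbb{R}^n_+,$$ where $\Lambda:[0,\infty)\to(0,\infty)$ is nondecreasing, and let $\gamma:(0,\infty)\to(0,\infty)$ be nondecreasing with $\Lambda(R)\,e^{\int_0^R\lambda^{-1}(s)ds}\precsim\gamma(R)$.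 Then any $p(x)$-subharmonic function $u$ in $\mathbb{R}^n_+$ satisfying $\limsup_{x\to y}u(x)\le0$ for all $y\in\partial\mathbb{R}^n_+$ and exceeding $\check u$ somewhere on the $x_n$-axis satisfies $$\liminf_{R\to\infty}\frac{M'(R)}{\nu^{e^{\int_0^R\lambda^{-1}(s)ds}}}>0.$$ (c) If, in the situation of (b), $\lambda$ is constant, then $$\check u(x)=\lambda\left(-E_i(\log\nu)+E_i\left(e^{\lambda^{-1}x_n}\log\nu\right)\right)\ \text{ if }0<\nu<1,\qquad\check u(x)=x_n\ \text{ if }\nu=1$$ where $E_i$ is the exponential integral (for $\nu=1$ the value is $\lambda\cdot\lambda^{-1}x_n=x_n$).
   Context: Notation: $\mathbb{R}^n_+=\{x\in\mathbb{R}^n:x_n>0\}$, $n\ge1$; $\lambda^{-1}(s)=1/\lambda(s)$, and $\|Dp\|_{\infty,x}=\sup_{y\in\mathbb{R}^n_+:\,y_n=x_n}|Dp(y)|$. A function $u\in W^{1,p(x)}_{loc}(\Omega)$ is a weak subsolution (resp. solution) of $\nabla\cdot(|Du|^{p(x)-2}Du)=0$ in $\Omega$ if $\int_\Omega|Du|^{p(x)-2}Du\cdot D\psi\,dx\le0$ for all nonnegative $\psi\in C_0^\infty(\Omega)$ (resp. $=0$ for all $\psi\in C_0^\infty(\Omega)$). An upper semicontinuous weak subsolution is called $p(x)$-subharmonic, and a (continuous) weak solution is called $p(x)$-harmonic. $D(R)=\{x\in\mathbb{R}^n_+:\sum_{i=1}^{n-1}x_i^2+(x_n+\gamma(R))^2<(R+\gamma(R))^2\}$,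 $M(R)=\sup_{\partial D(R)}u$ (with $u(y):=\limsup_{x\to y}u(x)$ for $y\in\partial\mathbb{R}^n_+$), $M'(R)=\liminf_{h\to0^+}\frac{M(R)-M(R-h)}{h}$. $A\precsim B$ means that there is a constant $c>0$ with $A\le cB$. $E_i(z)=\mathrm{p.v.}\int_{-\infty}^z\frac{e^t}{t}\,dt$.
   Formalization: In (b), the p(x)-subharmonic u is real-valued and equals its essential upper limit at every point (the usc representative); otherwise u=0 raised at one axis point would be a counterexample. *)

theory Defs
  imports "HOL-Analysis.Analysis" "HOL-Probability.Essential_Supremum"
begin

text \<open>
  The type \<open>real ^ 'n\<close> carries no order on its coordinates, so the ``last'' coordinate
  \<open>x\<^sub>n\<close> is the coordinate at a fixed but arbitrary index \<open>k :: 'n\<close>. The remaining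
  \<open>n - 1\<close> coordinates are those with index in \<open>UNIV - {k}\<close>.
\<close>

definition half_space :: "'n::finite \<Rightarrow> (real ^ 'n) set" where
  "half_space k = {x. x $ k > 0}"

section \<open>Test functions\<close>

definition grad :: "(real ^ 'n::finite \<Rightarrow> real) \<Rightarrow> real ^ 'n \<Rightarrow> real ^ 'n" where
  "grad f x = (\<chi> i. frechet_derivative f (at x) (axis i 1))"

primrec Ck :: "nat \<Rightarrow> (real ^ 'n::finite \<Rightarrow> real) \<Rightarrow> bool" where
  "Ck 0 f \<longleftrightarrow> continuous_on UNIV f"
| "Ck (Suc m) f \<longleftrightarrow> (\<forall>x. f differentiable (at x)) \<and> (\<forall>i. Ck m (\<lambda>x. grad f x $ i))"

definition test_functions :: "(real ^ 'n::finite) set \<Rightarrow> (real ^ 'n \<Rightarrow> real) set" where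
  "test_functions \<Omega> = {\<psi>. (\<forall>m. Ck m \<psi>) \<and> compact (closure {x. \<psi> x \<noteq> 0})
      \<and> closure {x. \<psi> x \<noteq> 0} \<subseteq> \<Omega>}"

definition C1_on :: "(real ^ 'n::finite) set \<Rightarrow> (real ^ 'n \<Rightarrow> real) \<Rightarrow> bool" where
  "C1_on \<Omega> f \<longleftrightarrow> (\<forall>x\<in>\<Omega>. f differentiable (at x)) \<and> continuous_on \<Omega> (grad f)"

section \<open>Variable exponent Sobolev spaces\<close>

definition Lp_var ::
    "(real ^ 'n::finite \<Rightarrow> real) \<Rightarrow> (real ^ 'n) set \<Rightarrow> (real ^ 'n \<Rightarrow> 'b::real_normed_vector) set" where
  "Lp_var p K = {f. set_borel_measurable lebesgue K f \<and>
      (\<exists>\<mu>>0. set_integrable lebesgue K (\<lambda>x. (norm (f x) / \<mu>) powr p x))}"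

definition Lp_var_loc ::
    "(real ^ 'n::finite \<Rightarrow> real) \<Rightarrow> (real ^ 'n) set \<Rightarrow> (real ^ 'n \<Rightarrow> 'b::real_normed_vector) set" where
  "Lp_var_loc p \<Omega> = {f. \<forall>K. compact K \<and> K \<subseteq> \<Omega> \<longrightarrow> f \<in> Lp_var p K}"

definition has_weak_gradient ::
    "(real ^ 'n::finite) set \<Rightarrow> (real ^ 'n \<Rightarrow> real) \<Rightarrow> (real ^ 'n \<Rightarrow> real ^ 'n) \<Rightarrow> bool" where
  "has_weak_gradient \<Omega> u g \<longleftrightarrow>
     (\<forall>K. compact K \<and> K \<subseteq> \<Omega> \<longrightarrow> set_integrable lebesgue K u \<and> set_integrable lebesgue K g) \<and>
     (\<forall>\<phi>\<in>test_functions \<Omega>. \<forall>i.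
        set_lebesgue_integral lebesgue \<Omega> (\<lambda>x. u x * grad \<phi> x $ i)
          = - set_lebesgue_integral lebesgue \<Omega> (\<lambda>x. g x $ i * \<phi> x))"

text \<open>\<open>W1p_loc p \<Omega> u Du\<close>: \<open>u\<close> belongs to the local Sobolev space with exponent \<open>p\<close> and has
  weak gradient \<open>Du\<close>, which is unique up to null sets.\<close>

definition W1p_loc ::
    "(real ^ 'n::finite \<Rightarrow> real) \<Rightarrow> (real ^ 'n) set \<Rightarrow> (real ^ 'n \<Rightarrow> real) \<Rightarrow> (real ^ 'n \<Rightarrow> real ^ 'n) \<Rightarrow> bool" where
  "W1p_loc p \<Omega> u Du \<longleftrightarrow>
     has_weak_gradient \<Omega> u Du \<and> u \<in> Lp_var_loc p \<Omega> \<and> Du \<in> Lp_var_loc p \<Omega>"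

section \<open>The \<open>p(x)\<close>-Laplace equation\<close>

text \<open>Since \<open>0 powr a = 0\<close>, the integrand vanishes where \<open>Du = 0\<close>, also for \<open>p(x) \<le> 2\<close>.\<close>

definition px_energy ::
    "(real ^ 'n::finite \<Rightarrow> real) \<Rightarrow> (real ^ 'n) set \<Rightarrow> (real ^ 'n \<Rightarrow> real ^ 'n) \<Rightarrow> (real ^ 'n \<Rightarrow> real) \<Rightarrow> real" where
  "px_energy p \<Omega> Du \<psi> = set_lebesgue_integral lebesgue \<Omega>
     (\<lambda>x. ((norm (Du x) powr (p x - 2)) *\<^sub>R Du x) \<bullet> grad \<psi> x)"

definition weak_subsolution ::
    "(real ^ 'n::finite \<Rightarrow> real) \<Rightarrow> (real ^ 'n) set \<Rightarrow> (real ^ 'n \<Rightarrow> real) \<Rightarrow> bool" where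
  "weak_subsolution p \<Omega> u \<longleftrightarrow> (\<exists>Du. W1p_loc p \<Omega> u Du \<and>
     (\<forall>\<psi>\<in>test_functions \<Omega>. (\<forall>x. \<psi> x \<ge> 0) \<longrightarrow> px_energy p \<Omega> Du \<psi> \<le> 0))"

definition weak_solution ::
    "(real ^ 'n::finite \<Rightarrow> real) \<Rightarrow> (real ^ 'n) set \<Rightarrow> (real ^ 'n \<Rightarrow> real) \<Rightarrow> bool" where
  "weak_solution p \<Omega> u \<longleftrightarrow> (\<exists>Du. W1p_loc p \<Omega> u Du \<and>
     (\<forall>\<psi>\<in>test_functions \<Omega>. px_energy p \<Omega> Du \<psi> = 0))"

definition usc_on :: "(real ^ 'n::finite) set \<Rightarrow> (real ^ 'n \<Rightarrow> real) \<Rightarrow> bool" where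
  "usc_on \<Omega> u \<longleftrightarrow> (\<forall>x\<in>\<Omega>. Limsup (at x within \<Omega>) (\<lambda>y. ereal (u y)) \<le> ereal (u x))"

text \<open>
  Elements of a Sobolev space are functions modulo null sets; the upper semicontinuous
  representative of a weak subsolution is the one given by its essential upper limit,
  \<open>u(x) = ess limsup\<^bsub>y \<rightarrow> x\<^esub> u(y)\<close>. Without fixing it, raising the function \<open>0\<close> at a
  single point would give another upper semicontinuous weak subsolution, and no pointwise
  maximum principle could hold.
\<close>

definition ess_limsup_on :: "(real ^ 'n::finite) set \<Rightarrow> (real ^ 'n \<Rightarrow> real) \<Rightarrow> real ^ 'n \<Rightarrow> ereal" where
  "ess_limsup_on \<Omega> u x =
     (INF r\<in>{0<..}. esssup (lebesgue_on (\<Omega> \<inter> ball x r)) (\<lambda>y. ereal (u y)))"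

definition px_subharmonic ::
    "(real ^ 'n::finite \<Rightarrow> real) \<Rightarrow> (real ^ 'n) set \<Rightarrow> (real ^ 'n \<Rightarrow> real) \<Rightarrow> bool" where
  "px_subharmonic p \<Omega> u \<longleftrightarrow> usc_on \<Omega> u \<and> (\<forall>x\<in>\<Omega>. ereal (u x) = ess_limsup_on \<Omega> u x)
     \<and> weak_subsolution p \<Omega> u"

definition px_harmonic ::
    "(real ^ 'n::finite \<Rightarrow> real) \<Rightarrow> (real ^ 'n) set \<Rightarrow> (real ^ 'n \<Rightarrow> real) \<Rightarrow> bool" where
  "px_harmonic p \<Omega> u \<longleftrightarrow> continuous_on \<Omega> u \<and> weak_solution p \<Omega> u"

section \<open>The quantities \<open>\<parallel>Dp\<parallel>\<close>, \<open>D(R)\<close>, \<open>M(R)\<close>, \<open>M'(R)\<close>\<close>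

text \<open>Extended-real valued, since the supremum may be infinite; note \<open>a / \<infinity> = 0\<close> and
  \<open>a / 0 = \<infinity>\<close> for \<open>a > 0\<close> in \<open>ereal\<close>.\<close>

definition Dp_norm :: "'n::finite \<Rightarrow> (real ^ 'n \<Rightarrow> real) \<Rightarrow> real ^ 'n \<Rightarrow> ereal" where
  "Dp_norm k p x = (SUP y\<in>{y \<in> half_space k. y $ k = x $ k}. ereal (norm (grad p y)))"

definition D_set :: "'n::finite \<Rightarrow> (real \<Rightarrow> real) \<Rightarrow> real \<Rightarrow> (real ^ 'n) set" where
  "D_set k \<gamma> R = {x \<in> half_space k.
     (\<Sum>i\<in>UNIV - {k}. (x $ i)\<^sup>2) + (x $ k + \<gamma> R)\<^sup>2 < (R + \<gamma> R)\<^sup>2}"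

definition bdry_ext :: "'n::finite \<Rightarrow> (real ^ 'n \<Rightarrow> real) \<Rightarrow> real ^ 'n \<Rightarrow> ereal" where
  "bdry_ext k u y = (if y \<in> half_space k then ereal (u y)
     else Limsup (at y within half_space k) (\<lambda>x. ereal (u x)))"

definition M_sup :: "'n::finite \<Rightarrow> (real \<Rightarrow> real) \<Rightarrow> (real ^ 'n \<Rightarrow> real) \<Rightarrow> real \<Rightarrow> ereal" where
  "M_sup k \<gamma> u R = (SUP y\<in>frontier (D_set k \<gamma> R). bdry_ext k u y)"

definition M_deriv :: "'n::finite \<Rightarrow> (real \<Rightarrow> real) \<Rightarrow> (real ^ 'n \<Rightarrow> real) \<Rightarrow> real \<Rightarrow> ereal" where
  "M_deriv k \<gamma> u R =
     Liminf (at_right 0) (\<lambda>h. (M_sup k \<gamma> u R - M_sup k \<gamma> u (R - h)) / ereal h)"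

section \<open>The extremal function\<close>

definition A_int :: "(real \<Rightarrow> real) \<Rightarrow> (real \<Rightarrow> real) \<Rightarrow> real \<Rightarrow> real" where
  "A_int C lam t = integral {0..t} (\<lambda>s. C s / lam s)"

definition f_nu :: "(real \<Rightarrow> real) \<Rightarrow> (real \<Rightarrow> real) \<Rightarrow> real \<Rightarrow> real \<Rightarrow> real" where
  "f_nu C lam \<nu> t = (if \<nu> \<le> 1 then \<nu> powr exp (A_int C lam t) else \<nu> powr exp (- A_int C lam t))"

definition u_check ::
    "'n::finite \<Rightarrow> (real \<Rightarrow> real) \<Rightarrow> (real \<Rightarrow> real) \<Rightarrow> real \<Rightarrow> real ^ 'n \<Rightarrow> real" where
  "u_check k C lam \<nu> x = integral {0..x $ k} (f_nu C lam \<nu>)"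

definition p_check ::
    "'n::finite \<Rightarrow> (real \<Rightarrow> real) \<Rightarrow> (real \<Rightarrow> real) \<Rightarrow> real \<Rightarrow> real \<Rightarrow> real ^ 'n \<Rightarrow> real" where
  "p_check k C lam \<nu> M\<^sub>0 x =
     (if \<nu> \<le> 1 then 1 + M\<^sub>0 * exp (- A_int C lam (x $ k)) else 1 + M\<^sub>0 * exp (A_int C lam (x $ k)))"

text \<open>The principal value is taken at the singularity \<open>t = 0\<close>.\<close>

definition Ei :: "real \<Rightarrow> real" where
  "Ei z = Lim (at_right 0)
     (\<lambda>\<epsilon>. set_lebesgue_integral lborel {t. t \<le> z \<and> \<bar>t\<bar> \<ge> \<epsilon>} (\<lambda>t. exp t / t))"

end

theory Submission
  imports Defs
begin

text \<open>
  The function of part (a) has \<open>|Du|\<^sup>p\<^sup>-\<^sup>1\<close> constant, so its flux is a constant vector field and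
  has integral zero against every gradient of a test function.

  For part (b), fix \<open>R\<close> and let \<open>\<rho>\<close> be the distance to the centre of the ball defining \<open>D(R)\<close>, minus
  \<open>\<gamma>(R)\<close>. Expanding \<open>div (|Dw|\<^sup>p\<^sup>-\<^sup>2 Dw)\<close> for \<open>w = \<phi> \<circ> \<rho>\<close> with \<open>\<phi>' = exp g\<close>, \<open>g \<le> 0\<close>, and using the bounds on
  \<open>Dp\<close> and \<open>x\<^sub>n \<le> \<rho>\<close>, one sees that \<open>w\<close> is a supersolution in \<open>D(R)\<close> as soon as
  \<open>g' \<le> - (\<epsilon> - g) / \<lambda>(\<rho>)\<close>, where \<open>\<epsilon> = n \<Lambda>(R) / \<gamma>(R)\<close> absorbs the curvature term. Starting from
  \<open>g(0) \<le> log \<nu>\<close>, the solution keeps \<open>\<phi>\<close> below the extremal function, while the growth condition on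
  \<open>\<gamma>\<close> bounds \<open>\<epsilon> exp (\<integral>\<^sub>0\<^sup>R 1/\<lambda>)\<close> and hence keeps \<open>\<phi>'(R)\<close> above a constant multiple of \<open>f\<^sub>\<nu>(R)\<close>. If
  \<open>M(R) \<le> \<phi>(R)\<close>, comparison would put \<open>u\<close> below the extremal function on the axis, so \<open>M(R) > \<phi>(R)\<close>.
  Adding the positive constant \<open>M(R) - \<phi>(R)\<close> to \<open>w\<close> keeps it a supersolution that dominates \<open>u\<close> on the
  boundary; comparing once more on \<open>\<partial>D(R - h)\<close> gives \<open>M(R) - M(R - h) \<ge> \<phi>(R) - \<phi>(R - h) \<ge> h \<phi>'(R)\<close>.

  The comparison principle must be run with smooth test functions only. For \<open>z = u - w\<close> one tests with
  \<open>H(z\<^sub>e - \<eta>)\<close>, where \<open>z\<^sub>e\<close> is a mollification and \<open>H(t) = exp (-1/t)\<close> for \<open>t > 0\<close>; since \<open>p\<close> is locally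
  Lipschitz, mollification is controlled by the modular of the variable exponent space, and one may pass
  to the limit by dominated convergence. Strict monotonicity of the flux yields \<open>Dz = 0\<close> where \<open>z > \<eta>\<close>.
\<close>

section \<open>Smooth functions and a flat cutoff\<close>

text \<open>The double exponential comes from a linear equation for the logarithm g of the slope.
  The flux of w is exp ((p - 1) g) times the unit radial field e, and its divergence, up to that
  positive factor, is (n - 1) / r + (p - 1) g' + g (e . Dp). The last term, absent for constant p,
  may have the wrong sign; as g \<le> 0 and |Dp| \<le> (p - 1) / lambda, it is at most -g (p - 1) /
  lambda. So g' has to be proportional to g, and g = log \<nu> exp (integral of 1 / lambda) is the
  limiting case. The curvature (n - 1) / r carries no factor p - 1, hence p - 1 must also be bounded
  below: if N is the norm of Dp on the slice through x, then (p - 1) / lambda \<ge> N \<ge> 1 /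
  Lambda. This is the origin of \<epsilon>. In the comparison principle the flux is controlled only
  through the p-modular, so L^1 convergence of mollified gradients is not enough. A pointwise Jensen
  inequality bounds |D z_e|^p by a mollification of |Dz|^p, and radii with errors 2^(-j) provide
  that mollification with an integrable majorant.\<close>

lemma grad_nth_eq: "(f has_derivative f') (at x) \<Longrightarrow> grad f x $ i = f' (axis i 1)"
  by (simp add: grad_def frechet_derivative_at[symmetric])

lemma has_derivative_grad:
  fixes f :: "real ^ 'n::finite \<Rightarrow> real"
  shows "f differentiable (at x) \<Longrightarrow> (f has_derivative (\<lambda>v. grad f x \<bullet> v)) (at x)"
proof -
  assume "f differentiable (at x)"
  then have d: "(f has_derivative frechet_derivative f (at x)) (at x)"
    by (simp add: frechet_derivative_works)
  have lin: "linear (frechet_derivative f (at x))"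
    using d has_derivative_linear by blast
  have "frechet_derivative f (at x) v = grad f x \<bullet> v" for v :: "real^'n"
  proof -
    have "frechet_derivative f (at x) v = frechet_derivative f (at x) (\<Sum>i\<in>UNIV. v $ i *\<^sub>R axis i 1)"
      by (simp add: basis_expansion scalar_mult_eq_scaleR[symmetric])
    also have "\<dots> = (\<Sum>i\<in>UNIV. v $ i * frechet_derivative f (at x) (axis i 1))"
      by (simp add: linear_sum[OF lin] linear_scale[OF lin])
    finally show ?thesis by (simp add: grad_def inner_vec_def mult.commute)
  qed
  then have "frechet_derivative f (at x) = (\<lambda>v. grad f x \<bullet> v)" by auto
  then show ?thesis using d by simp
qed

lemma grad_eqI: "(f has_derivative (\<lambda>v. a \<bullet> v)) (at x) \<Longrightarrow> grad f x = a"
  by (simp add: vec_eq_iff grad_nth_eq inner_axis)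

lemma grad_add:
  "f differentiable (at x) \<Longrightarrow> g differentiable (at x) \<Longrightarrow> grad (\<lambda>x. f x + g x) x = grad f x + grad g x"
  by (intro grad_eqI) (auto intro!: derivative_eq_intros has_derivative_grad simp: inner_add_left)

lemma grad_diff:
  "f differentiable (at x) \<Longrightarrow> g differentiable (at x) \<Longrightarrow> grad (\<lambda>x. f x - g x) x = grad f x - grad g x"
  by (intro grad_eqI) (auto intro!: derivative_eq_intros has_derivative_grad simp: inner_diff_left)

lemma grad_mult:
  "f differentiable (at x) \<Longrightarrow> g differentiable (at x) \<Longrightarrow>
    grad (\<lambda>x. f x * g x) x = f x *\<^sub>R grad g x + g x *\<^sub>R grad f x"
  by (intro grad_eqI) (auto intro!: derivative_eq_intros has_derivative_grad simp: inner_add_left)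

lemma grad_compose:
  assumes "f differentiable (at x)" "(h has_real_derivative h') (at (f x))"
  shows "((\<lambda>x. h (f x)) has_derivative (\<lambda>v. (h' *\<^sub>R grad f x) \<bullet> v)) (at x)"
    "grad (\<lambda>x. h (f x)) x = h' *\<^sub>R grad f x"
proof -
  have "((\<lambda>x. h (f x)) has_derivative (\<lambda>v. h' * (grad f x \<bullet> v))) (at x)"
    using has_derivative_compose[OF has_derivative_grad[OF assms(1)] assms(2)[unfolded has_field_derivative_def]]
    by simp
  then show "((\<lambda>x. h (f x)) has_derivative (\<lambda>v. (h' *\<^sub>R grad f x) \<bullet> v)) (at x)" by simp
  then show "grad (\<lambda>x. h (f x)) x = h' *\<^sub>R grad f x" by (rule grad_eqI)
qed

lemma grad_eq_0_outside:
  assumes "open U" "x \<in> U" "\<And>y. y \<in> U \<Longrightarrow> f y = 0"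
  shows "f differentiable (at x)" "grad f x = 0"
proof -
  have "(f has_derivative (\<lambda>v. 0 \<bullet> v)) (at x)"
    by (rule has_derivative_transform_within_open[of "\<lambda>_. 0", OF _ assms(1,2)]) (use assms(3) in auto)
  then show "f differentiable (at x)" "grad f x = 0"
    by (auto simp: differentiable_def intro!: grad_eqI)
qed

section \<open>Closure properties of the classes \<open>Ck\<close>\<close>

lemma Ck_SucD: "Ck (Suc m) f \<Longrightarrow> Ck m f"
proof (induction m arbitrary: f)
  case 0
  then show ?case
    by (auto simp: continuous_on_eq_continuous_at differentiable_imp_continuous_within)
next
  case (Suc m)
  then show ?case by (metis Ck.simps(2))
qed

lemma Ck_imp_continuous: "Ck m f \<Longrightarrow> continuous_on UNIV f"
  by (induction m) (use Ck_SucD in \<open>auto simp del: Ck.simps(2)\<close>)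

lemma Ck_const [simp]: "Ck m (\<lambda>_ :: real ^ 'n::finite. c)"
proof (induction m arbitrary: c)
  case (Suc m)
  have "grad (\<lambda>_. c) x = 0" for x :: "real^'n" by (intro grad_eqI) simp
  then show ?case using Suc[of 0] by simp
qed simp

lemma Ck_add: "Ck m f \<Longrightarrow> Ck m g \<Longrightarrow> Ck m (\<lambda>x. f x + g x)"
  by (induction m arbitrary: f g) (auto simp: grad_add intro: continuous_intros)

lemma Ck_mult: "Ck m f \<Longrightarrow> Ck m g \<Longrightarrow> Ck m (\<lambda>x. f x * g x)"
proof (induction m arbitrary: f g)
  case (Suc m)
  have "Ck m (\<lambda>x. grad (\<lambda>x. f x * g x) x $ i)" for i
    using Suc.prems Ck_SucD[OF Suc.prems(1)] Ck_SucD[OF Suc.prems(2)]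
    by (simp add: grad_mult) (intro Ck_add Suc.IH, auto)
  then show ?case using Suc.prems by (auto intro: differentiable_mult)
qed (auto intro: continuous_intros)

lemma Ck_sum: "finite I \<Longrightarrow> (\<And>i. i \<in> I \<Longrightarrow> Ck m (f i)) \<Longrightarrow> Ck m (\<lambda>x. \<Sum>i\<in>I. f i x)"
  by (induction I rule: finite_induct) (auto intro: Ck_add)

lemma has_derivative_nth: "((\<lambda>x. x $ i) has_derivative (\<lambda>v. axis i 1 \<bullet> v)) (at (x :: real ^ 'n::finite))"
  by (auto simp: inner_axis inner_commute intro!: bounded_linear_imp_has_derivative bounded_linear_vec_nth)

lemma Ck_nth: "Ck m (\<lambda>x :: real ^ 'n::finite. x $ i)"
proof (cases m)
  case (Suc m')
  have d: "((\<lambda>x. x $ i) has_derivative (\<lambda>v. axis i 1 \<bullet> v)) (at x)" for x :: "real^'n"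
    by (rule has_derivative_nth)
  then show ?thesis using Suc by (auto simp: grad_eqI[OF d] differentiable_def intro: d)
qed (simp add: continuous_on_component)

text \<open>The chain rule replaces \<open>H j\<close> by \<open>H (Suc j)\<close>, so the outer
  function has to be a whole sequence of successive derivatives and the induction has to range over
  all \<open>j\<close>.\<close>

lemma Ck_compose:
  assumes H: "\<And>j t. (H j has_real_derivative H (Suc j) t) (at t)"
  shows "Ck m f \<Longrightarrow> Ck m (\<lambda>x. H j (f x))"
proof (induction m arbitrary: j)
  case 0
  have "continuous_on UNIV (H j)"
    using H by (meson DERIV_isCont continuous_at_imp_continuous_on)
  then show ?case using 0 continuous_on_compose2 by fastforce
next
  case (Suc m)
  have "Ck m (\<lambda>x. grad (\<lambda>x. H j (f x)) x $ i)" for i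
    using Suc.prems Suc.IH[OF Ck_SucD[OF Suc.prems], of "Suc j"]
    by (simp add: grad_compose(2)[OF _ H]) (intro Ck_mult, auto)
  moreover have "(\<lambda>x. H j (f x)) differentiable (at x)" for x
    using grad_compose(1)[OF _ H] Suc.prems unfolding differentiable_def
    by (metis Ck.simps(2) differentiable_def)
  ultimately show ?case by auto
qed

section \<open>Smooth functions vanishing to infinite order at 0\<close>

definition flat :: "real poly \<Rightarrow> real \<Rightarrow> real" where
  "flat q t = (if t > 0 then poly q (1 / t) * exp (- (1 / t)) else 0)"

lemma poly_times_exp_tendsto_0: "((\<lambda>y::real. poly q y * exp (- y)) \<longlongrightarrow> 0) at_top"
proof -
  have "((\<lambda>y. \<Sum>i\<le>degree q. coeff q i * (y ^ i / exp y)) \<longlongrightarrow> (\<Sum>i\<le>degree q. coeff q i * 0)) at_top"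
    by (intro tendsto_intros tendsto_power_div_exp_0)
  then show ?thesis by (simp add: poly_altdef sum_distrib_right exp_minus divide_inverse mult.assoc)
qed

text \<open>With y = 1/t, differentiating q(y) e^(-y) gives y^2 (q - q')(y) e^(-y), which is again a
  \<open>flat\<close> function. Iterating this step from q = 1 produces every derivative of exp
  (-1/t), collected in \<open>bump\<close>.\<close>

lemma flat_has_derivative:
  "(flat q has_real_derivative flat ([:0,0,1:] * (q - pderiv q)) t) (at t)"
proof -
  consider "t > 0" | "t < 0" | "t = 0" by linarith
  then show ?thesis
  proof cases
    case 1
    have "((\<lambda>t. poly q (1 / t) * exp (- (1 / t))) has_real_derivative
        flat ([:0,0,1:] * (q - pderiv q)) t) (at t)"
      using 1 by (auto intro!: derivative_eq_intros DERIV_chain2[OF poly_DERIV] simp: flat_def field_simps power2_eq_square)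
    then show ?thesis
      by (rule has_field_derivative_transform_within_open[where S="{0<..}"]) (use 1 in \<open>auto simp: flat_def\<close>)
  next
    case 2
    have "((\<lambda>_. 0) has_real_derivative 0) (at t)" by simp
    then have "(flat q has_real_derivative 0) (at t)"
      by (rule has_field_derivative_transform_within_open[where S="{..<0}"]) (use 2 in \<open>auto simp: flat_def\<close>)
    then show ?thesis using 2 by (simp add: flat_def)
  next
    case 3
    \<comment> \<open>The difference quotient \<open>flat q h / h\<close> is y q(y) e^(-y) with y =
      1/h, and \<open>pCons 0 q\<close> is the polynomial y q(y).\<close>
    have "((\<lambda>h. poly (pCons 0 q) (inverse h) * exp (- (inverse h))) \<longlongrightarrow> 0) (at_right 0)"
      using poly_times_exp_tendsto_0 filterlim_inverse_at_top_right by (rule filterlim_compose)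
    then have "((\<lambda>h. flat q h / h) \<longlongrightarrow> 0) (at_right 0)"
      by (rule Lim_transform_eventually) (auto simp: eventually_at_right_field flat_def field_simps intro!: exI[of _ 1])
    moreover have "((\<lambda>h. flat q h / h) \<longlongrightarrow> 0) (at_left 0)"
      by (rule Lim_transform_eventually[OF tendsto_const])
         (auto simp: eventually_at_left_field flat_def intro!: exI[of _ "-1"])
    ultimately have "((\<lambda>h. flat q h / h) \<longlongrightarrow> 0) (at 0)"
      by (simp add: filterlim_split_at)
    then show ?thesis using 3 by (simp add: DERIV_def flat_def)
  qed
qed

definition bump :: "nat \<Rightarrow> real \<Rightarrow> real" where
  "bump j = flat (((\<lambda>q. [:0,0,1:] * (q - pderiv q)) ^^ j) [:1:])"

lemma bump_has_derivative: "(bump j has_real_derivative bump (Suc j) t) (at t)"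
  unfolding bump_def using flat_has_derivative by simp

lemma bump_0: "bump 0 t = (if t > 0 then exp (- (1 / t)) else 0)"
  by (simp add: bump_def flat_def)

lemma bump_1: "bump (Suc 0) t = (if t > 0 then (1 / t)\<^sup>2 * exp (- (1 / t)) else 0)"
  by (simp add: bump_def flat_def power2_eq_square pderiv_pCons)

lemma bump_nonpos: "t \<le> 0 \<Longrightarrow> bump j t = 0"
  by (simp add: bump_def flat_def)

text \<open>With y = 1/t, e^y \<ge> y^2 / 2 gives y^2 e^(-y) \<le> 2. The uniform bound enters the
  majorants under which mollified test functions pass to the limit.\<close>

lemma bump_1_bounds: "0 \<le> bump (Suc 0) t" "bump (Suc 0) t \<le> 2"
proof -
  show "0 \<le> bump (Suc 0) t" by (simp add: bump_1)
  have "(1 / t)\<^sup>2 * exp (- (1 / t)) \<le> 2" if "t > 0"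
  proof -
    have "1 + 1/t + (1/t)\<^sup>2 / 2 \<le> exp (1/t)" using that by (intro exp_lower_Taylor_quadratic) simp
    then have "(1/t)\<^sup>2 \<le> 2 * exp (1/t)" using that
      by (smt (verit) divide_pos_pos field_sum_of_halves)
    then have "(1/t)\<^sup>2 * exp (- (1/t)) \<le> 2 * exp (1/t) * exp (- (1/t))"
      by (intro mult_right_mono) auto
    also have "\<dots> = 2" by (simp add: mult.assoc flip: exp_add)
    finally show ?thesis .
  qed
  then show "bump (Suc 0) t \<le> 2" by (simp add: bump_1)
qed

lemma continuous_bump: "continuous_on S (bump j)"
  by (meson DERIV_isCont bump_has_derivative continuous_at_imp_continuous_on)

section \<open>Integration by parts\<close>

lemma DERIV_along_axis:
  assumes "f differentiable (at (x + t *\<^sub>R axis i 1))"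
  shows "((\<lambda>t. f (x + t *\<^sub>R axis i 1)) has_real_derivative grad f (x + t *\<^sub>R axis i 1) $ i) (at t)"
proof -
  have "((\<lambda>t. x + t *\<^sub>R axis i 1) has_derivative (\<lambda>s. s *\<^sub>R axis i 1)) (at t)"
    by (auto intro!: derivative_eq_intros)
  from has_derivative_compose[OF this has_derivative_grad[OF assms]]
  have "((\<lambda>t. f (x + t *\<^sub>R axis i 1)) has_derivative
      (\<lambda>s. grad f (x + t *\<^sub>R axis i 1) \<bullet> (s *\<^sub>R axis i 1))) (at t)" .
  moreover have "(\<lambda>s. grad f (x + t *\<^sub>R axis i 1) \<bullet> (s *\<^sub>R axis i 1)) = (\<lambda>s. grad f (x + t *\<^sub>R axis i 1) $ i * s)"
    by (auto simp: inner_axis)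
  ultimately show ?thesis by (simp only: has_field_derivative_def)
qed

lemma integral_lborel_translate:
  fixes f :: "'a::euclidean_space \<Rightarrow> real"
  assumes "f \<in> borel_measurable borel"
  shows "(\<integral>x. f (x + c) \<partial>lborel) = (\<integral>x. f x \<partial>lborel)"
proof -
  have "(\<integral>x. f x \<partial>lborel) = (\<integral>x. f x \<partial>distr lborel borel ((+) c))"
    by (simp add: lborel_distr_plus)
  also have "\<dots> = (\<integral>x. f (c + x) \<partial>lborel)"
    using assms by (subst integral_distr) auto
  finally show ?thesis by (simp add: add.commute)
qed

text \<open>Difference quotients of \<open>f\<close> along the axis have integral zero by
  translation invariance of Lebesgue measure, and they converge to the partial derivative under a
  common majorant.\<close>

lemma integral_grad_eq_0:
  fixes f :: "real ^ 'n::finite \<Rightarrow> real"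
  assumes diff: "\<And>x. f differentiable (at x)" and cont: "continuous_on UNIV (\<lambda>x. grad f x $ i)"
    and supp: "\<And>x. norm x > r \<Longrightarrow> f x = 0"
  shows "(\<integral>x. grad f x $ i \<partial>lebesgue) = 0"
proof -
  let ?e = "axis i 1 :: real ^ 'n"
  have contf: "continuous_on UNIV f"
    using diff by (simp add: continuous_on_eq_continuous_at differentiable_imp_continuous_within)
  have zero: "grad f x = 0" if "norm x > r" for x
    by (rule grad_eq_0_outside(2)[of "{x. norm x > r}"]) (use that supp in \<open>auto intro: open_Collect_less continuous_intros\<close>)
  have "bounded ((\<lambda>x. grad f x $ i) ` cball 0 r)"
    by (intro compact_imp_bounded compact_continuous_image continuous_on_subset[OF cont]) auto
  then obtain B0 where B0: "\<And>x. norm x \<le> r \<Longrightarrow> \<bar>grad f x $ i\<bar> \<le> B0"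
    by (force simp: bounded_iff)
  define B where "B = max B0 0"
  have B: "\<bar>grad f x $ i\<bar> \<le> B" for x
    using B0[of x] zero[of x] by (cases "norm x \<le> r") (auto simp: B_def)
  \<comment> \<open>Step lengths at most 1 keep all difference quotients supported in the ball of
    radius r + 1, so a multiple of its indicator dominates them.\<close>
  define h :: "nat \<Rightarrow> real" where "h = (\<lambda>m. inverse (real (Suc m)))"
  have h: "h m > 0" "h m \<le> 1" for m by (auto simp: h_def field_simps)
  define q where "q = (\<lambda>m x. (f (x + h m *\<^sub>R ?e) - f x) / h m)"
  have q_bound: "\<bar>q m x\<bar> \<le> B * indicator (cball 0 (r + 1)) x" for m x
  proof (cases "norm x \<le> r + 1")
    case True
    obtain z where "f (x + h m *\<^sub>R ?e) - f (x + 0 *\<^sub>R ?e) = (h m - 0) * grad f (x + z *\<^sub>R ?e) $ i"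
      using MVT2[OF h(1)[of m], of "\<lambda>t. f (x + t *\<^sub>R ?e)" "\<lambda>t. grad f (x + t *\<^sub>R ?e) $ i"]
        DERIV_along_axis[OF diff] by blast
    then show ?thesis using True h[of m] B by (simp add: q_def)
  next
    case False
    have "norm x \<le> norm (x + h m *\<^sub>R ?e) + norm (h m *\<^sub>R ?e)"
      by (metis add_diff_cancel_right' norm_triangle_ineq4)
    then have "norm (x + h m *\<^sub>R ?e) > r" using False h[of m] by (simp add: norm_axis_1)
    then show ?thesis using False supp by (simp add: q_def)
  qed
  have "(\<lambda>m. \<integral>x. q m x \<partial>lborel) \<longlonglongrightarrow> (\<integral>x. grad f x $ i \<partial>lborel)"
  proof (rule integral_dominated_convergence)
    show "(\<lambda>x. grad f x $ i) \<in> borel_measurable lborel" 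
      using cont by (simp add: borel_measurable_continuous_onI)
    show "q m \<in> borel_measurable lborel" for m
      unfolding q_def measurable_lborel2
      by (intro borel_measurable_continuous_onI continuous_intros continuous_on_compose2[OF contf])
         (use h(1)[of m] in auto)
    show "integrable lborel (\<lambda>x. B * indicator (cball 0 (r + 1)) x :: real)"
      by (intro integrable_mult_right integrable_real_indicator) (use emeasure_lborel_cball_finite[of 0 "r + 1"] in \<open>auto simp: less_top\<close>)
    show "AE x in lborel. norm (q m x) \<le> B * indicator (cball 0 (r + 1)) x" for m
      using q_bound by simp
    have lim: "(\<lambda>m. q m x) \<longlonglongrightarrow> grad f x $ i" for x
    proof -
      have "((\<lambda>t. (f (x + (0 + t) *\<^sub>R ?e) - f (x + 0 *\<^sub>R ?e)) / t) \<longlongrightarrow> grad f (x + 0 *\<^sub>R ?e) $ i) (at 0)"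
        using DERIV_along_axis[where f=f and x=x and t=0 and i=i, OF diff] unfolding DERIV_def .
      moreover have "filterlim h (at 0) sequentially"
        unfolding filterlim_at h_def using LIMSEQ_inverse_real_of_nat by auto
      ultimately show ?thesis
        using filterlim_compose[of "\<lambda>t. (f (x + t *\<^sub>R ?e) - f x) / t" _ "at 0" h sequentially]
        by (simp add: q_def)
    qed
    then show "AE x in lborel. (\<lambda>m. q m x) \<longlonglongrightarrow> grad f x $ i" by simp
  qed
  moreover have "(\<integral>x. q m x \<partial>lborel) = 0" for m
  proof -
    have bm: "f \<in> borel_measurable borel" using contf by (rule borel_measurable_continuous_onI)
    have int: "integrable lborel f"
    proof -
      have "integrable lborel (\<lambda>x. indicator (cball 0 r) x *\<^sub>R f x)"
        by (intro borel_integrable_compact continuous_on_subset[OF contf]) auto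
      then show ?thesis
        by (rule Bochner_Integration.integrable_cong[THEN iffD1, rotated -1]) (use supp in \<open>auto simp: indicator_def not_le\<close>)
    qed
    have int2: "integrable lborel (\<lambda>x. f (x + h m *\<^sub>R ?e))"
    proof -
      have "integrable (distr lborel borel ((+) (h m *\<^sub>R ?e))) f" using int by (simp add: lborel_distr_plus)
      then show ?thesis using bm by (subst (asm) integrable_distr_eq) (auto simp: add.commute)
    qed
    show ?thesis using integral_lborel_translate[OF bm, of "h m *\<^sub>R ?e"] int int2 by (simp add: q_def)
  qed
  ultimately have "(\<integral>x. grad f x $ i \<partial>lborel) = 0" by (simp add: LIMSEQ_const_iff)
  then show ?thesis
    using cont by (simp add: integral_completion borel_measurable_continuous_onI)
qed

section \<open>Test functions and integration by parts against them\<close>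

lemma test_functionsD:
  assumes "\<psi> \<in> test_functions \<Omega>"
  shows "\<psi> differentiable (at x)" "continuous_on UNIV \<psi>" "continuous_on UNIV (grad \<psi>)"
    "x \<notin> closure {x. \<psi> x \<noteq> 0} \<Longrightarrow> \<psi> x = 0" "x \<notin> closure {x. \<psi> x \<noteq> 0} \<Longrightarrow> grad \<psi> x = 0"
    "compact (closure {x. \<psi> x \<noteq> 0})" "closure {x. \<psi> x \<noteq> 0} \<subseteq> \<Omega>"
proof -
  have c: "Ck m \<psi>" for m using assms by (simp add: test_functions_def)
  show "compact (closure {x. \<psi> x \<noteq> 0})" "closure {x. \<psi> x \<noteq> 0} \<subseteq> \<Omega>"
    using assms by (auto simp: test_functions_def)
  show "\<psi> differentiable (at x)" using c[of 1] by simp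
  show "continuous_on UNIV \<psi>" using c Ck_imp_continuous by blast
  have "continuous_on UNIV (\<lambda>x. grad \<psi> x $ i)" for i using c[of 1] by simp
  then have "continuous_on UNIV (\<lambda>x. \<chi> i. grad \<psi> x $ i)" by (intro continuous_on_vec_lambda)
  then show "continuous_on UNIV (grad \<psi>)" by simp
  show z: "\<psi> x = 0" if "x \<notin> closure {x. \<psi> x \<noteq> 0}" for x
    using that closure_subset[of "{x. \<psi> x \<noteq> 0}"] by auto
  show "grad \<psi> x = 0" if "x \<notin> closure {x. \<psi> x \<noteq> 0}"
    by (rule grad_eq_0_outside(2)[of "- closure {x. \<psi> x \<noteq> 0}", OF _ _ z]) (use that in auto)
qed

lemma test_functions_mono: "\<Omega> \<subseteq> \<Omega>' \<Longrightarrow> \<psi> \<in> test_functions \<Omega> \<Longrightarrow> \<psi> \<in> test_functions \<Omega>'"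
  by (auto simp: test_functions_def)

lemma set_integrable_compact_continuous:
  fixes g :: "'a::euclidean_space \<Rightarrow> 'b::{banach, second_countable_topology}"
  assumes "compact S" "continuous_on S g"
  shows "set_integrable lebesgue S g"
  using borel_integrable_compact[OF assms] unfolding set_integrable_def
  by (intro integrable_completion[THEN iffD2]) auto

lemma set_integrable_compact_support:
  fixes g :: "'a::euclidean_space \<Rightarrow> 'b::{banach, second_countable_topology}"
  assumes "compact S" "S \<subseteq> \<Omega>" "continuous_on S g" "\<And>x. x \<in> \<Omega> - S \<Longrightarrow> g x = 0"
  shows "set_integrable lebesgue \<Omega> g"
proof -
  have "(\<lambda>x. indicator \<Omega> x *\<^sub>R g x) = (\<lambda>x. indicator S x *\<^sub>R g x)"
    using assms(2,4) by (fastforce simp: indicator_def)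
  then show ?thesis using set_integrable_compact_continuous[OF assms(1,3)] by (simp add: set_integrable_def)
qed

text \<open>\<open>f\<close> is differentiable on \<Omega> only, but its product with \<psi>
  vanishes off the support of \<psi>. As \<Omega> and the complement of that support cover the
  space, the product is globally C^1 and the integral of its derivative is zero.\<close>

lemma set_integral_by_parts:
  fixes f :: "real ^ 'n::finite \<Rightarrow> real"
  assumes "open \<Omega>" and diff: "\<And>x. x \<in> \<Omega> \<Longrightarrow> f differentiable (at x)"
    and cont: "continuous_on \<Omega> (\<lambda>x. grad f x $ i)" and \<psi>: "\<psi> \<in> test_functions \<Omega>"
  shows "set_lebesgue_integral lebesgue \<Omega> (\<lambda>x. f x * grad \<psi> x $ i)
     = - set_lebesgue_integral lebesgue \<Omega> (\<lambda>x. grad f x $ i * \<psi> x)"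
proof -
  note t = test_functionsD[OF \<psi>]
  define S where "S = closure {x. \<psi> x \<noteq> 0}"
  define P where "P = (\<lambda>x. f x * \<psi> x)"
  have S: "compact S" "S \<subseteq> \<Omega>" using t(6,7) by (auto simp: S_def)
  have oS: "open (- S)" unfolding S_def by (intro open_Compl closed_closure)
  have z: "\<psi> x = 0" "grad \<psi> x = 0" if "x \<notin> S" for x
    using t(4,5)[of x] that unfolding S_def by blast+
  have contf: "continuous_on \<Omega> f"
    using diff by (simp add: continuous_at_imp_continuous_on differentiable_imp_continuous_within)
  have PS: "P differentiable (at x)" "grad P x = 0" if "x \<notin> S" for x
    using grad_eq_0_outside[of "- S" x P] oS that z by (auto simp: P_def)
  have P\<Omega>: "P differentiable (at x)" "grad P x $ i = f x * grad \<psi> x $ i + grad f x $ i * \<psi> x" if "x \<in> \<Omega>" for x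
    using diff[OF that] t(1) by (auto simp: P_def grad_mult intro: differentiable_mult)
  have "continuous_on (\<Omega> \<union> - S) (\<lambda>x. grad P x $ i)"
  proof (rule continuous_on_open_Un[OF \<open>open \<Omega>\<close> oS])
    have "continuous_on \<Omega> (\<lambda>x. f x * grad \<psi> x $ i + grad f x $ i * \<psi> x)"
      by (intro continuous_intros contf cont continuous_on_subset[OF t(2)] continuous_on_subset[OF t(3)]) auto
    then show "continuous_on \<Omega> (\<lambda>x. grad P x $ i)"
      by (rule continuous_on_eq) (simp add: P\<Omega>)
    show "continuous_on (- S) (\<lambda>x. grad P x $ i)"
      by (rule continuous_on_eq[of _ "\<lambda>_. 0"]) (auto simp: PS)
  qed
  moreover have "\<Omega> \<union> - S = UNIV" using S(2) by auto
  ultimately have c: "continuous_on UNIV (\<lambda>x. grad P x $ i)" by simp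
  obtain r where r: "\<And>x. x \<in> S \<Longrightarrow> norm x \<le> r" using compact_imp_bounded[OF S(1)] by (auto simp: bounded_iff)
  have P_diff: "P differentiable (at x)" for x using PS(1)[of x] P\<Omega>(1)[of x] S(2) by blast
  have P_supp: "P x = 0" if "norm x > r" for x
    using r[of x] z(1)[of x] that by (auto simp: P_def)
  have "0 = (\<integral>x. grad P x $ i \<partial>lebesgue)"
    by (rule integral_grad_eq_0[symmetric, OF P_diff c P_supp])
  also have "\<dots> = set_lebesgue_integral lebesgue \<Omega> (\<lambda>x. f x * grad \<psi> x $ i + grad f x $ i * \<psi> x)"
    unfolding set_lebesgue_integral_def
  proof (rule Bochner_Integration.integral_cong[OF refl])
    show "grad P x $ i = indicator \<Omega> x *\<^sub>R (f x * grad \<psi> x $ i + grad f x $ i * \<psi> x)" for x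
    proof (cases "x \<in> \<Omega>")
      case False
      then have "x \<notin> S" using S(2) by blast
      then have "grad P x = 0" by (rule PS(2))
      then show ?thesis using False by simp
    qed (simp add: P\<Omega>(2))
  qed
  also have "\<dots> = set_lebesgue_integral lebesgue \<Omega> (\<lambda>x. f x * grad \<psi> x $ i)
     + set_lebesgue_integral lebesgue \<Omega> (\<lambda>x. grad f x $ i * \<psi> x)"
    by (intro set_integral_add set_integrable_compact_support[OF S] continuous_intros 
        continuous_on_subset[OF contf S(2)] continuous_on_subset[OF cont S(2)] continuous_on_subset[OF t(2)] 
        continuous_on_subset[OF t(3)]) (auto simp: z)
  finally show ?thesis by simp
qed

section \<open>Convolution and mollification\<close>

lemma uniformly_continuous_compact_support:
  fixes F :: "'a::euclidean_space \<Rightarrow> 'b::real_normed_vector"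
  assumes "continuous_on UNIV F" "\<And>x. norm x > r \<Longrightarrow> F x = 0"
  shows "uniformly_continuous_on UNIV F"
  unfolding uniformly_continuous_on_def
proof (intro allI impI)
  fix e :: real assume "e > 0"
  have "uniformly_continuous_on (cball 0 (r + 1)) F"
    by (intro compact_uniformly_continuous continuous_on_subset[OF assms(1)]) auto
  then obtain d where d: "d > 0"
    "\<And>x x'. x \<in> cball 0 (r + 1) \<Longrightarrow> x' \<in> cball 0 (r + 1) \<Longrightarrow> dist x' x < d \<Longrightarrow> dist (F x') (F x) < e"
    unfolding uniformly_continuous_on_def using \<open>e > 0\<close> by metis
  have "dist (F x') (F x) < e" if "dist x' x < min d 1" for x x'
  proof (cases "norm x \<le> r + 1 \<and> norm x' \<le> r + 1")
    case True
    then show ?thesis using d that by simp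
  next
    case False
    have "\<bar>norm x' - norm x\<bar> < 1"
      using that norm_triangle_ineq3[of x' x] by (simp add: dist_norm)
    then have "norm x > r" "norm x' > r" using False by linarith+
    then show ?thesis using assms(2) \<open>e > 0\<close> by simp
  qed
  then show "\<exists>d>0. \<forall>x\<in>UNIV. \<forall>x'\<in>UNIV. dist x' x < d \<longrightarrow> dist (F x') (F x) < e"
    using d(1) by (intro exI[of _ "min d 1"]) auto
qed

lemma bounded_compact_support:
  fixes F :: "'a::euclidean_space \<Rightarrow> 'b::real_normed_vector"
  assumes "continuous_on UNIV F" "\<And>x. norm x > r \<Longrightarrow> F x = 0"
  obtains B where "B > 0" "\<And>x. norm (F x) \<le> B"
proof -
  have "bounded (F ` cball 0 r)"
    by (intro compact_imp_bounded compact_continuous_image continuous_on_subset[OF assms(1)]) auto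
  then obtain B where "\<And>x. norm x \<le> r \<Longrightarrow> norm (F x) \<le> B" by (force simp: bounded_iff)
  then have "norm (F x) \<le> max B 1" for x
    using assms(2)[of x] by (cases "norm x \<le> r") (auto simp: le_max_iff_disj)
  then show ?thesis using that[of "max B 1"] by auto
qed

text \<open>The integral is taken with respect to \<open>lebesgue\<close>, since the second factor
  will be a Sobolev function or gradient component cut off by an indicator, which is merely Lebesgue
  measurable.\<close>

definition conv :: "('a::euclidean_space \<Rightarrow> real) \<Rightarrow> ('a \<Rightarrow> real) \<Rightarrow> 'a \<Rightarrow> real" where
  "conv \<kappa> g x = (\<integral>y. \<kappa> (x - y) * g y \<partial>lebesgue)"

lemma integrable_bounded_mult:
  fixes \<kappa> g :: "'a::euclidean_space \<Rightarrow> real"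
  assumes "integrable lebesgue g" "continuous_on UNIV \<kappa>" "\<And>y. \<bar>\<kappa> y\<bar> \<le> e"
  shows "integrable lebesgue (\<lambda>y. \<kappa> y * g y)" "\<bar>\<integral>y. \<kappa> y * g y \<partial>lebesgue\<bar> \<le> e * (\<integral>y. \<bar>g y\<bar> \<partial>lebesgue)"
proof -
  have m: "\<kappa> \<in> borel_measurable lebesgue"
    using assms(2) by (intro measurable_completion) (simp add: borel_measurable_continuous_onI)
  show i: "integrable lebesgue (\<lambda>y. \<kappa> y * g y)"
    using assms(1)
    by (rule Bochner_Integration.integrable_bound[OF integrable_mult_right[of e] , OF integrable_norm])
       (use m assms in \<open>auto simp: abs_mult intro!: mult_mono AE_I2 order_trans[OF _ abs_ge_self] abs_ge_zero\<close>)
  have "\<bar>\<integral>y. \<kappa> y * g y \<partial>lebesgue\<bar> \<le> (\<integral>y. \<bar>\<kappa> y * g y\<bar> \<partial>lebesgue)" by (rule integral_abs_bound)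
  also have "\<dots> \<le> (\<integral>y. e * \<bar>g y\<bar> \<partial>lebesgue)"
    using assms(3) by (intro integral_mono integrable_abs[OF i] integrable_mult_right integrable_abs[OF assms(1)])
      (auto simp: abs_mult intro!: mult_right_mono)
  finally show "\<bar>\<integral>y. \<kappa> y * g y \<partial>lebesgue\<bar> \<le> e * (\<integral>y. \<bar>g y\<bar> \<partial>lebesgue)" by simp
qed

lemma continuous_on_reflect:
  fixes \<kappa> :: "'a::euclidean_space \<Rightarrow> 'b::real_normed_vector"
  shows "continuous_on UNIV \<kappa> \<Longrightarrow> continuous_on UNIV (\<lambda>y. \<kappa> (x - y))"
  by (rule continuous_on_compose2) (auto intro: continuous_intros)

lemma conv_integrand_integrable:
  fixes \<kappa> g :: "'a::euclidean_space \<Rightarrow> real"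
  assumes "integrable lebesgue g" "continuous_on UNIV \<kappa>" "\<And>x. norm x > r \<Longrightarrow> \<kappa> x = 0"
  shows "integrable lebesgue (\<lambda>y. \<kappa> (x - y) * g y)"
proof -
  obtain B where "\<And>x. \<bar>\<kappa> x\<bar> \<le> B"
    using bounded_compact_support[OF assms(2,3)] by (metis real_norm_def)
  then show ?thesis
    by (intro integrable_bounded_mult(1)[OF assms(1), of _ B] continuous_on_reflect assms(2))
qed

lemma continuous_conv:
  assumes g: "integrable lebesgue g" and \<kappa>: "continuous_on UNIV \<kappa>" "\<And>x. norm x > r \<Longrightarrow> \<kappa> x = 0"
  shows "continuous_on UNIV (conv \<kappa> g)"
  unfolding continuous_on_iff
proof (intro ballI allI impI)
  fix x :: 'a and e :: real assume "e > 0"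
  define G where "G = (\<integral>y. \<bar>g y\<bar> \<partial>lebesgue)"
  have G: "G \<ge> 0" by (simp add: G_def)
  \<comment> \<open>The denominator \<open>G + 1\<close> instead of \<open>G\<close> covers the case
    that \<open>g\<close> vanishes almost everywhere.\<close>
  obtain d where d: "d > 0" "\<And>x x'. dist x' x < d \<Longrightarrow> dist (\<kappa> x') (\<kappa> x) < e / (G + 1)"
    using uniformly_continuous_compact_support[OF \<kappa>] \<open>e > 0\<close> G
    unfolding uniformly_continuous_on_def by (metis UNIV_I add_nonneg_pos divide_pos_pos zero_less_one)
  have "dist (conv \<kappa> g x') (conv \<kappa> g x) < e" if "dist x' x < d" for x'
  proof -
    have "conv \<kappa> g x' - conv \<kappa> g x = (\<integral>y. (\<kappa> (x' - y) - \<kappa> (x - y)) * g y \<partial>lebesgue)"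
      using conv_integrand_integrable[OF g \<kappa>] by (simp add: conv_def left_diff_distrib)
    moreover have "\<bar>\<integral>y. (\<kappa> (x' - y) - \<kappa> (x - y)) * g y \<partial>lebesgue\<bar> \<le> e / (G + 1) * G"
      unfolding G_def
    proof (rule integrable_bounded_mult(2)[OF g])
      show "continuous_on UNIV (\<lambda>y. \<kappa> (x' - y) - \<kappa> (x - y))"
        using \<kappa>(1) by (intro continuous_on_diff continuous_on_reflect)
      show "\<bar>\<kappa> (x' - y) - \<kappa> (x - y)\<bar> \<le> e / ((\<integral>y. \<bar>g y\<bar> \<partial>lebesgue) + 1)" for y
        using d(2)[of "x' - y" "x - y"] that by (simp add: dist_norm G_def)
    qed
    moreover have "e / (G + 1) * G < e" using G \<open>e > 0\<close> by (simp add: field_simps)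
    ultimately show ?thesis by (simp add: dist_norm)
  qed
  then show "\<exists>d>0. \<forall>x'\<in>UNIV. dist x' x < d \<longrightarrow> dist (conv \<kappa> g x') (conv \<kappa> g x) < e"
    using d(1) by blast
qed

text \<open>Uniform continuity of the kernel's gradient makes its linearization error a small
  multiple of the increment, uniformly in the base point; integrating that error against
  \<open>g\<close> costs only the L^1 norm of \<open>g\<close>.\<close>

lemma conv_has_derivative:
  fixes \<kappa> g :: "real ^ 'n::finite \<Rightarrow> real"
  assumes g: "integrable lebesgue g" and diff: "\<And>x. \<kappa> differentiable (at x)"
    and cont: "continuous_on UNIV (grad \<kappa>)" and supp: "\<And>x. norm x > r \<Longrightarrow> \<kappa> x = 0"
  shows "(conv \<kappa> g has_derivative (\<lambda>v. (\<chi> i. conv (\<lambda>z. grad \<kappa> z $ i) g x) \<bullet> v)) (at x)"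
  unfolding has_derivative_at_alt
proof (intro conjI allI impI)
  show "bounded_linear (\<lambda>v. (\<chi> i. conv (\<lambda>z. grad \<kappa> z $ i) g x) \<bullet> v)"
    by (rule bounded_linear_inner_right)
  fix e :: real assume "e > 0"
  define G where "G = (\<integral>y. \<bar>g y\<bar> \<partial>lebesgue)"
  have G: "G \<ge> 0" by (simp add: G_def)
  have cont\<kappa>: "continuous_on UNIV \<kappa>"
    using diff by (simp add: continuous_on_eq_continuous_at differentiable_imp_continuous_within)
  have supp': "grad \<kappa> x = 0" if "norm x > r" for x
    by (rule grad_eq_0_outside(2)[of "{x. norm x > r}"]) (use that supp in \<open>auto intro: open_Collect_less continuous_intros\<close>)
  have ints: "integrable lebesgue (\<lambda>y. \<kappa> (x - y) * g y)" for x
    by (rule conv_integrand_integrable[OF g cont\<kappa> supp])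
  have intg: "integrable lebesgue (\<lambda>y. grad \<kappa> (x - y) $ i * g y)" for x i
    by (rule conv_integrand_integrable[OF g, of "\<lambda>z. grad \<kappa> z $ i" r])
       (auto simp: supp' intro!: continuous_on_component cont)
  obtain d where d: "d > 0" "\<And>x x'. dist x' x < d \<Longrightarrow> dist (grad \<kappa> x') (grad \<kappa> x) < e / (G + 1)"
    using uniformly_continuous_compact_support[OF cont supp'] \<open>e > 0\<close> G
    unfolding uniformly_continuous_on_def by (metis UNIV_I add_nonneg_pos divide_pos_pos zero_less_one)
  have lin: "\<bar>\<kappa> (a + v) - \<kappa> a - grad \<kappa> a \<bullet> v\<bar> \<le> e / (G + 1) * norm v" if v: "norm v < d" for a v
  proof -
    have "norm (\<kappa> (a + v) - \<kappa> a - grad \<kappa> a \<bullet> ((a + v) - a)) \<le> norm ((a + v) - a) * (e / (G + 1))"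
    proof (rule differentiable_bound_linearization[where S="closed_segment a (a + v)" and f'="\<lambda>z w. grad \<kappa> z \<bullet> w"])
      show "(\<kappa> has_derivative (\<lambda>w. grad \<kappa> z \<bullet> w)) (at z within closed_segment a (a + v))" for z
        using has_derivative_grad[OF diff] by (rule has_derivative_at_withinI)
      show "a + t *\<^sub>R ((a + v) - a) \<in> closed_segment a (a + v)" if "t \<in> {0..1}" for t
        using that by (auto simp: in_segment algebra_simps intro!: exI[of _ t])
      fix z assume "z \<in> closed_segment a (a + v)"
      then have "dist z a \<le> norm v"
        using dist_in_closed_segment[of z a "a + v"] by (simp add: dist_norm norm_minus_commute)
      then have dz: "norm (grad \<kappa> z - grad \<kappa> a) \<le> e / (G + 1)" using d(2)[of z a] v by (simp add: dist_norm)
      show "onorm ((\<lambda>w. grad \<kappa> z \<bullet> w) - (\<lambda>w. grad \<kappa> a \<bullet> w)) \<le> e / (G + 1)"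
        unfolding fun_diff_def
      proof (rule onorm_bound)
        show "0 \<le> e / (G + 1)" using dz norm_ge_zero order_trans by blast
        show "norm (grad \<kappa> z \<bullet> w - grad \<kappa> a \<bullet> w) \<le> e / (G + 1) * norm w" for w
          using Cauchy_Schwarz_ineq2[of "grad \<kappa> z - grad \<kappa> a" w] mult_right_mono[OF dz norm_ge_zero[of w]]
          by (simp add: inner_diff_left)
      qed
    qed auto
    then show ?thesis by (simp add: mult.commute)
  qed
  have "norm (conv \<kappa> g y - conv \<kappa> g x - (\<chi> i. conv (\<lambda>z. grad \<kappa> z $ i) g x) \<bullet> (y - x)) \<le> e * norm (y - x)"
    if y: "norm (y - x) < d" for y
  proof -
    define v where "v = y - x"
    have "(\<chi> i. conv (\<lambda>z. grad \<kappa> z $ i) g x) \<bullet> v = (\<Sum>i\<in>UNIV. (\<integral>z. grad \<kappa> (x - z) $ i * g z * v $ i \<partial>lebesgue))"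
      by (simp add: inner_vec_def conv_def)
    also have "\<dots> = (\<integral>z. (\<Sum>i\<in>UNIV. grad \<kappa> (x - z) $ i * g z * v $ i) \<partial>lebesgue)"
      by (rule Bochner_Integration.integral_sum[symmetric]) (intro integrable_mult_left intg)
    also have "\<dots> = (\<integral>z. (grad \<kappa> (x - z) \<bullet> v) * g z \<partial>lebesgue)"
      by (simp add: inner_vec_def sum_distrib_left mult_ac)
    finally have i: "(\<chi> i. conv (\<lambda>z. grad \<kappa> z $ i) g x) \<bullet> v = (\<integral>z. (grad \<kappa> (x - z) \<bullet> v) * g z \<partial>lebesgue)" .
    have "integrable lebesgue (\<lambda>z. (\<Sum>i\<in>UNIV. grad \<kappa> (x - z) $ i * g z * v $ i))"
      by (intro Bochner_Integration.integrable_sum integrable_mult_left intg)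
    then have ig: "integrable lebesgue (\<lambda>z. (grad \<kappa> (x - z) \<bullet> v) * g z)"
      by (simp add: inner_vec_def sum_distrib_left mult_ac)
    have "conv \<kappa> g y - conv \<kappa> g x - (\<chi> i. conv (\<lambda>z. grad \<kappa> z $ i) g x) \<bullet> v
      = (\<integral>z. (\<kappa> (y - z) - \<kappa> (x - z) - grad \<kappa> (x - z) \<bullet> v) * g z \<partial>lebesgue)"
      unfolding i unfolding conv_def using ig ints by (simp add: left_diff_distrib)
    moreover have "\<bar>\<integral>z. (\<kappa> (y - z) - \<kappa> (x - z) - grad \<kappa> (x - z) \<bullet> v) * g z \<partial>lebesgue\<bar> \<le> (e / (G + 1) * norm v) * G"
      unfolding G_def
    proof (rule integrable_bounded_mult(2)[OF g])
      show "continuous_on UNIV (\<lambda>z. \<kappa> (y - z) - \<kappa> (x - z) - grad \<kappa> (x - z) \<bullet> v)"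
        using cont\<kappa> cont by (intro continuous_intros continuous_on_reflect)
      show "\<bar>\<kappa> (y - z) - \<kappa> (x - z) - grad \<kappa> (x - z) \<bullet> v\<bar> \<le> e / ((\<integral>y. \<bar>g y\<bar> \<partial>lebesgue) + 1) * norm v" for z
        using lin[of v "x - z"] y by (simp add: v_def G_def)
    qed
    moreover have "(e / (G + 1) * norm v) * G \<le> e * norm v"
    proof -
      have "e / (G + 1) * G \<le> e" using G \<open>e > 0\<close> by (simp add: field_simps)
      then have "(e / (G + 1) * G) * norm v \<le> e * norm v" by (rule mult_right_mono) simp
      then show ?thesis by (simp add: mult_ac)
    qed
    ultimately show ?thesis by (simp add: v_def)
  qed
  then show "\<exists>d>0. \<forall>y. norm (y - x) < d \<longrightarrow>
      norm (conv \<kappa> g y - conv \<kappa> g x - (\<chi> i. conv (\<lambda>z. grad \<kappa> z $ i) g x) \<bullet> (y - x)) \<le> e * norm (y - x)"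
    using d(1) by blast
qed

lemma Ck_1D:
  assumes "Ck (Suc m) f"
  shows "f differentiable (at x)" "continuous_on UNIV (grad f)"
proof -
  show "f differentiable (at x)" using assms by simp
  have "continuous_on UNIV (\<lambda>x. grad f x $ i)" for i using assms Ck_imp_continuous by auto
  then have "continuous_on UNIV (\<lambda>x. \<chi> i. grad f x $ i)" by (intro continuous_on_vec_lambda)
  then show "continuous_on UNIV (grad f)" by simp
qed

lemma Ck_conv:
  assumes g: "integrable lebesgue g"
  shows "Ck m \<kappa> \<Longrightarrow> (\<And>x. norm x > r \<Longrightarrow> \<kappa> x = 0) \<Longrightarrow> Ck m (conv \<kappa> g)"
proof (induction m arbitrary: \<kappa>)
  case 0
  then show ?case using continuous_conv[OF g] by auto
next
  case (Suc m)
  have d: "(conv \<kappa> g has_derivative (\<lambda>v. (\<chi> i. conv (\<lambda>z. grad \<kappa> z $ i) g x) \<bullet> v)) (at x)" for x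
    using conv_has_derivative[OF g Ck_1D[OF Suc.prems(1)] Suc.prems(2)] .
  have supp': "grad \<kappa> x = 0" if "norm x > r" for x
    by (rule grad_eq_0_outside(2)[of "{x. norm x > r}"]) (use that Suc.prems(2) in \<open>auto intro: open_Collect_less continuous_intros\<close>)
  have "Ck m (conv (\<lambda>z. grad \<kappa> z $ i) g)" for i
    by (rule Suc.IH) (use Suc.prems(1) supp' in auto)
  then show ?case using d by (auto simp: grad_eqI[OF d] differentiable_def)
qed

section \<open>Density of compactly supported continuous functions in L^1\<close>

lemma L1_approx_limit:
  fixes f :: "'a \<Rightarrow> 'b::{banach, second_countable_topology}"
  assumes "integrable M f" "\<And>i. integrable M (s i)" "\<And>x. x \<in> space M \<Longrightarrow> (\<lambda>i. s i x) \<longlonglongrightarrow> f x"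
    "\<And>i x. x \<in> space M \<Longrightarrow> norm (s i x) \<le> 2 * norm (f x)" "e > 0"
  obtains i where "(\<integral>x. norm (s i x - f x) \<partial>M) < e"
proof -
  have "(\<lambda>i. \<integral>x. norm (s i x - f x) \<partial>M) \<longlonglongrightarrow> (\<integral>x. 0 \<partial>M)"
  proof (rule integral_dominated_convergence)
    show "integrable M (\<lambda>x. 3 * norm (f x))" using assms by auto
    show "AE x in M. (\<lambda>i. norm (s i x - f x)) \<longlonglongrightarrow> 0"
      using assms(3) by (auto intro!: AE_I2 tendsto_norm_zero simp: LIM_zero)
    show "AE x in M. norm (norm (s i x - f x)) \<le> 3 * norm (f x)" for i
    proof (rule AE_I2)
      fix x assume "x \<in> space M"
      then show "norm (norm (s i x - f x)) \<le> 3 * norm (f x)"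
        using norm_triangle_ineq4[of "s i x" "f x"] assms(4)[of x i] by simp
    qed
  qed (use assms in auto)
  then have "eventually (\<lambda>i. (\<integral>x. norm (s i x - f x) \<partial>M) < e) sequentially"
    using order_tendstoD(2)[of _ 0 sequentially e] \<open>e > 0\<close> by simp
  then show ?thesis using that by (auto simp: eventually_sequentially)
qed

lemma integrable_compact_support:
  fixes h :: "'a::euclidean_space \<Rightarrow> real"
  assumes "continuous_on UNIV h" "\<And>x. norm x > r \<Longrightarrow> h x = 0"
  shows "integrable lebesgue h" "integrable lborel h"
proof -
  have "integrable lborel (\<lambda>x. indicator (cball 0 r) x *\<^sub>R h x)"
    by (intro borel_integrable_compact continuous_on_subset[OF assms(1)]) auto
  moreover have "(\<lambda>x. indicator (cball 0 r) x *\<^sub>R h x) = h"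
    using assms(2) by (fastforce simp: indicator_def not_le)
  ultimately show "integrable lborel h" by simp
  then show "integrable lebesgue h" 
    using integrable_completion[of h lborel] assms(1) by (simp add: borel_measurable_continuous_onI)
qed

lemma L1_triangle:
  fixes f g h :: "'a \<Rightarrow> real"
  assumes "integrable M f" "integrable M g" "integrable M h"
  shows "(\<integral>x. \<bar>f x - h x\<bar> \<partial>M) \<le> (\<integral>x. \<bar>f x - g x\<bar> \<partial>M) + (\<integral>x. \<bar>g x - h x\<bar> \<partial>M)"
proof -
  have "(\<integral>x. \<bar>f x - h x\<bar> \<partial>M) \<le> (\<integral>x. \<bar>f x - g x\<bar> + \<bar>g x - h x\<bar> \<partial>M)"
    using assms by (intro integral_mono) auto
  then show ?thesis using assms by simp
qed

text \<open>Induction over integrable functions. Indicators of bounded sets are approximated by a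
  Urysohn function squeezed between a closed subset and an open superset of almost the same measure;
  unbounded sets are truncated to balls and treated as a limit.\<close>

lemma continuous_dense_L1:
  fixes g :: "'a::euclidean_space \<Rightarrow> real"
  assumes "integrable lebesgue g" "e > 0"
  obtains h r where "continuous_on UNIV h" "\<And>x. norm x > r \<Longrightarrow> h x = 0" "(\<integral>x. \<bar>g x - h x\<bar> \<partial>lebesgue) < e"
proof -
  define P where "P = (\<lambda>g :: 'a \<Rightarrow> real. \<forall>e>0. \<exists>h r. continuous_on UNIV h \<and> (\<forall>x. norm x > r \<longrightarrow> h x = 0) \<and>
    (\<integral>x. \<bar>g x - h x\<bar> \<partial>lebesgue) < e)"
  \<comment> \<open>The factor 2 in the domination is the one that the limit case of
    \<open>integrable_induct\<close> supplies.\<close>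
  have limit: "P f" if f: "integrable lebesgue f" and s: "\<And>i. integrable lebesgue (s i)" "\<And>i. P (s i)"
    "\<And>x. (\<lambda>i. s i x) \<longlonglongrightarrow> f x" "\<And>i x. norm (s i x) \<le> 2 * norm (f x)" for f s
    unfolding P_def
  proof (intro allI impI)
    fix e :: real assume "e > 0"
    obtain i where i: "(\<integral>x. norm (s i x - f x) \<partial>lebesgue) < e / 2"
      by (rule L1_approx_limit[OF f s(1) s(3) s(4) half_gt_zero[OF \<open>e > 0\<close>]])
    obtain h r where h: "continuous_on UNIV h" "\<forall>x. norm x > r \<longrightarrow> h x = 0" "(\<integral>x. \<bar>s i x - h x\<bar> \<partial>lebesgue) < e / 2"
      using s(2)[of i] half_gt_zero[OF \<open>e > 0\<close>] unfolding P_def by blast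
    have "integrable lebesgue h" using h by (intro integrable_compact_support) auto
    then have "(\<integral>x. \<bar>f x - h x\<bar> \<partial>lebesgue) \<le> (\<integral>x. \<bar>f x - s i x\<bar> \<partial>lebesgue) + (\<integral>x. \<bar>s i x - h x\<bar> \<partial>lebesgue)"
      by (intro L1_triangle f s)
    also have "(\<integral>x. \<bar>f x - s i x\<bar> \<partial>lebesgue) = (\<integral>x. norm (s i x - f x) \<partial>lebesgue)"
      by (simp add: abs_minus_commute)
    finally show "\<exists>h r. continuous_on UNIV h \<and> (\<forall>x. norm x > r \<longrightarrow> h x = 0) \<and> (\<integral>x. \<bar>f x - h x\<bar> \<partial>lebesgue) < e"
      using i h by (intro exI[of _ h] exI[of _ r]) auto
  qed
  have bdd: "P (\<lambda>x. indicator A x *\<^sub>R c)" if A: "A \<in> sets lebesgue" "A \<subseteq> cball 0 (real n)" for A c n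
    unfolding P_def
  proof (intro allI impI)
    fix e :: real assume "e > 0"
    define d where "d = e / (2 * (\<bar>c\<bar> + 1))"
    have d: "d > 0" using \<open>e > 0\<close> by (simp add: d_def)
    obtain T where T: "closed T" "T \<subseteq> A" "A - T \<in> lmeasurable" "emeasure lebesgue (A - T) < ennreal d"
      using sets_lebesgue_inner_closed[OF A(1) d] by blast
    obtain U where U: "open U" "A \<subseteq> U" "U - A \<in> lmeasurable" "emeasure lebesgue (U - A) < ennreal d"
      using sets_lebesgue_outer_open[OF A(1) d] by blast
    \<comment> \<open>Intersecting \<open>U\<close> with a ball gives \<open>f\<close> bounded
      support; \<open>T\<close> stays inside because \<open>A\<close> lies in the ball of radius
      \<open>n\<close>.\<close>
    obtain f :: "'a \<Rightarrow> real" where f: "continuous_on UNIV f" "\<And>x. f x \<in> closed_segment 1 0"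
      "\<And>x. x \<in> T \<Longrightarrow> f x = 1" "\<And>x. x \<in> - (U \<inter> ball 0 (real n + 1)) \<Longrightarrow> f x = 0"
    proof (rule Urysohn[of T "- (U \<inter> ball 0 (real n + 1))" "1::real" 0])
      show "closed T" "closed (- (U \<inter> ball 0 (real n + 1)))" using T U by auto
      have "x \<in> U \<inter> ball 0 (real n + 1)" if "x \<in> T" for x
        using that T(2) U(2) A(2) by fastforce
      then show "T \<inter> - (U \<inter> ball 0 (real n + 1)) = {}" by blast
    qed blast
    have f01: "0 \<le> f x" "f x \<le> 1" for x
      using f(2)[of x] by (auto simp: closed_segment_eq_real_ivl)
    \<comment> \<open>On \<open>T\<close> both \<open>f\<close> and the indicator of
      \<open>A\<close> are 1 and off \<open>U\<close> both are 0, so they differ only on this set,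
      by at most 1.\<close>
    define D where "D = (A - T) \<union> (U - A)"
    have D: "D \<in> lmeasurable" using T U by (simp add: D_def fmeasurable.Un)
    have mD: "measure lebesgue D < 2 * d"
    proof -
      have "measure lebesgue D \<le> measure lebesgue (A - T) + measure lebesgue (U - A)"
        unfolding D_def using T U by (intro measure_Un_le) auto
      moreover have "measure lebesgue (A - T) < d" "measure lebesgue (U - A) < d"
        using T U d by (simp_all add: emeasure_eq_measure2 ennreal_less_iff)
      ultimately show ?thesis by simp
    qed
    have "(\<integral>x. \<bar>indicator A x *\<^sub>R c - f x * c\<bar> \<partial>lebesgue) \<le> (\<integral>x. \<bar>c\<bar> * indicator D x \<partial>lebesgue)"
    proof (rule integral_mono_AE')
      show "integrable lebesgue (\<lambda>x. \<bar>c\<bar> * indicator D x :: real)"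
        using D by (intro integrable_mult_right integrable_real_indicator) (auto simp: fmeasurable_def)
      have "\<bar>indicator A x *\<^sub>R c - f x * c\<bar> \<le> \<bar>c\<bar> * indicator D x" for x
      proof -
        have "\<bar>indicator A x - f x\<bar> \<le> indicator D x"
          using f(3)[of x] f(4)[of x] f01[of x] T(2) U(2) by (auto simp: indicator_def D_def)
        then have "\<bar>c\<bar> * \<bar>indicator A x - f x\<bar> \<le> \<bar>c\<bar> * indicator D x" by (intro mult_left_mono) auto
        then show ?thesis by (simp add: abs_mult[symmetric] algebra_simps)
      qed
      then show "AE x in lebesgue. \<bar>indicator A x *\<^sub>R c - f x * c\<bar> \<le> \<bar>c\<bar> * indicator D x" by simp
    qed auto
    also have "\<dots> = \<bar>c\<bar> * measure lebesgue D" using D by simp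
    also have "\<dots> \<le> \<bar>c\<bar> * (2 * d)" using mD by (intro mult_left_mono) auto
    also have "\<dots> < e" using \<open>e > 0\<close> by (simp add: d_def field_simps)
    finally have *: "(\<integral>x. \<bar>indicator A x *\<^sub>R c - f x * c\<bar> \<partial>lebesgue) < e" .
    show "\<exists>h r. continuous_on UNIV h \<and> (\<forall>x. norm x > r \<longrightarrow> h x = 0) \<and> (\<integral>x. \<bar>indicator A x *\<^sub>R c - h x\<bar> \<partial>lebesgue) < e"
      by (rule exI[of _ "\<lambda>x. f x * c"], rule exI[of _ "real n + 1"])
         (use f(1) f(4) * in \<open>auto intro!: continuous_intros\<close>)
  qed
  have "P g" using assms(1)
  proof (induction g rule: integrable_induct)
    case (base A c)
    show ?case
    proof (rule limit)
      show "integrable lebesgue (\<lambda>x. indicator A x *\<^sub>R c)" using base by simp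
      show "integrable lebesgue (\<lambda>x. indicator (A \<inter> cball 0 (real i)) x *\<^sub>R c)" for i
        using base emeasure_mono[of "A \<inter> cball 0 (real i)" A lebesgue]
        by (intro integrable_scaleR_left integrable_real_indicator) (auto intro: le_less_trans)
      show "P (\<lambda>x. indicator (A \<inter> cball 0 (real i)) x *\<^sub>R c)" for i
        using base by (intro bdd[of _ i]) auto
      show "(\<lambda>i. indicator (A \<inter> cball 0 (real i)) x *\<^sub>R c) \<longlonglongrightarrow> indicator A x *\<^sub>R c" for x
      proof (rule tendsto_eventually)
        obtain N where "norm x \<le> real N" using real_arch_simple by blast
        then show "\<forall>\<^sub>F i in sequentially. indicator (A \<inter> cball 0 (real i)) x *\<^sub>R c = indicator A x *\<^sub>R c"
          by (intro eventually_sequentiallyI[of N]) (auto simp: indicator_def)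
      qed
      show "norm (indicator (A \<inter> cball 0 (real i)) x *\<^sub>R c) \<le> 2 * norm (indicator A x *\<^sub>R c)" for i x
        by (auto simp: indicator_def)
    qed
  next
    case (add f g)
    show ?case unfolding P_def
    proof (intro allI impI)
      fix e :: real assume "e > 0"
      obtain h r where h: "continuous_on UNIV h" "\<forall>x. norm x > r \<longrightarrow> h x = 0" "(\<integral>x. \<bar>f x - h x\<bar> \<partial>lebesgue) < e / 2"
        using add half_gt_zero[OF \<open>e > 0\<close>] unfolding P_def by blast
      obtain h' r' where h': "continuous_on UNIV h'" "\<forall>x. norm x > r' \<longrightarrow> h' x = 0" "(\<integral>x. \<bar>g x - h' x\<bar> \<partial>lebesgue) < e / 2"
        using add half_gt_zero[OF \<open>e > 0\<close>] unfolding P_def by blast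
      have i: "integrable lebesgue h" "integrable lebesgue h'" using h h' by (auto intro!: integrable_compact_support)
      have "(\<integral>x. \<bar>f x + g x - (h x + h' x)\<bar> \<partial>lebesgue) \<le> (\<integral>x. \<bar>f x - h x\<bar> + \<bar>g x - h' x\<bar> \<partial>lebesgue)"
        using add i by (intro integral_mono) auto
      also have "\<dots> = (\<integral>x. \<bar>f x - h x\<bar> \<partial>lebesgue) + (\<integral>x. \<bar>g x - h' x\<bar> \<partial>lebesgue)"
        using add i by simp
      also have "\<dots> < e" using h h' by simp
      finally show "\<exists>h r. continuous_on UNIV h \<and> (\<forall>x. norm x > r \<longrightarrow> h x = 0) \<and> (\<integral>x. \<bar>f x + g x - h x\<bar> \<partial>lebesgue) < e"
        using h h' by (intro exI[of _ "\<lambda>x. h x + h' x"] exI[of _ "max r r'"]) (auto intro: continuous_intros)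
    qed
  next
    case (lim f s)
    show ?case by (rule limit[of f s]) (use lim in auto)
  qed
  then show ?thesis using that assms(2) unfolding P_def by blast
qed

text \<open>Young's inequality for a kernel of mass 1: interchanging the integrations leaves the
  inner integral of the kernel, which is 1.\<close>

lemma conv_L1_bound:
  fixes \<kappa> g :: "'a::euclidean_space \<Rightarrow> real"
  assumes g: "integrable lebesgue g" and \<kappa>: "continuous_on UNIV \<kappa>" "\<And>x. norm x > r \<Longrightarrow> \<kappa> x = 0" "\<And>x. \<kappa> x \<ge> 0"
    and one: "(\<integral>x. \<kappa> x \<partial>lborel) = 1"
  shows "integrable lebesgue (conv \<kappa> g)" "(\<integral>x. \<bar>conv \<kappa> g x\<bar> \<partial>lebesgue) \<le> (\<integral>x. \<bar>g x\<bar> \<partial>lebesgue)"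
proof -
  \<comment> \<open>Fubini requires joint Borel measurability, so \<open>g\<close> is replaced by a
    Borel function equal to it almost everywhere; no value of the convolution changes.\<close>
  obtain g' where g'm [measurable]: "g' \<in> borel_measurable lborel" and eq: "AE x in lborel. g x = g' x"
    using completion_ex_borel_measurable_real[of g lborel] g by blast
  have eq': "AE x in lebesgue. g x = g' x" using AE_completion[OF eq] .
  have \<kappa>m [measurable]: "\<kappa> \<in> borel_measurable borel" using \<kappa>(1) by (rule borel_measurable_continuous_onI)
  have g'i: "integrable lborel g'"
  proof -
    have "integrable lebesgue g'" using g eq' g'm
      by (subst integrable_cong_AE[of _ _ g]) (auto intro: measurable_completion borel_measurable_integrable)
    then show ?thesis using integrable_completion[OF g'm] by simp
  qed
  have conv_eq: "conv \<kappa> g = (\<lambda>x. \<integral>y. \<kappa> (x - y) * g' y \<partial>lborel)"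
  proof
    fix x
    have "conv \<kappa> g x = (\<integral>y. \<kappa> (x - y) * g' y \<partial>lebesgue)"
      unfolding conv_def
    proof (rule integral_cong_AE)
      show "(\<lambda>y. \<kappa> (x - y) * g y) \<in> borel_measurable lebesgue"
        using conv_integrand_integrable[OF g \<kappa>(1,2)] by (rule borel_measurable_integrable)
      show "(\<lambda>y. \<kappa> (x - y) * g' y) \<in> borel_measurable lebesgue" by (rule measurable_completion) simp
    qed (use eq' in auto)
    also have "\<dots> = (\<integral>y. \<kappa> (x - y) * g' y \<partial>lborel)" by (intro integral_completion) simp
    finally show "conv \<kappa> g x = (\<integral>y. \<kappa> (x - y) * g' y \<partial>lborel)" .
  qed
  have shift: "integrable lborel (\<lambda>x. \<kappa> (x - y))" "(\<integral>x. \<kappa> (x - y) \<partial>lborel) = 1" for y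
  proof -
    show "(\<integral>x. \<kappa> (x - y) \<partial>lborel) = 1"
      using integral_lborel_translate[OF \<kappa>m, of "- y"] one by simp
    \<comment> \<open>The Bochner integral of a non-integrable function is 0 by default, so the
      value 1 already proves integrability.\<close>
    then show "integrable lborel (\<lambda>x. \<kappa> (x - y))"
      using not_integrable_integral_eq by fastforce
  qed
  let ?F = "\<lambda>(y, x). \<kappa> (x - y) * g' y"
  have F: "integrable (lborel \<Otimes>\<^sub>M lborel) ?F"
  proof (rule lborel_pair.Fubini_integrable)
    show "?F \<in> borel_measurable (lborel \<Otimes>\<^sub>M lborel)" by measurable
    have "(\<integral>x. norm (?F (y, x)) \<partial>lborel) = \<bar>g' y\<bar>" for y
      using shift(2)[of y] \<kappa>(3) by (simp add: abs_mult)
    then show "integrable lborel (\<lambda>y. \<integral>x. norm (?F (y, x)) \<partial>lborel)" using g'i by simp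
    show "AE y in lborel. integrable lborel (\<lambda>x. ?F (y, x))" using shift(1) by (intro AE_I2) auto
  qed
  have Fn: "integrable (lborel \<Otimes>\<^sub>M lborel) (\<lambda>(y, x). \<bar>\<kappa> (x - y) * g' y\<bar>)"
    using integrable_abs[OF F] by (simp add: case_prod_unfold)
  have i: "integrable lborel (\<lambda>x. \<integral>y. \<kappa> (x - y) * g' y \<partial>lborel)"
    using lborel_pair.integrable_snd[OF F] .
  then show int: "integrable lebesgue (conv \<kappa> g)"
    unfolding conv_eq using integrable_completion borel_measurable_integrable by blast
  have "(\<integral>x. \<bar>conv \<kappa> g x\<bar> \<partial>lebesgue) = (\<integral>x. \<bar>\<integral>y. \<kappa> (x - y) * g' y \<partial>lborel\<bar> \<partial>lborel)"
    unfolding conv_eq using i by (intro integral_completion) (auto dest: borel_measurable_integrable)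
  also have "\<dots> \<le> (\<integral>x. (\<integral>y. \<bar>\<kappa> (x - y) * g' y\<bar> \<partial>lborel) \<partial>lborel)"
    by (intro integral_mono integrable_abs i lborel_pair.integrable_snd[OF Fn] integral_abs_bound)
  also have "\<dots> = (\<integral>y. (\<integral>x. \<bar>\<kappa> (x - y) * g' y\<bar> \<partial>lborel) \<partial>lborel)"
    using lborel_pair.Fubini_integral[OF Fn] .
  also have "\<dots> = (\<integral>y. \<bar>g' y\<bar> \<partial>lborel)"
    using shift(2) \<kappa>(3) by (simp add: abs_mult)
  also have "\<dots> = (\<integral>y. \<bar>g' y\<bar> \<partial>lebesgue)" by (intro integral_completion[symmetric]) simp
  also have "\<dots> = (\<integral>y. \<bar>g y\<bar> \<partial>lebesgue)"
    using eq' g by (intro integral_cong_AE) (auto intro: measurable_completion)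
  finally show "(\<integral>x. \<bar>conv \<kappa> g x\<bar> \<partial>lebesgue) \<le> (\<integral>x. \<bar>g x\<bar> \<partial>lebesgue)" .
qed

lemma kernel_reflect:
  fixes \<kappa> :: "'a::euclidean_space \<Rightarrow> real"
  assumes "continuous_on UNIV \<kappa>" and even: "\<And>x. \<kappa> (- x) = \<kappa> x" and one: "(\<integral>x. \<kappa> x \<partial>lborel) = 1"
  shows "integrable lebesgue (\<lambda>y. \<kappa> (x - y))" "(\<integral>y. \<kappa> (x - y) \<partial>lebesgue) = 1"
proof -
  have \<kappa>m: "\<kappa> \<in> borel_measurable borel" using assms(1) by (rule borel_measurable_continuous_onI)
  have "(\<integral>y. \<kappa> (x - y) \<partial>lebesgue) = (\<integral>y. \<kappa> (x - y) \<partial>lborel)"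
    using \<kappa>m by (intro integral_completion) simp
  also have "\<dots> = (\<integral>y. \<kappa> (y - x) \<partial>lborel)" using even[of "x - y" for y] by simp
  also have "\<dots> = (\<integral>y. \<kappa> y \<partial>lborel)"
    using integral_lborel_translate[OF \<kappa>m, of "- x"] by simp
  finally show "(\<integral>y. \<kappa> (x - y) \<partial>lebesgue) = 1" using one by simp
  then show "integrable lebesgue (\<lambda>y. \<kappa> (x - y))"
    using not_integrable_integral_eq by fastforce
qed

lemma conv_close:
  fixes \<kappa> h :: "'a::euclidean_space \<Rightarrow> real"
  assumes h: "integrable lebesgue h" and \<kappa>: "continuous_on UNIV \<kappa>" "\<And>x. norm x > r \<Longrightarrow> \<kappa> x = 0" "\<And>x. \<kappa> x \<ge> 0"
    and even: "\<And>x. \<kappa> (- x) = \<kappa> x"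
    and one: "(\<integral>x. \<kappa> x \<partial>lborel) = 1" and close: "\<And>y. norm (x - y) \<le> r \<Longrightarrow> \<bar>h y - h x\<bar> \<le> \<eta>"
  shows "\<bar>conv \<kappa> h x - h x\<bar> \<le> \<eta>"
proof -
  note i1 = kernel_reflect(1)[OF \<kappa>(1) even one] and refl = kernel_reflect(2)[OF \<kappa>(1) even one]
  have i2: "integrable lebesgue (\<lambda>y. \<kappa> (x - y) * h y)" by (rule conv_integrand_integrable[OF h \<kappa>(1,2)])
  have "conv \<kappa> h x - h x = (\<integral>y. \<kappa> (x - y) * h y - \<kappa> (x - y) * h x \<partial>lebesgue)"
    using i1 i2 refl by (simp add: conv_def)
  then have "\<bar>conv \<kappa> h x - h x\<bar> \<le> (\<integral>y. \<bar>\<kappa> (x - y) * h y - \<kappa> (x - y) * h x\<bar> \<partial>lebesgue)"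
    using integral_abs_bound by metis
  also have "\<dots> \<le> (\<integral>y. \<kappa> (x - y) * \<eta> \<partial>lebesgue)"
  proof (intro integral_mono integrable_abs Bochner_Integration.integrable_diff i2 integrable_mult_left i1)
    fix y
    have "\<kappa> (x - y) * \<bar>h y - h x\<bar> \<le> \<kappa> (x - y) * \<eta>"
      using close[of y] \<kappa>(2)[of "x - y"] \<kappa>(3)[of "x - y"] by (cases "norm (x - y) \<le> r") (auto intro: mult_left_mono)
    then show "\<bar>\<kappa> (x - y) * h y - \<kappa> (x - y) * h x\<bar> \<le> \<kappa> (x - y) * \<eta>"
      using \<kappa>(3)[of "x - y"] by (simp add: right_diff_distrib[symmetric] abs_mult)
  qed
  also have "\<dots> = \<eta>" using refl by simp
  finally show ?thesis .
qed

section \<open>The standard mollifier\<close>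

definition mol_base :: "real \<Rightarrow> real ^ 'n::finite \<Rightarrow> real" where
  "mol_base e x = bump 0 (1 - (norm x)\<^sup>2 / e\<^sup>2)"

definition mol :: "real \<Rightarrow> real ^ 'n::finite \<Rightarrow> real" where
  "mol e x = mol_base e x / (\<integral>y. mol_base e (y :: real ^ 'n) \<partial>lborel)"

lemma mol_base_zero: "e > 0 \<Longrightarrow> norm x \<ge> e \<Longrightarrow> mol_base e x = 0"
proof -
  assume "e > 0" "norm x \<ge> e"
  then have "e\<^sup>2 \<le> (norm x)\<^sup>2" by (intro power_mono) auto
  then show "mol_base e x = 0" using \<open>e > 0\<close> by (simp add: mol_base_def bump_nonpos)
qed

lemma mol_base_bounds: "0 \<le> mol_base e x" "mol_base e x \<le> 1"
  by (simp_all add: mol_base_def bump_0)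

lemma Ck_mol_base: "Ck m (\<lambda>x. mol_base e (x - a))"
proof -
  \<comment> \<open>The squared norm is a polynomial in the coordinates; the norm itself would not
    be differentiable at the centre.\<close>
  have sq: "(norm (x - a))\<^sup>2 = (\<Sum>i\<in>UNIV. (x $ i + (- a $ i)) * (x $ i + (- a $ i)))" for x
    by (simp add: norm_vec_def L2_set_def sum_nonneg power2_eq_square)
  have "Ck m (\<lambda>x. 1 + (- 1 / e\<^sup>2) * (\<Sum>i\<in>UNIV. (x $ i + (- a $ i)) * (x $ i + (- a $ i))))"
    by (intro Ck_add Ck_mult Ck_sum Ck_nth Ck_const) auto
  then have "Ck m (\<lambda>x. 1 - (norm (x - a))\<^sup>2 / e\<^sup>2)" by (simp add: sq)
  then show ?thesis unfolding mol_base_def by (rule Ck_compose[of bump, OF bump_has_derivative])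
qed

lemma continuous_mol_base: "continuous_on UNIV (mol_base e)"
  using Ck_mol_base[of 0 e 0] by simp

text \<open>On the ball of radius e/2 the argument of \<open>bump 0\<close> is at least 3/4, so the
  integrand is at least exp (-4/3) there. The exact power of e matters: the normalized kernel may
  grow only polynomially in 1/e for the Jensen estimate to survive.\<close>

lemma mol_mass_lower:
  obtains c where "c > 0" "\<And>e. e > 0 \<Longrightarrow> c * e ^ CARD('n) \<le> (\<integral>y. mol_base e (y :: real ^ 'n::finite) \<partial>lborel)"
proof -
  define c where "c = exp (- (4/3)) * unit_ball_vol (real (CARD('n))) * (1/2) ^ CARD('n)"
  have "c > 0" by (simp add: c_def)
  moreover have "c * e ^ CARD('n) \<le> (\<integral>y. mol_base e (y :: real ^ 'n) \<partial>lborel)" if e: "e > 0" for e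
  proof -
    let ?B = "ball (0 :: real ^ 'n) (e / 2)"
    have fin: "emeasure lborel ?B < \<infinity>" using emeasure_lborel_ball_finite[of 0 "e/2"] by simp
    have "(\<integral>y. exp (- (4/3)) * indicator ?B y \<partial>lborel) \<le> (\<integral>y. mol_base e (y :: real ^ 'n) \<partial>lborel)"
    proof (rule integral_mono)
      show "integrable lborel (\<lambda>y. exp (- (4/3)) * indicator ?B y :: real)"
        using fin by (intro integrable_mult_right integrable_real_indicator) auto
      show "integrable lborel (mol_base e :: real ^ 'n \<Rightarrow> real)"
        by (rule integrable_compact_support(2)[OF continuous_mol_base, of e]) (intro mol_base_zero[OF e] less_imp_le)
      fix y :: "real ^ 'n"
      show "exp (- (4/3)) * indicator ?B y \<le> mol_base e y"
      proof (cases "y \<in> ?B")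
        case True
        then have "(norm y)\<^sup>2 \<le> (e / 2)\<^sup>2" by (intro power_mono) auto
        then have "(norm y)\<^sup>2 / e\<^sup>2 \<le> 1 / 4" using e by (simp add: field_simps power2_eq_square)
        then have t: "3 / 4 \<le> 1 - (norm y)\<^sup>2 / e\<^sup>2" by simp
        define s where "s = 1 - (norm y)\<^sup>2 / e\<^sup>2"
        have s: "3 / 4 \<le> s" using t by (simp add: s_def)
        then have "1 / s \<le> 1 / (3 / 4)" by (intro divide_left_mono) auto
        then show ?thesis using True s by (simp add: mol_base_def bump_0 flip: s_def)
      qed (use mol_base_bounds in auto)
    qed
    moreover have "(\<integral>y. exp (- (4/3)) * indicator ?B y \<partial>lborel) = exp (- (4/3)) * measure lborel ?B"
      using fin by simp
    moreover have "measure lborel ?B = unit_ball_vol (real (CARD('n))) * (e / 2) ^ CARD('n)"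
      using e by (subst content_ball) auto
    ultimately show ?thesis by (simp add: c_def power_divide)
  qed
  ultimately show ?thesis using that by blast
qed

lemma mol_props:
  fixes e :: real
  assumes e: "e > 0"
  shows "mol e (x :: real ^ 'n::finite) \<ge> 0" "norm x \<ge> e \<Longrightarrow> mol e x = 0" "mol e (- x) = mol e x"
    "Ck m (\<lambda>y. mol e (y - x))" "continuous_on UNIV (mol e :: real ^ 'n \<Rightarrow> real)" "(\<integral>y. mol e (y :: real ^ 'n) \<partial>lborel) = 1"
proof -
  obtain c where "c > 0" "c * e ^ CARD('n) \<le> (\<integral>y. mol_base e (y :: real ^ 'n) \<partial>lborel)"
    using mol_mass_lower e by metis
  then have N: "(\<integral>y. mol_base e (y :: real ^ 'n) \<partial>lborel) > 0" using e by (smt (verit) mult_pos_pos zero_less_power)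
  show "mol e x \<ge> 0" unfolding mol_def using N mol_base_bounds by (intro divide_nonneg_pos) auto
  show "norm x \<ge> e \<Longrightarrow> mol e x = 0" by (simp add: mol_def mol_base_zero[OF e])
  show "mol e (- x) = mol e x" by (simp add: mol_def mol_base_def)
  show "Ck m (\<lambda>y. mol e (y - x))"
    using Ck_mult[OF Ck_mol_base Ck_const[of m "inverse (\<integral>y. mol_base e (y :: real ^ 'n) \<partial>lborel)"]]
    by (simp add: mol_def divide_inverse)
  show "continuous_on UNIV (mol e :: real ^ 'n \<Rightarrow> real)"
    unfolding mol_def divide_inverse by (intro continuous_intros continuous_mol_base)
  show "(\<integral>y. mol e (y :: real ^ 'n) \<partial>lborel) = 1" using N by (simp add: mol_def)
qed

lemma mol_upper:
  obtains c where "c > 0" "\<And>e x. e > 0 \<Longrightarrow> mol e (x :: real ^ 'n::finite) \<le> c / e ^ CARD('n)"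
proof -
  obtain c where c: "c > 0" "\<And>e. e > 0 \<Longrightarrow> c * e ^ CARD('n) \<le> (\<integral>y. mol_base e (y :: real ^ 'n) \<partial>lborel)"
    using mol_mass_lower by metis
  have "mol e x \<le> (1 / c) / e ^ CARD('n)" if "e > 0" for e and x :: "real ^ 'n"
  proof -
    have "mol e x \<le> 1 / (c * e ^ CARD('n))"
      unfolding mol_def using c that mol_base_bounds[of e x] by (intro frac_le) auto
    then show ?thesis by simp
  qed
  then show ?thesis using that[of "1 / c"] c(1) by simp
qed

text \<open>Mollification contracts L^1 distances, so the claim reduces to a continuous function of
  compact support, where the convergence is uniform.\<close>

lemma conv_mol_L1:
  fixes g :: "real ^ 'n::finite \<Rightarrow> real"
  assumes g: "integrable lebesgue g"
  shows "((\<lambda>e. \<integral>x. \<bar>conv (mol e) g x - g x\<bar> \<partial>lebesgue) \<longlongrightarrow> 0) (at_right 0)"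
proof (rule tendstoI)
  fix d :: real assume d: "d > 0"
  obtain h r0 where h: "continuous_on UNIV h" "\<And>x. norm x > r0 \<Longrightarrow> h x = 0" "(\<integral>x. \<bar>g x - h x\<bar> \<partial>lebesgue) < d / 4"
    using continuous_dense_L1[OF g, of "d / 4"] d by auto
  define r where "r = max r0 0"
  have hr: "h x = 0" if "norm x > r" for x using h(2) that by (simp add: r_def)
  have hi: "integrable lebesgue h" using h hr by (intro integrable_compact_support) auto
  define V where "V = measure lborel (cball (0 :: real ^ 'n) (r + 1))"
  have V: "V \<ge> 0" by (simp add: V_def)
  \<comment> \<open>For e < 1 the error lives in the ball of radius r + 1 and volume V, so a uniform
    error \<eta> contributes at most d/4.\<close>
  define \<eta> where "\<eta> = d / (4 * (V + 1))"
  have \<eta>: "\<eta> > 0" using d V by (simp add: \<eta>_def)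
  obtain \<delta> where \<delta>: "\<delta> > 0" "\<And>x x'. dist x' x < \<delta> \<Longrightarrow> dist (h x') (h x) < \<eta>"
    using uniformly_continuous_compact_support[OF h(1) hr] \<eta>
    unfolding uniformly_continuous_on_def by (metis UNIV_I)
  have "(\<integral>x. \<bar>conv (mol e) g x - g x\<bar> \<partial>lebesgue) < d" if e: "e > 0" "e < min \<delta> 1" for e
  proof -
    note m = mol_props[OF e(1)]
    have m2: "mol e x = 0" if "norm x > e" for x :: "real ^ 'n" using m(2)[of x] that by simp
    note L1 = conv_L1_bound[where r=e, OF _ m(5) m2 m(1) m(6)]
    have gh: "integrable lebesgue (\<lambda>x. g x - h x)" using g hi by simp
    have lin: "conv (mol e) (\<lambda>x. g x - h x) x = conv (mol e) g x - conv (mol e) h x" for x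
      using conv_integrand_integrable[OF g m(5) m2] conv_integrand_integrable[OF hi m(5) m2]
      by (simp add: conv_def right_diff_distrib)
    have 1: "(\<integral>x. \<bar>conv (mol e) g x - conv (mol e) h x\<bar> \<partial>lebesgue) < d / 4"
      using L1(2)[OF gh] h(3) by (simp add: lin)
    have pt: "\<bar>conv (mol e) h x - h x\<bar> \<le> \<eta> * indicator (cball 0 (r + 1)) x" for x
    proof -
      define \<eta>' where "\<eta>' = (if norm x \<le> r + 1 then \<eta> else 0)"
      have "\<bar>conv (mol e) h x - h x\<bar> \<le> \<eta>'"
      proof (rule conv_close[OF hi m(5) m2 m(1) m(3) m(6)])
        fix y assume y: "norm (x - y) \<le> e"
        show "\<bar>h y - h x\<bar> \<le> \<eta>'"
        proof (cases "norm x \<le> r + 1")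
          case True
          then show ?thesis using \<delta>(2)[of y x] y e by (simp add: \<eta>'_def dist_norm norm_minus_commute)
        next
          case False
          have "norm x - norm y \<le> norm (x - y)" by (rule norm_triangle_ineq2)
          then have "norm y > r" using False y e by linarith
          then show ?thesis using hr[of x] hr[of y] False by (simp add: \<eta>'_def)
        qed
      qed
      then show ?thesis by (auto simp: \<eta>'_def split: if_splits)
    qed
    have "(\<integral>x. \<bar>conv (mol e) h x - h x\<bar> \<partial>lebesgue) \<le> (\<integral>x. \<eta> * indicator (cball 0 (r + 1)) (x :: real ^ 'n) \<partial>lebesgue)"
    proof (rule integral_mono)
      have "emeasure lebesgue (cball (0 :: real ^ 'n) (r + 1)) < \<infinity>"
        using emeasure_lborel_cball_finite[of "0 :: real ^ 'n" "r + 1"] by (simp add: less_top)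
      then show "integrable lebesgue (\<lambda>x :: real ^ 'n. \<eta> * indicator (cball 0 (r + 1)) x)"
        by (intro integrable_mult_right integrable_real_indicator) auto
      show "integrable lebesgue (\<lambda>x. \<bar>conv (mol e) h x - h x\<bar>)"
        using L1(1)[OF hi] hi by auto
    qed (rule pt)
    also have "\<dots> = \<eta> * V" by (simp add: V_def measure_completion)
    also have "\<dots> \<le> d / 4" using V d by (simp add: \<eta>_def field_simps)
    finally have 2: "(\<integral>x. \<bar>conv (mol e) h x - h x\<bar> \<partial>lebesgue) \<le> d / 4" .
    have 3: "(\<integral>x. \<bar>h x - g x\<bar> \<partial>lebesgue) < d / 4" using h(3) by (simp add: abs_minus_commute)
    have "(\<integral>x. \<bar>conv (mol e) g x - g x\<bar> \<partial>lebesgue) \<le>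
      (\<integral>x. \<bar>conv (mol e) g x - conv (mol e) h x\<bar> \<partial>lebesgue) + (\<integral>x. \<bar>conv (mol e) h x - g x\<bar> \<partial>lebesgue)"
      by (intro L1_triangle L1(1) g hi)
    moreover have "(\<integral>x. \<bar>conv (mol e) h x - g x\<bar> \<partial>lebesgue) \<le>
      (\<integral>x. \<bar>conv (mol e) h x - h x\<bar> \<partial>lebesgue) + (\<integral>x. \<bar>h x - g x\<bar> \<partial>lebesgue)"
      by (intro L1_triangle L1(1) g hi)
    ultimately show ?thesis using 1 2 3 d by linarith
  qed
  moreover have "eventually (\<lambda>e. e > 0 \<and> e < min \<delta> 1) (at_right (0::real))"
    using eventually_at_right_real[of 0 "min \<delta> 1"] \<delta>(1) by (auto elim!: eventually_mono)
  ultimately show "\<forall>\<^sub>F e in at_right 0. dist (\<integral>x. \<bar>conv (mol e) g x - g x\<bar> \<partial>lebesgue) 0 < d"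
    by (auto elim!: eventually_mono)
qed

section \<open>Mollification in the variable exponent modular\<close>

text \<open>Summable L^1 errors make the sum of all |F_j - f| integrable. Its finiteness almost
  everywhere forces pointwise convergence, and the sum plus |f| is a majorant common to all
  j.\<close>

lemma fast_L1_dominated:
  fixes f :: "'a \<Rightarrow> real"
  assumes f: "integrable M f" and fj: "\<And>j. integrable M (F j)"
    and fast: "\<And>j::nat. (\<integral>x. \<bar>F j x - f x\<bar> \<partial>M) \<le> (1 / 2) ^ j"
  obtains B where "integrable M B" "AE x in M. (\<lambda>j. F j x) \<longlonglongrightarrow> f x \<and> (\<forall>j. \<bar>F j x\<bar> \<le> B x)"
proof -
  have i: "integrable M (\<lambda>x. \<bar>F j x - f x\<bar>)" for j using f fj by auto
  have [measurable]: "(\<lambda>x. \<bar>F j x - f x\<bar>) \<in> borel_measurable M" for j using i by (rule borel_measurable_integrable)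
  have "(\<integral>\<^sup>+x. (\<Sum>j. ennreal \<bar>F j x - f x\<bar>) \<partial>M) = (\<Sum>j. \<integral>\<^sup>+x. ennreal \<bar>F j x - f x\<bar> \<partial>M)"
    by (rule nn_integral_suminf) measurable
  also have "\<dots> = (\<Sum>j. ennreal (\<integral>x. \<bar>F j x - f x\<bar> \<partial>M))"
    using nn_integral_eq_integral[OF i] by simp
  also have "\<dots> \<le> (\<Sum>j. ennreal ((1 / 2) ^ j))"
    using fast by (intro suminf_le summableI ennreal_leI)
  also have "\<dots> = ennreal (\<Sum>j. (1 / 2) ^ j)"
    by (intro suminf_ennreal2) (auto intro: summable_geometric)
  also have "\<dots> < \<infinity>" by simp
  finally have "(\<integral>\<^sup>+x. (\<Sum>j. ennreal \<bar>F j x - f x\<bar>) \<partial>M) \<noteq> \<infinity>" by simp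
  then have "AE x in M. (\<Sum>j. ennreal \<bar>F j x - f x\<bar>) \<noteq> \<infinity>"
    by (intro nn_integral_PInf_AE) measurable
  then have sm: "AE x in M. summable (\<lambda>j. \<bar>F j x - f x\<bar>)"
    by eventually_elim (rule summable_suminf_not_top, auto)
  have int: "integrable M (\<lambda>x. \<Sum>j. \<bar>F j x - f x\<bar>)"
  proof (rule integrable_suminf[OF i])
    show "AE x in M. summable (\<lambda>j. norm \<bar>F j x - f x\<bar>)" using sm by simp
    show "summable (\<lambda>j. \<integral>x. norm \<bar>F j x - f x\<bar> \<partial>M)"
      by (rule summable_comparison_test'[OF summable_geometric[of "1/2::real"], of 0]) (use fast in auto)
  qed
  show ?thesis
  proof (rule that[of "\<lambda>x. \<bar>f x\<bar> + (\<Sum>j. \<bar>F j x - f x\<bar>)"])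
    show "integrable M (\<lambda>x. \<bar>f x\<bar> + (\<Sum>j. \<bar>F j x - f x\<bar>))" using f int by auto
    show "AE x in M. (\<lambda>j. F j x) \<longlonglongrightarrow> f x \<and> (\<forall>j. \<bar>F j x\<bar> \<le> \<bar>f x\<bar> + (\<Sum>j. \<bar>F j x - f x\<bar>))"
      using sm
    proof eventually_elim
      case (elim x)
      have "(\<lambda>j. F j x) \<longlonglongrightarrow> f x"
        using summable_LIMSEQ_zero[OF elim] by (simp add: tendsto_rabs_zero_iff LIM_zero_iff)
      moreover have "\<bar>F j x\<bar> \<le> \<bar>f x\<bar> + (\<Sum>j. \<bar>F j x - f x\<bar>)" for j
      proof -
        have "\<bar>F j x - f x\<bar> \<le> (\<Sum>j. \<bar>F j x - f x\<bar>)"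
          using sum_le_suminf[OF elim, of "{j}"] by simp
        then show ?thesis by linarith
      qed
      ultimately show ?case by simp
    qed
  qed
qed

text \<open>The supporting line of t^q at \<open>a\<close>, obtained from the weighted
  arithmetic-geometric mean inequality with weights 1/q and 1 - 1/q. Averaging it at the mean value
  is Jensen's inequality.\<close>

lemma powr_above_tangent:
  fixes q a t :: real
  assumes "q \<ge> 1" "a > 0" "t \<ge> 0"
  shows "a powr q * (1 + q * (t / a - 1)) \<le> t powr q"
proof (cases "t = 0")
  case True
  have "a powr q * (1 - q) \<le> 0" using assms(1) by (simp add: mult_nonneg_nonpos)
  then show ?thesis using True by simp
next
  case False
  define s where "s = t / a"
  have s: "s > 0" using False assms by (simp add: s_def)
  have "(s powr q) powr (1 / q) * 1 powr (1 - 1 / q) \<le> 1 / q * (s powr q) + (1 - 1 / q) * 1"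
    using assms s by (intro Youngs_inequality_0) auto
  then have "s \<le> 1 / q * (s powr q) + (1 - 1 / q)" using assms s by (simp add: powr_powr)
  then have "q * s \<le> q * (1 / q * (s powr q) + (1 - 1 / q))" using assms by (intro mult_left_mono) auto
  also have "q * (1 / q * (s powr q) + (1 - 1 / q)) = s powr q + q - 1" using assms by (simp add: distrib_left right_diff_distrib)
  finally have "1 + q * (s - 1) \<le> s powr q" by (simp add: algebra_simps)
  then have "a powr q * (1 + q * (s - 1)) \<le> a powr q * s powr q" by (intro mult_left_mono) auto
  also have "\<dots> = t powr q" using assms False by (simp add: s_def powr_mult[symmetric])
  finally show ?thesis by (simp add: s_def)
qed

lemma conv_mol_le:
  fixes g h :: "real ^ 'n::finite \<Rightarrow> real"
  assumes "e > 0" "integrable lebesgue g" "integrable lebesgue h" "\<And>y. norm (x - y) < e \<Longrightarrow> g y \<le> h y"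
  shows "conv (mol e) g x \<le> conv (mol e) h x"
proof -
  note m = mol_props[OF \<open>e > 0\<close>]
  have z: "mol e x = 0" if "norm x > e" for x :: "real ^ 'n"
    by (rule m(2)) (use that in simp)
  show ?thesis unfolding conv_def
  proof (rule integral_mono[OF conv_integrand_integrable[OF assms(2) m(5) z] conv_integrand_integrable[OF assms(3) m(5) z]])
    show "mol e (x - y) * g y \<le> mol e (x - y) * h y" for y
      using assms(4)[of y] m(1)[of "x - y"] m(2)[of "x - y"]
      by (cases "norm (x - y) < e") (auto intro: mult_left_mono)
  qed
qed

lemma conv_mol_le_const:
  fixes g :: "real ^ 'n::finite \<Rightarrow> real"
  assumes "e > 0" "integrable lebesgue g" "\<And>y. norm (x - y) < e \<Longrightarrow> g y \<le> c"
  shows "conv (mol e) g x \<le> c"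
proof -
  note m = mol_props[OF \<open>e > 0\<close>]
  have z: "mol e x = 0" if "norm x > e" for x :: "real ^ 'n"
    by (rule m(2)) (use that in simp)
  note k = kernel_reflect[where x=x, OF m(5) m(3) m(6)]
  have "conv (mol e) g x \<le> (\<integral>y. mol e (x - y) * c \<partial>lebesgue)" unfolding conv_def
  proof (rule integral_mono[OF conv_integrand_integrable[OF assms(2) m(5) z]])
    show "integrable lebesgue (\<lambda>y. mol e (x - y) * c)" using k(1) by simp
    show "mol e (x - y) * g y \<le> mol e (x - y) * c" for y
      using assms(3)[of y] m(1)[of "x - y"] m(2)[of "x - y"]
      by (cases "norm (x - y) < e") (auto intro: mult_left_mono)
  qed
  then show ?thesis using k(2) by simp
qed

lemma conv_mol_nonneg:
  fixes g :: "real ^ 'n::finite \<Rightarrow> real"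
  assumes "e > 0" "\<And>y. g y \<ge> 0"
  shows "conv (mol e) g x \<ge> 0"
  unfolding conv_def
  by (intro Bochner_Integration.integral_nonneg mult_nonneg_nonneg mol_props(1)[OF \<open>e > 0\<close>] assms(2))

lemma conv_mol_le_norm:
  fixes g :: "real ^ 'n::finite \<Rightarrow> real"
  assumes "e > 0" "integrable lebesgue g" "\<And>y. g y \<ge> 0" "\<And>y :: real ^ 'n. mol e y \<le> M"
  shows "conv (mol e) g x \<le> M * (\<integral>y. g y \<partial>lebesgue)"
proof -
  note m = mol_props[OF \<open>e > 0\<close>]
  have "\<bar>mol e (x - y)\<bar> \<le> M" for y using m(1)[of "x - y"] assms(4)[of "x - y"] by simp
  then have "\<bar>\<integral>y. mol e (x - y) * g y \<partial>lebesgue\<bar> \<le> M * (\<integral>y. \<bar>g y\<bar> \<partial>lebesgue)"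
    by (intro integrable_bounded_mult(2) continuous_on_reflect m assms(2))
  then show ?thesis using assms(3) by (simp add: conv_def)
qed

lemma conv_mol_abs:
  fixes g :: "real ^ 'n::finite \<Rightarrow> real"
  assumes "e > 0" "integrable lebesgue g"
  shows "\<bar>conv (mol e) g x\<bar> \<le> conv (mol e) (\<lambda>y. \<bar>g y\<bar>) x"
proof -
  have "conv (mol e) g x \<le> conv (mol e) (\<lambda>y. \<bar>g y\<bar>) x"
    using assms by (intro conv_mol_le) auto
  moreover have "conv (mol e) (\<lambda>y. - g y) x \<le> conv (mol e) (\<lambda>y. \<bar>g y\<bar>) x"
    using assms by (intro conv_mol_le) auto
  moreover have "conv (mol e) (\<lambda>y. - g y) x = - conv (mol e) g x" by (simp add: conv_def)
  ultimately show ?thesis by linarith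
qed

text \<open>A variable exponent form of Jensen's inequality: on a ball of radius \<open>e\<close> the exponent drops
  by at most \<open>L * e\<close>, and the factor \<open>e powr (- n * L * e)\<close> that this costs stays bounded.\<close>

lemma conv_mol_powr_le:
  fixes G p :: "real ^ 'n::finite \<Rightarrow> real"
  assumes e: "e > 0" and G: "integrable lebesgue G" "\<And>y. G y \<ge> 0"
    and b: "integrable lebesgue (\<lambda>y. G y powr p y)"
    and q: "p x - L * e \<ge> 1" "L \<ge> 0" "\<And>y. norm (x - y) < e \<Longrightarrow> G y \<noteq> 0 \<Longrightarrow> p x - L * e \<le> p y"
    and M: "M \<ge> 1" "\<And>y. conv (mol e) G y \<le> M"
  shows "conv (mol e) G x powr p x \<le> M powr (L * e) * (1 + conv (mol e) (\<lambda>y. G y powr p y) x)"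
proof -
  note m = mol_props[OF \<open>e > 0\<close>]
  have z: "mol e x = 0" if "norm x > e" for x :: "real ^ 'n"
    by (rule m(2)) (use that in simp)
  note k = kernel_reflect[where x=x, OF m(5) m(3) m(6)]
  define a where "a = conv (mol e) G x"
  define B where "B = conv (mol e) (\<lambda>y. G y powr p y) x"
  define q where "q = p x - L * e"
  have B: "B \<ge> 0" unfolding B_def using e by (intro conv_mol_nonneg) auto
  have M1: "M powr (L * e) \<ge> 1" using M q(2) e by (intro ge_one_powr_ge_zero) auto
  have p: "p x \<ge> 1" using q(1,2) e by (smt (verit) mult_nonneg_nonneg)
  have a0: "a \<ge> 0" unfolding a_def using G e by (intro conv_mol_nonneg) auto
  show ?thesis
  proof (cases "a \<le> 1")
    case True
    then have "a powr p x \<le> 1" using a0 p by (intro powr_le1) auto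
    also have "\<dots> \<le> M powr (L * e) * (1 + B)" using M1 B mult_mono[of 1 "M powr (L * e)" 1 "1 + B"] by simp
    finally show ?thesis by (simp add: a_def B_def)
  next
    case False
    \<comment> \<open>The tangent inequality is taken at the mean \<open>a\<close> itself. Since the
      kernel has mass 1 and averages \<open>G\<close> to \<open>a\<close>, the linear part cancels
      and exactly a^q remains.\<close>
    have "a powr q \<le> 1 + B"
    proof -
      have iG: "integrable lebesgue (\<lambda>y. mol e (x - y) * G y)" by (rule conv_integrand_integrable[OF G(1) m(5) z])
      have ib: "integrable lebesgue (\<lambda>y. mol e (x - y) * G y powr p y)" by (rule conv_integrand_integrable[OF b m(5) z])
      have "(\<integral>y. mol e (x - y) * (a powr q * (1 + q * (G y / a - 1))) \<partial>lebesgue)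
          \<le> (\<integral>y. mol e (x - y) * (1 + G y powr p y) \<partial>lebesgue)"
      proof (rule integral_mono)
        have "integrable lebesgue (\<lambda>y. (a powr q * (1 - q)) * mol e (x - y) + (a powr q * q / a) * (mol e (x - y) * G y))"
          using k(1) iG by simp
        then show "integrable lebesgue (\<lambda>y. mol e (x - y) * (a powr q * (1 + q * (G y / a - 1))))"
          by (simp add: algebra_simps)
        show "integrable lebesgue (\<lambda>y. mol e (x - y) * (1 + G y powr p y))"
          using k(1) ib by (simp add: distrib_left)
        fix y
        show "mol e (x - y) * (a powr q * (1 + q * (G y / a - 1))) \<le> mol e (x - y) * (1 + G y powr p y)"
        proof (cases "norm (x - y) < e")
          case True
          have "a powr q * (1 + q * (G y / a - 1)) \<le> G y powr q"
            using False G q(1) by (intro powr_above_tangent) (auto simp: q_def)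
          \<comment> \<open>Raising the exponent from \<open>q\<close> to \<open>p y\<close> is
            legitimate only where G > 1; the summand 1 takes care of the other points.\<close>
          also have "\<dots> \<le> 1 + G y powr p y"
          proof (cases "G y \<le> 1")
            case True
            then have "G y powr q \<le> 1" using G q(1) by (intro powr_le1) (auto simp: q_def)
            then show ?thesis by (smt (verit) powr_ge_zero)
          next
            case False
            then have "G y powr q \<le> G y powr p y" using q(3)[OF True] by (intro powr_mono) (auto simp: q_def)
            then show ?thesis by simp
          qed
          finally show ?thesis using m(1) by (intro mult_left_mono)
        qed (use m(2)[of "x - y"] in auto)
      qed
      also have "\<dots> = 1 + B"
        using k ib by (simp add: distrib_left B_def conv_def)
      also have "(\<integral>y. mol e (x - y) * (a powr q * (1 + q * (G y / a - 1))) \<partial>lebesgue)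
         = (\<integral>y. (a powr q * (1 - q)) * mol e (x - y) + (a powr q * q / a) * (mol e (x - y) * G y) \<partial>lebesgue)"
        by (simp add: algebra_simps)
      also have "\<dots> = (a powr q * (1 - q)) * 1 + (a powr q * q / a) * a"
        using k iG by (simp add: a_def conv_def)
      also have "\<dots> = a powr q" using False by (simp add: algebra_simps)
      finally show ?thesis .
    qed
    \<comment> \<open>As p x = q + L e, the factor a^(L e) is still missing; it is paid for by the a
      priori bound \<open>M\<close> on the average.\<close>
    moreover have "a powr (L * e) \<le> M powr (L * e)"
      using M(2)[of x] a0 q(2) e by (intro powr_mono2) (auto simp: a_def)
    ultimately have "a powr q * a powr (L * e) \<le> (1 + B) * M powr (L * e)" using B by (intro mult_mono) auto
    then show ?thesis by (simp add: a_def B_def q_def powr_add[symmetric] mult.commute)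
  qed
qed

text \<open>The power of 1/e^n is exp (n L e ln (1/e)), and e ln (1/e) \<le> 1: the exponent L e
  tends to 0 faster than ln (1/e) grows.\<close>

lemma powr_vanishing_exponent_bound:
  assumes "L \<ge> 0" "c \<ge> 1" "0 < e" "e \<le> 1"
  shows "(c / e ^ n) powr (L * e) \<le> c powr L * exp (real n * L)"
proof -
  have "- ln e \<le> 1 / e" using ln_le_minus_one[of "1 / e"] assms by (simp add: ln_div)
  then have "e * (- ln e) \<le> e * (1 / e)" using assms by (intro mult_left_mono) auto
  then have "e * (- ln e) \<le> 1" using assms by simp
  then have 1: "(real n * L) * (e * (- ln e)) \<le> (real n * L) * 1" using assms by (intro mult_left_mono) auto
  have "(c / e ^ n) powr (L * e) = c powr (L * e) * (1 / e ^ n) powr (L * e)"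
    using assms by (subst powr_mult[symmetric]) auto
  also have "(1 / e ^ n) powr (L * e) = exp ((real n * L) * (e * (- ln e)))"
    using assms by (simp add: powr_def ln_div ln_realpow algebra_simps)
  also have "c powr (L * e) * \<dots> \<le> c powr L * exp (real n * L)"
    using assms 1 by (intro mult_mono powr_mono) (auto simp: mult_left_le)
  finally show ?thesis .
qed

section \<open>Weak maximum principle\<close>

lemma mol_test_function:
  assumes "e > 0" "cball x e \<subseteq> \<Omega>"
  shows "(\<lambda>y. mol e (y - x)) \<in> test_functions \<Omega>"
proof -
  have "{y. mol e (y - x) \<noteq> 0} \<subseteq> cball x e"
    using mol_props(2)[OF assms(1)] by (force simp: dist_norm norm_minus_commute not_le)
  then have cl: "closure {y. mol e (y - x) \<noteq> 0} \<subseteq> cball x e" by (intro closure_minimal) auto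
  then have "compact (closure {y. mol e (y - x) \<noteq> 0})"
    by (meson bounded_cball bounded_subset closed_closure compact_eq_bounded_closed)
  then show ?thesis using cl assms(2) mol_props(4)[OF assms(1)] by (auto simp: test_functions_def)
qed

text \<open>Mollification commutes with weak differentiation, because the mollifier centred at \<open>x\<close> is a
  test function.\<close>

lemma grad_conv_mol:
  fixes z :: "real ^ 'n::finite \<Rightarrow> real" and Z :: "real ^ 'n \<Rightarrow> real ^ 'n"
  assumes e: "e > 0" and K: "K \<subseteq> D" "cball x e \<subseteq> K"
    and wg: "\<And>\<phi>. \<phi> \<in> test_functions D \<Longrightarrow>
        set_lebesgue_integral lebesgue D (\<lambda>y. z y * grad \<phi> y $ i) = - set_lebesgue_integral lebesgue D (\<lambda>y. Z y $ i * \<phi> y)"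
    and z: "integrable lebesgue (\<lambda>y. indicator K y * z y)"
  shows "conv (mol e) (\<lambda>y. indicator K y * z y) differentiable (at x)"
    "grad (conv (mol e) (\<lambda>y. indicator K y * z y)) x $ i = conv (mol e) (\<lambda>y. indicator K y * Z y $ i) x"
proof -
  define \<kappa> where "\<kappa> = (mol e :: real ^ 'n \<Rightarrow> real)"
  note m = mol_props[OF e, where ?'n='n, folded \<kappa>_def]
  have Ck\<kappa>: "Ck m \<kappa>" for m using m(4)[of m 0] by simp
  have supp: "\<kappa> x = 0" if "norm x > e" for x using m(2)[of x] that by simp
  have diff: "\<kappa> differentiable (at y)" and gc: "continuous_on UNIV (grad \<kappa>)" for y
    using Ck_1D[OF Ck\<kappa>[of 1, unfolded One_nat_def]] by auto
  define \<phi> where "\<phi> = (\<lambda>y. \<kappa> (y - x))"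
  have \<phi>: "\<phi> \<in> test_functions D"
    unfolding \<phi>_def \<kappa>_def using K by (intro mol_test_function e) auto
  \<comment> \<open>The kernel is even, so as a function of y the test function is \<kappa>(x - y).
    The minus sign produced here cancels the one in the definition of the weak gradient.\<close>
  have grad\<phi>: "grad \<phi> y = - grad \<kappa> (x - y)" for y
  proof -
    have "\<phi> = (\<lambda>y. \<kappa> (x - y))" using m(3)[of "x - y" for y] by (simp add: \<phi>_def)
    moreover have "((\<lambda>y. \<kappa> (x - y)) has_derivative (\<lambda>v. (- grad \<kappa> (x - y)) \<bullet> v)) (at y)"
    proof -
      have "((\<lambda>y. x - y) has_derivative (\<lambda>v. - v)) (at y)" by (auto intro!: derivative_eq_intros)
      from has_derivative_compose[OF this has_derivative_grad[OF diff]] show ?thesis by simp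
    qed
    ultimately show ?thesis by (simp add: grad_eqI)
  qed
  have \<phi>0: "\<phi> y = 0" "grad \<phi> y = 0" if "y \<notin> K" for y
  proof -
    have yb: "y \<notin> cball x e" using that K by auto
    then show "\<phi> y = 0" using supp[of "y - x"] by (simp add: \<phi>_def dist_norm norm_minus_commute)
    show "grad \<phi> y = 0"
      by (rule grad_eq_0_outside(2)[of "- cball x e"])
         (use yb supp in \<open>auto simp: \<phi>_def dist_norm norm_minus_commute\<close>)
  qed
  have d: "(conv \<kappa> (\<lambda>y. indicator K y * z y) has_derivative
      (\<lambda>v. (\<chi> i. conv (\<lambda>w. grad \<kappa> w $ i) (\<lambda>y. indicator K y * z y) x) \<bullet> v)) (at x)"
    by (rule conv_has_derivative[OF z diff gc supp])
  then show "conv (mol e) (\<lambda>y. indicator K y * z y) differentiable (at x)" 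
    unfolding differentiable_def \<kappa>_def by blast
  have "grad (conv \<kappa> (\<lambda>y. indicator K y * z y)) x $ i = conv (\<lambda>w. grad \<kappa> w $ i) (\<lambda>y. indicator K y * z y) x"
    by (simp add: grad_eqI[OF d])
  also have "\<dots> = - set_lebesgue_integral lebesgue D (\<lambda>y. z y * grad \<phi> y $ i)"
    unfolding conv_def set_lebesgue_integral_def integral_minus[symmetric]
  proof (rule Bochner_Integration.integral_cong[OF refl])
    fix y
    show "grad \<kappa> (x - y) $ i * (indicator K y * z y) = - (indicator D y *\<^sub>R (z y * grad \<phi> y $ i))"
    proof (cases "y \<in> K")
      case True
      then have "y \<in> D" using K by auto
      then show ?thesis using True by (simp add: grad\<phi>)
    qed (simp add: \<phi>0)
  qed
  also have "\<dots> = set_lebesgue_integral lebesgue D (\<lambda>y. Z y $ i * \<phi> y)" using wg[OF \<phi>] by simp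
  also have "\<dots> = conv \<kappa> (\<lambda>y. indicator K y * Z y $ i) x"
    unfolding conv_def set_lebesgue_integral_def
  proof (rule Bochner_Integration.integral_cong[OF refl])
    fix y
    show "indicator D y *\<^sub>R (Z y $ i * \<phi> y) = \<kappa> (x - y) * (indicator K y * Z y $ i)"
    proof (cases "y \<in> K")
      case True
      then have "y \<in> D" using K by auto
      then show ?thesis using True m(3)[of "x - y"] by (simp add: \<phi>_def)
    qed (simp add: \<phi>0)
  qed
  finally show "grad (conv (mol e) (\<lambda>y. indicator K y * z y)) x $ i = conv (mol e) (\<lambda>y. indicator K y * Z y $ i) x"
    by (simp add: \<kappa>_def)
qed

text \<open>A Poincare inequality in L^1: integrate by parts against the coordinate x_k, whose k-th
  derivative is 1 and whose modulus is at most R on D.\<close>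

lemma integral_test_function_le:
  fixes \<psi> :: "real ^ 'n::finite \<Rightarrow> real"
  assumes "open D" "\<psi> \<in> test_functions D" "\<And>x. x \<in> D \<Longrightarrow> norm x \<le> R" "\<And>x. \<psi> x \<ge> 0"
  shows "set_lebesgue_integral lebesgue D \<psi> \<le> R * set_lebesgue_integral lebesgue D (\<lambda>x. \<bar>grad \<psi> x $ k\<bar>)"
proof -
  note t = test_functionsD[OF assms(2)]
  have g: "grad (\<lambda>x. x $ k) x $ k = 1" for x :: "real ^ 'n" by (simp add: grad_eqI[OF has_derivative_nth])
  have cc: "continuous_on S (\<lambda>x. grad \<psi> x $ k)" for S
    by (intro continuous_on_component continuous_on_subset[OF t(3)]) auto
  have gz: "grad \<psi> x $ k = 0" if "x \<in> D - closure {x. \<psi> x \<noteq> 0}" for x using t(5) that by simp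
  have "set_lebesgue_integral lebesgue D \<psi> = - set_lebesgue_integral lebesgue D (\<lambda>x. x $ k * grad \<psi> x $ k)"
  proof -
    have "(\<lambda>x. x $ k) differentiable (at x)" for x :: "real ^ 'n"
      using has_derivative_nth unfolding differentiable_def by blast
    from set_integral_by_parts[OF assms(1) this _ assms(2), of k] show ?thesis by (simp add: g)
  qed
  also have "\<dots> = set_lebesgue_integral lebesgue D (\<lambda>x. - (x $ k * grad \<psi> x $ k))"
    by (simp add: set_lebesgue_integral_def)
  also have "\<dots> \<le> set_lebesgue_integral lebesgue D (\<lambda>x. R * \<bar>grad \<psi> x $ k\<bar>)"
  proof (rule set_integral_mono)
    show "set_integrable lebesgue D (\<lambda>x. - (x $ k * grad \<psi> x $ k))"
      by (rule set_integrable_compact_support[OF t(6,7)])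
         (auto intro!: continuous_intros cc simp: gz)
    show "set_integrable lebesgue D (\<lambda>x. R * \<bar>grad \<psi> x $ k\<bar>)"
      by (rule set_integrable_compact_support[OF t(6,7)])
         (auto intro!: continuous_intros cc simp: gz)
    fix x assume x: "x \<in> D"
    have "\<bar>x $ k * grad \<psi> x $ k\<bar> \<le> R * \<bar>grad \<psi> x $ k\<bar>"
      unfolding abs_mult using component_le_norm_cart[of x k] assms(3)[OF x] by (intro mult_right_mono) auto
    then show "- (x $ k * grad \<psi> x $ k) \<le> R * \<bar>grad \<psi> x $ k\<bar>" by linarith
  qed
  also have "\<dots> = R * set_lebesgue_integral lebesgue D (\<lambda>x. \<bar>grad \<psi> x $ k\<bar>)"
    by (simp add: set_lebesgue_integral_def mult.left_commute)
  finally show ?thesis .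
qed

text \<open>Abstract in \<open>F\<close> and \<open>Z\<close>, which will be a difference of two
  fluxes and of two gradients. Having z \<le> \<eta> off the compact \<open>K\<close> replaces a
  boundary condition and gives the test functions compact support. \<open>FH\<close> is a Young
  inequality: it bounds the pairing of \<open>F\<close> with any field by that field's p-modular.
  Two limits are taken: one shows that Z = 0 where z > \<eta>, the other combines this with the
  Poincare inequality to show that this set is null.\<close>

lemma weak_maximum_principle:
  fixes z p :: "real ^ 'n::finite \<Rightarrow> real" and Z F :: "real ^ 'n \<Rightarrow> real ^ 'n"
  assumes D: "open D" "bounded D"
    and wg: "\<And>\<phi> i. \<phi> \<in> test_functions D \<Longrightarrow>
        set_lebesgue_integral lebesgue D (\<lambda>y. z y * grad \<phi> y $ i) = - set_lebesgue_integral lebesgue D (\<lambda>y. Z y $ i * \<phi> y)"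
    and z: "\<And>K. compact K \<Longrightarrow> K \<subseteq> D \<Longrightarrow> set_integrable lebesgue K z"
    and Z: "\<And>K. compact K \<Longrightarrow> K \<subseteq> D \<Longrightarrow> set_integrable lebesgue K Z"
    and Zp: "\<And>K. compact K \<Longrightarrow> K \<subseteq> D \<Longrightarrow> set_integrable lebesgue K (\<lambda>x. norm (Z x) powr p x)"
    and Fm: "\<And>K. compact K \<Longrightarrow> K \<subseteq> D \<Longrightarrow> set_borel_measurable lebesgue K F"
    and FH: "\<And>K. compact K \<Longrightarrow> K \<subseteq> D \<Longrightarrow> \<exists>H C. set_integrable lebesgue K H \<and> C \<ge> 0 \<and>
        (\<forall>x\<in>K. \<forall>t\<ge>0. norm (F x) * t \<le> H x + C * t powr p x)"
    and p: "\<And>x. x \<in> D \<Longrightarrow> p x > 1" "\<And>x y. x \<in> D \<Longrightarrow> y \<in> D \<Longrightarrow> \<bar>p x - p y\<bar> \<le> L * norm (x - y)"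
    and sub: "\<And>\<psi>. \<psi> \<in> test_functions D \<Longrightarrow> (\<And>x. \<psi> x \<ge> 0) \<Longrightarrow> set_lebesgue_integral lebesgue D (\<lambda>x. F x \<bullet> grad \<psi> x) \<le> 0"
    and mono: "\<And>x. x \<in> D \<Longrightarrow> F x \<bullet> Z x \<ge> 0" "\<And>x. x \<in> D \<Longrightarrow> F x \<bullet> Z x = 0 \<Longrightarrow> Z x = 0"
    and K: "compact K" "K \<subseteq> D" "\<And>x. x \<in> D - K \<Longrightarrow> z x \<le> \<eta>" and \<eta>: "\<eta> \<ge> 0"
  shows "AE x in lebesgue. x \<in> D \<longrightarrow> z x \<le> \<eta>"
proof (cases "K = {}")
  case True
  then show ?thesis using K by simp
next
  case False
  obtain d0 where d0: "d0 > 0" "{x. infdist x K \<le> d0} \<subseteq> D"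
    using compact_in_open_separated[OF False K(1) D(1) K(2)] by blast
  \<comment> \<open>Three nested compact sets K, K1, K2 separated by d: for radii up to d, a
    mollification at a point of K1 sees only K2, and at a point off K1 it sees only points off
    K.\<close>
  define d where "d = d0 / 2"
  have d: "d > 0" using d0 by (simp add: d_def)
  define K1 where "K1 = {x. infdist x K \<le> d}"
  define K2 where "K2 = {x. infdist x K \<le> d0}"
  have cK1: "compact K1" unfolding K1_def by (rule compact_infdist_le[OF False K(1) d])
  have cK2: "compact K2" unfolding K2_def by (rule compact_infdist_le[OF False K(1) d0(1)])
  have K12: "K1 \<subseteq> K2" "K2 \<subseteq> D" using d0 by (auto simp: K1_def K2_def d_def)
  then have K1D: "K1 \<subseteq> D" by blast
  have near: "y \<in> K2" if "x \<in> K1" "norm (x - y) \<le> d" for x y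
    using infdist_triangle[of y K x] that
    by (simp add: K1_def K2_def d_def dist_norm norm_minus_commute field_simps)
  have far: "y \<notin> K" if "x \<notin> K1" "norm (x - y) \<le> d" for x y
    using infdist_le[of y K x] that by (force simp: K1_def dist_norm)
  have mK1: "K1 \<in> sets lebesgue" using cK1 by (simp add: compact_imp_closed lborelD)
  have K1i: "integrable lebesgue (\<lambda>x. indicator K1 x :: real)"
    using lmeasurable_compact[OF cK1] by (intro integrable_real_indicator mK1) (auto simp: fmeasurable_def)
  obtain R where R: "\<And>x. x \<in> D \<Longrightarrow> norm x \<le> R" using D(2) by (auto simp: bounded_iff)
  \<comment> \<open>The sign of \<open>L\<close> follows from the Lipschitz bound at two distinct
    points of the nonempty open set \<open>D\<close>.\<close>
  have L: "L \<ge> 0"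
  proof -
    obtain x where x: "x \<in> K" using False by blast
    obtain y where y: "y \<in> D" "y \<noteq> x"
    proof -
      obtain r where r: "r > 0" "ball x r \<subseteq> D" using D(1) K(2) x by (meson openE subsetD)
      define v where "v = (r / 2) *\<^sub>R (axis undefined 1 :: real ^ 'n)"
      have "norm v = r / 2" using r by (simp add: v_def norm_axis_1)
      then have "x + v \<in> ball x r" "x + v \<noteq> x" using r by (auto simp: dist_norm)
      then show ?thesis using that r by blast
    qed
    have "0 \<le> L * norm (x - y)" using p(2)[of x y] x y K(2) by force
    then show ?thesis using y by (simp add: zero_le_mult_iff)
  qed

  define g where "g = (\<lambda>y. indicator K2 y * z y)"
  define Gi where "Gi = (\<lambda>i y. indicator K2 y * Z y $ i)"
  define G where "G = (\<lambda>y. indicator K2 y * norm (Z y))"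
  define b where "b = (\<lambda>y. G y powr p y)"
  have gi: "integrable lebesgue g" using z[OF cK2 K12(2)] by (simp add: g_def set_integrable_def)
  have Zi: "integrable lebesgue (\<lambda>y. indicator K2 y *\<^sub>R Z y)" using Z[OF cK2 K12(2)] by (simp add: set_integrable_def)
  have Gii: "integrable lebesgue (Gi i)" for i
  proof -
    have "integrable lebesgue (\<lambda>y. (indicator K2 y *\<^sub>R Z y) \<bullet> axis i 1)" by (intro integrable_inner_left Zi)
    then show ?thesis by (simp add: Gi_def inner_axis)
  qed
  have GI: "integrable lebesgue G" using integrable_norm[OF Zi] by (simp add: G_def)
  have bi: "integrable lebesgue b"
  proof -
    have "b = (\<lambda>x. indicator K2 x *\<^sub>R norm (Z x) powr p x)"
      by (auto simp: b_def G_def indicator_def)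
    then show ?thesis using Zp[OF cK2 K12(2)] by (simp add: set_integrable_def)
  qed
  have G0: "G y \<ge> 0" for y by (simp add: G_def)
  have GiG: "\<bar>Gi i y\<bar> \<le> G y" for i y
    using component_le_norm_cart[of "Z y" i] by (auto simp: Gi_def G_def indicator_def)
  have g\<eta>: "g y \<le> \<eta>" if "y \<notin> K" for y
    using K(3)[of y] K12(2) that \<eta> by (auto simp: g_def indicator_def)

  obtain c where c: "c > 0" "\<And>e x. e > 0 \<Longrightarrow> mol e (x :: real ^ 'n) \<le> c / e ^ CARD('n)"
    using mol_upper by blast
  \<comment> \<open>The kernel bound c / e^n makes every mollification of \<open>G\<close> at most I
    / e^n for e \<le> 1, and C0 bounds (I / e^n)^(L e) uniformly in e.\<close>
  define I where "I = max 1 (c * (\<integral>y. G y \<partial>lebesgue))"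
  define C0 where "C0 = I powr L * exp (real CARD('n) * L)"
  have I1: "I \<ge> 1" by (simp add: I_def)
  have C0: "C0 \<ge> 0" by (simp add: C0_def)

  obtain pm where pm: "pm > 1" "\<And>x. x \<in> K2 \<Longrightarrow> pm \<le> p x"
  proof -
    have cont: "continuous_on K2 p"
      unfolding continuous_on_iff
    proof (intro ballI allI impI)
      fix x and e :: real assume x: "x \<in> K2" and e: "e > 0"
      have "dist (p y) (p x) < e" if "y \<in> K2" "dist y x < e / (L + 1)" for y
      proof -
        have "\<bar>p y - p x\<bar> \<le> L * norm (y - x)" using p(2)[of y x] that x K12 by auto
        also have "\<dots> \<le> (L + 1) * norm (y - x)" by (intro mult_right_mono) auto
        also have "\<dots> < e" using that L by (simp add: dist_norm field_simps)
        finally show ?thesis by (simp add: dist_norm)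
      qed
      then show "\<exists>d>0. \<forall>x'\<in>K2. dist x' x < d \<longrightarrow> dist (p x') (p x) < e"
        using e L by (intro exI[of _ "e / (L + 1)"]) auto
    qed
    have "K \<subseteq> K2" using d0(1) by (auto simp: K2_def)
    then have "K2 \<noteq> {}" using False by blast
    from continuous_attains_inf[OF cK2 this cont]
    obtain x0 where x0: "x0 \<in> K2" "\<And>x. x \<in> K2 \<Longrightarrow> p x0 \<le> p x" by blast
    have "1 < p x0" by (rule p(1)) (use x0(1) K12(2) in blast)
    then show ?thesis using that[of "p x0"] x0(2) by blast
  qed
  \<comment> \<open>The last term keeps p x - L e \<ge> 1 on K2, the convexity that Jensen's
    inequality requires; dividing by L + 1 also covers L = 0.\<close>
  define d1 where "d1 = min (min d 1) ((pm - 1) / (L + 1))"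
  have d1: "d1 > 0" using d pm L by (simp add: d1_def)

  \<comment> \<open>One sequence of radii serves z, the modular density \<open>b\<close> and all
    gradient components simultaneously, with errors small enough for
    \<open>fast_L1_dominated\<close>.\<close>
  have "\<exists>e. 0 < e \<and> e < d1 \<and> (\<integral>x. \<bar>conv (mol e) g x - g x\<bar> \<partial>lebesgue) < (1/2)^j \<and>
     (\<integral>x. \<bar>conv (mol e) b x - b x\<bar> \<partial>lebesgue) < (1/2)^j \<and>
     (\<forall>i. (\<integral>x. \<bar>conv (mol e) (Gi i) x - Gi i x\<bar> \<partial>lebesgue) < (1/2)^j)" for j :: nat
  proof -
    have ev: "\<forall>\<^sub>F e in at_right 0. (\<integral>x. \<bar>conv (mol e) h x - h x\<bar> \<partial>lebesgue) < (1/2)^j"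
      if "integrable lebesgue h" for h :: "real ^ 'n \<Rightarrow> real"
      using order_tendstoD(2)[OF conv_mol_L1[OF that], of "(1/2)^j"] by simp
    have "\<forall>\<^sub>F e in at_right 0. e \<in> {0<..<d1}" using d1 by (rule eventually_at_right_real)
    moreover have "\<forall>\<^sub>F e in at_right 0. \<forall>i. (\<integral>x. \<bar>conv (mol e) (Gi i) x - Gi i x\<bar> \<partial>lebesgue) < (1/2)^j"
      using ev[OF Gii] by (intro eventually_all_finite) auto
    ultimately have "\<forall>\<^sub>F e in at_right 0. 0 < e \<and> e < d1 \<and> (\<integral>x. \<bar>conv (mol e) g x - g x\<bar> \<partial>lebesgue) < (1/2)^j \<and>
     (\<integral>x. \<bar>conv (mol e) b x - b x\<bar> \<partial>lebesgue) < (1/2)^j \<and>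
     (\<forall>i. (\<integral>x. \<bar>conv (mol e) (Gi i) x - Gi i x\<bar> \<partial>lebesgue) < (1/2)^j)"
      using ev[OF gi] ev[OF bi] by eventually_elim auto
    then show ?thesis using eventually_happens' trivial_limit_at_right_real by blast
  qed
  then obtain e where e_all: "\<forall>j. 0 < e j \<and> e j < d1 \<and> (\<integral>x. \<bar>conv (mol (e j)) g x - g x\<bar> \<partial>lebesgue) < (1/2)^j \<and>
     (\<integral>x. \<bar>conv (mol (e j)) b x - b x\<bar> \<partial>lebesgue) < (1/2)^j \<and>
     (\<forall>i. (\<integral>x. \<bar>conv (mol (e j)) (Gi i) x - Gi i x\<bar> \<partial>lebesgue) < (1/2)^j)"
    by (rule choice[OF allI, THEN exE])
  have e: "0 < e j" "e j < d1"
    and eg: "(\<integral>x. \<bar>conv (mol (e j)) g x - g x\<bar> \<partial>lebesgue) < (1/2)^j"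
    and eb: "(\<integral>x. \<bar>conv (mol (e j)) b x - b x\<bar> \<partial>lebesgue) < (1/2)^j"
    and eG: "(\<integral>x. \<bar>conv (mol (e j)) (Gi i) x - Gi i x\<bar> \<partial>lebesgue) < (1/2)^j" for i j
    using e_all by simp_all
  have ed: "e j \<le> d" "e j \<le> 1" "L * e j \<le> pm - 1" for j
  proof -
    show "e j \<le> d" "e j \<le> 1" using e(2)[of j] by (auto simp: d1_def)
    have "e j * (L + 1) \<le> pm - 1" using e(2)[of j] L by (simp add: d1_def field_simps)
    then show "L * e j \<le> pm - 1" using e(1)[of j] L by (simp add: algebra_simps)
  qed
  have convi: "integrable lebesgue (conv (mol (e j)) h)" if "integrable lebesgue h" for h :: "real ^ 'n \<Rightarrow> real" and j
  proof (rule conv_L1_bound(1)[OF that mol_props(5)[OF e(1)], of "e j"])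
    show "mol (e j) x = 0" if "norm x > e j" for x :: "real ^ 'n" by (rule mol_props(2)[OF e(1)]) (use that in simp)
  qed (rule mol_props[OF e(1)])+
  obtain Bg where Bg: "integrable lebesgue Bg"
    "AE x in lebesgue. (\<lambda>j. conv (mol (e j)) g x) \<longlonglongrightarrow> g x \<and> (\<forall>j. \<bar>conv (mol (e j)) g x\<bar> \<le> Bg x)"
    by (rule fast_L1_dominated[OF gi convi[OF gi] less_imp_le[OF eg]])
  obtain Bb where Bb: "integrable lebesgue Bb"
    "AE x in lebesgue. (\<lambda>j. conv (mol (e j)) b x) \<longlonglongrightarrow> b x \<and> (\<forall>j. \<bar>conv (mol (e j)) b x\<bar> \<le> Bb x)"
    by (rule fast_L1_dominated[OF bi convi[OF bi] less_imp_le[OF eb]])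
  have "\<exists>B. integrable lebesgue B \<and>
    (AE x in lebesgue. (\<lambda>j. conv (mol (e j)) (Gi i) x) \<longlonglongrightarrow> Gi i x \<and> (\<forall>j. \<bar>conv (mol (e j)) (Gi i) x\<bar> \<le> B x))" for i
  proof -
    obtain B where "integrable lebesgue B"
      "AE x in lebesgue. (\<lambda>j. conv (mol (e j)) (Gi i) x) \<longlonglongrightarrow> Gi i x \<and> (\<forall>j. \<bar>conv (mol (e j)) (Gi i) x\<bar> \<le> B x)"
      by (rule fast_L1_dominated[OF Gii convi[OF Gii] less_imp_le[OF eG]])
    then show ?thesis by (intro exI conjI)
  qed
  then obtain BG where BG_all: "\<forall>i. integrable lebesgue (BG i) \<and>
    (AE x in lebesgue. (\<lambda>j. conv (mol (e j)) (Gi i) x) \<longlonglongrightarrow> Gi i x \<and> (\<forall>j. \<bar>conv (mol (e j)) (Gi i) x\<bar> \<le> BG i x))"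
    by (rule choice[OF allI, THEN exE])
  have BG: "\<And>i. integrable lebesgue (BG i)"
    "\<And>i. AE x in lebesgue. (\<lambda>j. conv (mol (e j)) (Gi i) x) \<longlonglongrightarrow> Gi i x \<and> (\<forall>j. \<bar>conv (mol (e j)) (Gi i) x\<bar> \<le> BG i x)"
    using BG_all by simp_all
  have good: "AE x in lebesgue. (\<lambda>j. conv (mol (e j)) g x) \<longlonglongrightarrow> g x \<and>
     (\<forall>j. \<bar>conv (mol (e j)) b x\<bar> \<le> Bb x) \<and>
     (\<forall>i. (\<lambda>j. conv (mol (e j)) (Gi i) x) \<longlonglongrightarrow> Gi i x \<and> (\<forall>j. \<bar>conv (mol (e j)) (Gi i) x\<bar> \<le> BG i x))"
  proof -
    have "AE x in lebesgue. \<forall>i\<in>UNIV. (\<lambda>j. conv (mol (e j)) (Gi i) x) \<longlonglongrightarrow> Gi i x \<and> (\<forall>j. \<bar>conv (mol (e j)) (Gi i) x\<bar> \<le> BG i x)"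
      using BG(2) by (intro AE_finite_allI) auto
    then show ?thesis using Bg(2) Bb(2) by eventually_elim auto
  qed

  define w where "w = (\<lambda>j. conv (mol (e j)) g)"
  define \<psi> where "\<psi> = (\<lambda>j x. bump 0 (w j x - \<eta>))"
  define W where "W = (\<lambda>j x. \<chi> i. conv (mol (e j)) (Gi i) x)"
  have w_le: "w j x \<le> \<eta>" if "x \<notin> K1" for j x
    unfolding w_def
  proof (rule conv_mol_le_const[OF e(1) gi])
    show "g y \<le> \<eta>" if "norm (x - y) < e j" for y
      using far[OF \<open>x \<notin> K1\<close>, of y] that ed(1)[of j] by (intro g\<eta>) simp
  qed
  have Ckw: "Ck m (w j)" for m j
    unfolding w_def
  proof (rule Ck_conv[OF gi, of _ _ "e j"])
    show "Ck m (mol (e j) :: real ^ 'n \<Rightarrow> real)" using mol_props(4)[where x="0 :: real ^ 'n" and m=m and e="e j", OF e(1)] by simp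
    show "mol (e j) x = 0" if "norm x > e j" for x :: "real ^ 'n" by (rule mol_props(2)[OF e(1)]) (use that in simp)
  qed
  have \<psi>0: "\<psi> j x \<ge> 0" for j x by (simp add: \<psi>_def bump_0)
  have \<psi>t: "\<psi> j \<in> test_functions D" for j
  proof -
    have "Ck m (\<psi> j)" for m
    proof -
      have "Ck m (\<lambda>x. w j x + (- \<eta>))" by (intro Ck_add Ckw Ck_const)
      then show ?thesis unfolding \<psi>_def
        using Ck_compose[of bump, OF bump_has_derivative, of m "\<lambda>x. w j x - \<eta>" 0] by simp
    qed
    moreover have "\<psi> j x = 0" if "x \<notin> K1" for x
      using w_le[OF that, of j] by (simp add: \<psi>_def bump_nonpos)
    then have "{x. \<psi> j x \<noteq> 0} \<subseteq> K1" by blast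
    then have "closure {x. \<psi> j x \<noteq> 0} \<subseteq> K1" using cK1 by (intro closure_minimal) (auto simp: compact_imp_closed)
    moreover from this have "compact (closure {x. \<psi> j x \<noteq> 0})"
      using cK1 by (meson bounded_subset closed_closure compact_eq_bounded_closed)
    ultimately show ?thesis using K1D by (auto simp: test_functions_def)
  qed
  \<comment> \<open>\<open>W\<close> is the gradient of the mollification on K1 only. Off K1 the
    mollification is at most \<eta>, where the derivative of the bump vanishes, so the indicator
    costs nothing.\<close>
  have grad\<psi>: "grad (\<psi> j) x = (indicator K1 x * bump (Suc 0) (w j x - \<eta>)) *\<^sub>R W j x" for j x
  proof -
    have wd: "w j differentiable (at x)" using Ck_1D(1)[OF Ckw[of 1 j, unfolded One_nat_def]] .
    have "((\<lambda>t. bump 0 (t - \<eta>)) has_real_derivative bump (Suc 0) (w j x - \<eta>)) (at (w j x))"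
      using DERIV_shift[of "bump 0" "bump (Suc 0) (w j x - \<eta>)" "w j x" "- \<eta>"] bump_has_derivative[of 0 "w j x - \<eta>"] by simp
    from grad_compose(2)[OF wd this]
    have 1: "grad (\<psi> j) x = bump (Suc 0) (w j x - \<eta>) *\<^sub>R grad (w j) x" by (simp add: \<psi>_def)
    show ?thesis
    proof (cases "x \<in> K1")
      case True
      have "grad (w j) x $ i = W j x $ i" for i
        unfolding w_def g_def W_def Gi_def vec_lambda_beta
      proof (rule grad_conv_mol(2)[OF e(1) K12(2) _ wg])
        show "cball x (e j) \<subseteq> K2" using near[OF True] ed(1)[of j] by (force simp: dist_norm)
        show "integrable lebesgue (\<lambda>y. indicator K2 y * z y)" using gi by (simp add: g_def)
      qed
      then show ?thesis using 1 True by (simp add: vec_eq_iff)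
    next
      case False
      then show ?thesis using 1 w_le[OF False, of j] by (simp add: bump_nonpos)
    qed
  qed

  obtain H C where H: "set_integrable lebesgue K1 H" "C \<ge> 0"
    "\<And>x t. x \<in> K1 \<Longrightarrow> t \<ge> 0 \<Longrightarrow> norm (F x) * t \<le> H x + C * t powr p x"
    using FH[OF cK1 K1D] by blast
  define N where "N = real CARD('n)"
  define T where "T = (\<lambda>j x. indicator K1 x * bump (Suc 0) (w j x - \<eta>) * (F x \<bullet> W j x))"
  define T' where "T' = (\<lambda>x. indicator K1 x * bump (Suc 0) (z x - \<eta>) * (F x \<bullet> Z x))"
  have on_K1: "g x = z x" "Gi i x = Z x $ i" if "x \<in> K1" for x i
    using that K12 by (auto simp: g_def Gi_def)
  \<comment> \<open>The modular of the mollified |Z| is controlled by the mollified density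
    \<open>b\<close>, for which the majorant \<open>Bb\<close> is at hand.\<close>
  have convG_le: "conv (mol (e j)) G x powr p x \<le> C0 * (1 + \<bar>conv (mol (e j)) b x\<bar>)" if x: "x \<in> K1" for j x
  proof -
    define M where "M = I / e j ^ CARD('n)"
    have en: "0 < e j ^ CARD('n)" "e j ^ CARD('n) \<le> 1" using e(1)[of j] ed(2)[of j] by (auto intro: power_le_one)
    have "conv (mol (e j)) G x powr p x \<le> M powr (L * e j) * (1 + conv (mol (e j)) b x)"
      unfolding b_def
    proof (rule conv_mol_powr_le[OF e(1) GI G0])
      show "integrable lebesgue (\<lambda>y. G y powr p y)" using bi by (simp add: b_def)
      show "1 \<le> p x - L * e j" using ed(3)[of j] pm(2)[of x] x K12 by auto
      show "p x - L * e j \<le> p y" if "norm (x - y) < e j" "G y \<noteq> 0" for y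
      proof -
        have "y \<in> D" "x \<in> D" using that(2) x K12 by (auto simp: G_def indicator_def split: if_splits)
        then have "\<bar>p x - p y\<bar> \<le> L * norm (x - y)" using p(2) by auto
        also have "\<dots> \<le> L * e j" using that(1) L by (intro mult_left_mono) auto
        finally show ?thesis by linarith
      qed
      show "1 \<le> M" using en I1 by (simp add: M_def field_simps)
      show "conv (mol (e j)) G y \<le> M" for y
      proof -
        have "conv (mol (e j)) G y \<le> (c / e j ^ CARD('n)) * (\<integral>y. G y \<partial>lebesgue)"
          by (rule conv_mol_le_norm[OF e(1) GI G0 c(2)[OF e(1)]])
        also have "\<dots> \<le> M" using en by (simp add: M_def I_def divide_right_mono)
        finally show ?thesis .
      qed
    qed (rule L)
    also have "M powr (L * e j) \<le> C0" unfolding M_def C0_def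
      by (rule powr_vanishing_exponent_bound[OF L I1 e(1) ed(2)])
    also have "C0 * (1 + conv (mol (e j)) b x) \<le> C0 * (1 + \<bar>conv (mol (e j)) b x\<bar>)"
      using C0 by (intro mult_left_mono) auto
    finally show ?thesis using conv_mol_nonneg[OF e(1), of b j x] by (auto simp: b_def intro: mult_right_mono)
  qed
  have W_le: "norm (W j x) \<le> N * conv (mol (e j)) G x" for j x
  proof -
    have "norm (W j x) \<le> (\<Sum>i\<in>UNIV. \<bar>W j x $ i\<bar>)" by (rule norm_le_l1_cart)
    also have "\<dots> \<le> (\<Sum>i\<in>(UNIV :: 'n set). conv (mol (e j)) G x)"
    proof (rule sum_mono)
      fix i
      have "\<bar>conv (mol (e j)) (Gi i) x\<bar> \<le> conv (mol (e j)) (\<lambda>y. \<bar>Gi i y\<bar>) x" by (rule conv_mol_abs[OF e(1) Gii])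
      also have "\<dots> \<le> conv (mol (e j)) G x"
        by (rule conv_mol_le[OF e(1) integrable_abs[OF Gii] GI GiG])
      finally show "\<bar>W j x $ i\<bar> \<le> conv (mol (e j)) G x" by (simp add: W_def)
    qed
    finally show ?thesis by (simp add: N_def)
  qed
  \<comment> \<open>The majorant for \<open>T j\<close>: the factor 2 bounds the derivative of the
    bump, \<open>N\<close> passes from gradient components to the norm, and the bracket is
    \<open>FH\<close> applied with t the mollified |Z|.\<close>
  define E where "E = (\<lambda>x. indicator K1 x * (2 * N * (H x + C * C0 * (1 + Bb x))))"
  have T_le: "\<bar>T j x\<bar> \<le> E x" if "\<bar>conv (mol (e j)) b x\<bar> \<le> Bb x" for j x
  proof (cases "x \<in> K1")
    case True
    have cG: "conv (mol (e j)) G x \<ge> 0" by (rule conv_mol_nonneg[OF e(1) G0])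
    have "\<bar>F x \<bullet> W j x\<bar> \<le> norm (F x) * (N * conv (mol (e j)) G x)"
      using Cauchy_Schwarz_ineq2[of "F x" "W j x"] mult_left_mono[OF W_le[of j x] norm_ge_zero[of "F x"]] by linarith
    also have "\<dots> = N * (norm (F x) * conv (mol (e j)) G x)" by simp
    also have "\<dots> \<le> N * (H x + C * conv (mol (e j)) G x powr p x)"
      using H(3)[OF True cG] by (intro mult_left_mono) (auto simp: N_def)
    also have "\<dots> \<le> N * (H x + C * (C0 * (1 + Bb x)))"
    proof -
      have "conv (mol (e j)) G x powr p x \<le> C0 * (1 + Bb x)"
        using convG_le[OF True, of j] that C0 mult_left_mono[of "1 + \<bar>conv (mol (e j)) b x\<bar>" "1 + Bb x" C0] by linarith
      then show ?thesis using H(2) by (intro mult_left_mono add_left_mono) (auto simp: N_def)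
    qed
    finally have 1: "\<bar>F x \<bullet> W j x\<bar> \<le> N * (H x + C * (C0 * (1 + Bb x)))" .
    have "\<bar>T j x\<bar> = bump (Suc 0) (w j x - \<eta>) * \<bar>F x \<bullet> W j x\<bar>"
      using True bump_1_bounds(1) by (simp add: T_def abs_mult)
    also have "\<dots> \<le> 2 * (N * (H x + C * (C0 * (1 + Bb x))))"
      using bump_1_bounds 1 by (intro mult_mono) auto
    finally show ?thesis using True by (simp add: E_def mult.assoc)
  qed (simp add: T_def E_def)
  have mono_bump: "(\<lambda>j. bump i (w j x - \<eta>)) \<longlonglongrightarrow> bump i (z x - \<eta>)" if "(\<lambda>j. conv (mol (e j)) g x) \<longlonglongrightarrow> g x" "x \<in> K1" for x i
  proof -
    have "(\<lambda>j. w j x - \<eta>) \<longlonglongrightarrow> z x - \<eta>"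
      using that on_K1(1)[OF that(2)] unfolding w_def by (intro tendsto_intros) auto
    moreover have "isCont (bump i) (z x - \<eta>)" using bump_has_derivative DERIV_isCont by blast
    ultimately show ?thesis by (rule isCont_tendsto_compose[rotated])
  qed
  have wm: "w j \<in> borel_measurable lebesgue" for j
    unfolding w_def using convi[OF gi] by (rule borel_measurable_integrable)
  have bm: "(\<lambda>x. bump i (w j x - \<eta>)) \<in> borel_measurable lebesgue" for i j
    using borel_measurable_continuous_onI[OF continuous_bump[of UNIV i]] wm[of j] by measurable
  have K1m: "(\<lambda>x. indicator K1 x :: real) \<in> borel_measurable lebesgue" using mK1 by simp
  have zm: "(\<lambda>x. indicator K1 x * bump i (z x - \<eta>)) \<in> borel_measurable lebesgue" for i
  proof -
    have "(\<lambda>x. indicator K1 x * bump i (g x - \<eta>)) \<in> borel_measurable lebesgue"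
      using borel_measurable_continuous_onI[OF continuous_bump[of UNIV i]] borel_measurable_integrable[OF gi] K1m by measurable
    then show ?thesis by (rule measurable_cong[THEN iffD1, rotated]) (auto simp: indicator_def on_K1)
  qed
  have F1: "(\<lambda>x. indicator K1 x *\<^sub>R F x) \<in> borel_measurable lebesgue"
    using Fm[OF cK1 K1D] by (simp add: set_borel_measurable_def)
  have Wm: "W j \<in> borel_measurable lebesgue" for j
    using borel_measurable_integrable[OF convi[OF Gii]]
    by (subst borel_measurable_euclidean_space) (auto simp: Basis_vec_def inner_axis W_def)
  have Z1: "(\<lambda>x. indicator K1 x *\<^sub>R Z x) \<in> borel_measurable lebesgue"
    using Z[OF cK1 K1D] unfolding set_integrable_def by (rule borel_measurable_integrable)
  have lim: "(\<lambda>j. \<integral>x. T j x \<partial>lebesgue) \<longlonglongrightarrow> (\<integral>x. T' x \<partial>lebesgue)"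
    and T'i: "integrable lebesgue T'"
  proof -
    have T'_eq: "T' = (\<lambda>x. (indicator K1 x * bump (Suc 0) (z x - \<eta>)) * ((indicator K1 x *\<^sub>R F x) \<bullet> (indicator K1 x *\<^sub>R Z x)))"
      by (auto simp: T'_def indicator_def)
    have T_eq: "T j = (\<lambda>x. bump (Suc 0) (w j x - \<eta>) * ((indicator K1 x *\<^sub>R F x) \<bullet> W j x))" for j
      by (auto simp: T_def indicator_def)
    have 1: "T' \<in> borel_measurable lebesgue" unfolding T'_eq using zm F1 Z1 by measurable
    have 2: "T j \<in> borel_measurable lebesgue" for j unfolding T_eq using bm F1 Wm by measurable
    have 3: "integrable lebesgue E"
    proof -
      have "integrable lebesgue (\<lambda>x. (2 * N) * (indicator K1 x *\<^sub>R H x) + (2 * N * C * C0) * (indicator K1 x * Bb x) + (2 * N * C * C0) * indicator K1 x)"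
      proof (intro Bochner_Integration.integrable_add integrable_mult_right)
        show "integrable lebesgue (\<lambda>x. indicator K1 x *\<^sub>R H x)" using H(1) by (simp add: set_integrable_def)
        show "integrable lebesgue (\<lambda>x. indicator K1 x * Bb x)" using integrable_mult_indicator[OF mK1 Bb(1)] by simp
        show "integrable lebesgue (\<lambda>x. indicator K1 x :: real)"
          by (rule K1i)
      qed
      then show ?thesis unfolding E_def by (simp add: algebra_simps)
    qed
    have 4: "AE x in lebesgue. (\<lambda>j. T j x) \<longlonglongrightarrow> T' x"
      using good
    proof eventually_elim
      case (elim x)
      show ?case
      proof (cases "x \<in> K1")
        case True
        have "(\<lambda>j. W j x) \<longlonglongrightarrow> Z x"
          unfolding W_def using elim on_K1(2)[OF True] by (intro vec_tendstoI) simp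
        then show ?thesis unfolding T_def T'_def using True elim by (intro tendsto_intros mono_bump) auto
      qed (simp add: T_def T'_def)
    qed
    have 5: "AE x in lebesgue. norm (T j x) \<le> E x" for j
      using good by eventually_elim (use T_le in auto)
    show "(\<lambda>j. \<integral>x. T j x \<partial>lebesgue) \<longlonglongrightarrow> (\<integral>x. T' x \<partial>lebesgue)"
      by (rule integral_dominated_convergence[OF 1 2 3 4 5])
    show "integrable lebesgue T'"
      by (rule integrable_dominated_convergence[OF 1 2 3 4 5])
  qed
  have "(\<integral>x. T j x \<partial>lebesgue) \<le> 0" for j
  proof -
    have "set_lebesgue_integral lebesgue D (\<lambda>x. F x \<bullet> grad (\<psi> j) x) = (\<integral>x. T j x \<partial>lebesgue)"
      unfolding set_lebesgue_integral_def
      by (rule Bochner_Integration.integral_cong[OF refl])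
         (use K1D in \<open>auto simp: grad\<psi> T_def indicator_def\<close>)
    then show ?thesis using sub[OF \<psi>t \<psi>0, of j] by simp
  qed
  then have "(\<integral>x. T' x \<partial>lebesgue) \<le> 0" using lim by (intro LIMSEQ_le_const2[OF lim]) auto
  moreover have T'0: "T' x \<ge> 0" for x
    using mono(1)[of x] bump_1_bounds(1) K1D by (auto simp: T'_def indicator_def)
  \<comment> \<open>The limit of the tested inequalities is nonpositive while the limit integrand is
    nonnegative by monotonicity, so the integrand must vanish almost everywhere.\<close>
  ultimately have "(\<integral>x. T' x \<partial>lebesgue) = 0" by (simp add: Bochner_Integration.integral_nonneg order_antisym)
  then have "AE x in lebesgue. T' x = 0" using T'i T'0 by (simp add: integral_nonneg_eq_0_iff_AE)
  then have Z0: "AE x in lebesgue. indicator K1 x * bump (Suc 0) (z x - \<eta>) * Z x $ i = 0" for i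
  proof eventually_elim
    case (elim x)
    show ?case
    proof (cases "x \<in> K1 \<and> bump (Suc 0) (z x - \<eta>) \<noteq> 0")
      case True
      then have "F x \<bullet> Z x = 0" using elim by (simp add: T'_def)
      then show ?thesis using mono(2)[of x] True K1D by auto
    qed auto
  qed

  \<comment> \<open>Any coordinate will do, as the Poincare inequality uses a single partial
    derivative.\<close>
  define k :: 'n where "k = undefined"
  \<comment> \<open>The k-th derivatives of the test functions tend to 0 in L^1, because their limit
    contains the product of the bump's derivative with \<open>Z\<close>, which \<open>Z0\<close>
    annihilates.\<close>
  have "(\<lambda>j. \<integral>x. indicator K1 x * \<bar>bump (Suc 0) (w j x - \<eta>) * conv (mol (e j)) (Gi k) x\<bar> \<partial>lebesgue) \<longlonglongrightarrow> (\<integral>x. 0 \<partial>(lebesgue :: (real ^ 'n) measure))"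
  proof (rule integral_dominated_convergence)
    show "integrable lebesgue (\<lambda>x. 2 * BG k x)" using BG(1) by simp
    show "(\<lambda>x. indicator K1 x * \<bar>bump (Suc 0) (w j x - \<eta>) * conv (mol (e j)) (Gi k) x\<bar>) \<in> borel_measurable lebesgue" for j
      using K1m bm borel_measurable_integrable[OF convi[OF Gii]] by measurable
    show "AE x in lebesgue. (\<lambda>j. indicator K1 x * \<bar>bump (Suc 0) (w j x - \<eta>) * conv (mol (e j)) (Gi k) x\<bar>) \<longlonglongrightarrow> 0"
      using good Z0[of k]
    proof eventually_elim
      case (elim x)
      show ?case
      proof (cases "x \<in> K1")
        case True
        have "(\<lambda>j. indicator K1 x * \<bar>bump (Suc 0) (w j x - \<eta>) * conv (mol (e j)) (Gi k) x\<bar>)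
           \<longlonglongrightarrow> indicator K1 x * \<bar>bump (Suc 0) (z x - \<eta>) * Gi k x\<bar>"
          using True elim by (intro tendsto_intros mono_bump) auto
        moreover have "indicator K1 x * \<bar>bump (Suc 0) (z x - \<eta>) * Gi k x\<bar> = 0"
          using elim True on_K1(2)[OF True, of k] by simp
        ultimately show ?thesis by simp
      qed simp
    qed
    show "AE x in lebesgue. norm (indicator K1 x * \<bar>bump (Suc 0) (w j x - \<eta>) * conv (mol (e j)) (Gi k) x\<bar>) \<le> 2 * BG k x" for j
      using good
    proof eventually_elim
      case (elim x)
      then have 1: "\<bar>conv (mol (e j)) (Gi k) x\<bar> \<le> BG k x" by blast
      have "\<bar>bump (Suc 0) (w j x - \<eta>) * conv (mol (e j)) (Gi k) x\<bar> \<le> 2 * BG k x"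
        unfolding abs_mult using 1 bump_1_bounds by (intro mult_mono) auto
      moreover have "0 \<le> BG k x" using 1 by linarith
      ultimately show ?case by (auto simp: indicator_def)
    qed
  qed simp
  then have A1: "(\<lambda>j. R * (\<integral>x. indicator K1 x * \<bar>bump (Suc 0) (w j x - \<eta>) * conv (mol (e j)) (Gi k) x\<bar> \<partial>lebesgue)) \<longlonglongrightarrow> 0"
    using tendsto_mult_left[of _ 0 sequentially R] by fastforce
  define P where "P = (\<lambda>x. indicator K1 x * bump 0 (z x - \<eta>))"
  have b01: "bump 0 t \<le> 1" "0 \<le> bump 0 t" for t by (auto simp: bump_0)
  have A2: "(\<lambda>j. \<integral>x. indicator K1 x * \<psi> j x \<partial>lebesgue) \<longlonglongrightarrow> (\<integral>x. P x \<partial>lebesgue)"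
  proof (rule integral_dominated_convergence[OF _ _ K1i])
    show "P \<in> borel_measurable lebesgue" unfolding P_def by (rule zm)
    show "(\<lambda>x. indicator K1 x * \<psi> j x) \<in> borel_measurable lebesgue" for j
      unfolding \<psi>_def using K1m bm by measurable
    show "AE x in lebesgue. (\<lambda>j. indicator K1 x * \<psi> j x) \<longlonglongrightarrow> P x"
      using good
    proof eventually_elim
      case (elim x)
      show ?case
        by (cases "x \<in> K1") (use elim in \<open>auto simp: \<psi>_def P_def intro!: mono_bump\<close>)
    qed
    show "AE x in lebesgue. norm (indicator K1 x * \<psi> j x) \<le> indicator K1 x" for j
      by (intro AE_I2) (auto simp: \<psi>_def indicator_def b01)
  qed
  have "(\<integral>x. indicator K1 x * \<psi> j x \<partial>lebesgue) \<le> R * (\<integral>x. indicator K1 x * \<bar>bump (Suc 0) (w j x - \<eta>) * conv (mol (e j)) (Gi k) x\<bar> \<partial>lebesgue)" for j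
  proof -
    have "set_lebesgue_integral lebesgue D (\<psi> j) = (\<integral>x. indicator K1 x * \<psi> j x \<partial>lebesgue)"
      unfolding set_lebesgue_integral_def
      by (rule Bochner_Integration.integral_cong[OF refl])
         (use K1D w_le in \<open>auto simp: \<psi>_def indicator_def bump_nonpos\<close>)
    moreover have "set_lebesgue_integral lebesgue D (\<lambda>x. \<bar>grad (\<psi> j) x $ k\<bar>)
        = (\<integral>x. indicator K1 x * \<bar>bump (Suc 0) (w j x - \<eta>) * conv (mol (e j)) (Gi k) x\<bar> \<partial>lebesgue)"
      unfolding set_lebesgue_integral_def
      by (rule Bochner_Integration.integral_cong[OF refl])
         (use K1D in \<open>auto simp: grad\<psi> W_def indicator_def\<close>)
    ultimately show ?thesis using integral_test_function_le[OF D(1) \<psi>t R \<psi>0, of j k] by simp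
  qed
  then have "(\<integral>x. P x \<partial>lebesgue) \<le> 0" by (intro LIMSEQ_le[OF A2 A1]) auto
  moreover have P0: "P x \<ge> 0" for x by (simp add: P_def b01)
  ultimately have "(\<integral>x. P x \<partial>lebesgue) = 0" by (simp add: Bochner_Integration.integral_nonneg order_antisym)
  moreover have "integrable lebesgue P"
    by (rule Bochner_Integration.integrable_bound[OF K1i]) (use zm b01 in \<open>auto simp: P_def indicator_def\<close>)
  ultimately have "AE x in lebesgue. P x = 0" using P0 by (simp add: integral_nonneg_eq_0_iff_AE)
  then show ?thesis
  proof eventually_elim
    case (elim x)
    show ?case
    proof (cases "x \<in> K1")
      case True
      then have "bump 0 (z x - \<eta>) = 0" using elim by (simp add: P_def)
      then show ?thesis by (auto simp: bump_0 split: if_splits)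
    next
      case False
      then have "x \<notin> K" using d by (auto simp: K1_def)
      then show ?thesis using K(3) by auto
    qed
  qed
qed

section \<open>Comparison principle\<close>

definition p_field :: "real \<Rightarrow> 'a::real_inner \<Rightarrow> 'a" where
  "p_field p a = (norm a powr (p - 2)) *\<^sub>R a"

lemma powr_times_self: "s \<ge> 0 \<Longrightarrow> s powr (q - 1) * s = s powr (q :: real)"
  using powr_add[of s "q - 1" 1] by (cases "s = 0") (simp_all add: mult.commute)

lemma norm_p_field: "norm (p_field p a) = norm a powr (p - 1)"
proof (cases "a = 0")
  case False
  have "norm a powr (p - 2) * norm a = norm a powr (p - 1)" using powr_times_self[of "norm a" "p - 1"] by simp
  then show ?thesis by (simp add: p_field_def)
qed (simp add: p_field_def)

text \<open>With s = |a|, t = |b|, \<alpha> = s^(p-2), \<beta> = t^(p-2), the pairing equals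
  (\<alpha> s - \<beta> t)(s - t) + (\<alpha> + \<beta>)(s t - a . b). The first term is nonnegative
  because s^(p-1) is increasing, the second by Cauchy-Schwarz; if both vanish, the lengths agree and
  then the vectors do.\<close>

lemma p_field_strict_mono:
  fixes a b :: "'a::real_inner"
  assumes "p > 1"
  shows "(p_field p a - p_field p b) \<bullet> (a - b) \<ge> 0" (is "?l \<ge> 0")
    and "(p_field p a - p_field p b) \<bullet> (a - b) = 0 \<Longrightarrow> a = b"
proof -
  define s t where "s = norm a" and "t = norm b"
  define \<alpha> \<beta> where "\<alpha> = s powr (p - 2)" and "\<beta> = t powr (p - 2)"
  have st: "s \<ge> 0" "t \<ge> 0" by (simp_all add: s_def t_def)
  have \<alpha>\<beta>: "\<alpha> \<ge> 0" "\<beta> \<ge> 0" by (simp_all add: \<alpha>_def \<beta>_def)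
  have l: "?l = (\<alpha> * s - \<beta> * t) * (s - t) + (\<alpha> + \<beta>) * (s * t - a \<bullet> b)"
    by (simp add: p_field_def inner_diff_left inner_diff_right \<alpha>_def \<beta>_def s_def t_def
        dot_square_norm power2_eq_square inner_commute algebra_simps)
  have as: "\<alpha> * s = s powr (p - 1)" "\<beta> * t = t powr (p - 1)"
    using norm_p_field[of p a] norm_p_field[of p b] by (simp_all add: p_field_def \<alpha>_def \<beta>_def s_def t_def)
  have strict: "s < t \<Longrightarrow> \<alpha> * s < \<beta> * t" "t < s \<Longrightarrow> \<beta> * t < \<alpha> * s"
    using as st assms by (auto intro: powr_less_mono2)
  have 1: "(\<alpha> * s - \<beta> * t) * (s - t) \<ge> 0"
    using strict by (cases s t rule: linorder_cases) (auto intro: mult_nonneg_nonneg mult_nonpos_nonpos)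
  have cs: "s * t - a \<bullet> b \<ge> 0" using norm_cauchy_schwarz[of a b] by (simp add: s_def t_def)
  have 2: "(\<alpha> + \<beta>) * (s * t - a \<bullet> b) \<ge> 0" using \<alpha>\<beta> cs by (intro mult_nonneg_nonneg) auto
  show "?l \<ge> 0" using l 1 2 by simp
  assume "?l = 0"
  then have z: "(\<alpha> * s - \<beta> * t) * (s - t) = 0" "(\<alpha> + \<beta>) * (s * t - a \<bullet> b) = 0" using l 1 2 by linarith+
  have eq: "s = t" using z(1) strict by (cases s t rule: linorder_cases) auto
  show "a = b"
  proof (cases "s = 0")
    case True
    then show ?thesis using eq by (simp add: s_def t_def)
  next
    case False
    then have "\<alpha> > 0" using st by (simp add: \<alpha>_def)
    then have "a \<bullet> b = s * s" using z(2) \<alpha>\<beta> eq by auto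
    moreover have "a \<bullet> a = s * s" "b \<bullet> b = s * s"
      using eq by (simp_all add: s_def t_def dot_square_norm power2_eq_square)
    moreover have "(a - b) \<bullet> (a - b) = a \<bullet> a - 2 * (a \<bullet> b) + b \<bullet> b"
      by (simp only: inner_diff_left inner_diff_right inner_commute[of b a])
    ultimately have "(a - b) \<bullet> (a - b) = 0" by simp
    then show ?thesis by simp
  qed
qed

text \<open>A crude Young inequality with constants independent of p: the product is at most the
  p-th power of the larger of the two numbers.\<close>

lemma powr_pred_times_le:
  fixes s t p :: real
  assumes "s \<ge> 0" "t \<ge> 0" "p > 1"
  shows "s powr (p - 1) * t \<le> s powr p + t powr p"
proof (cases "t \<le> s")
  case True
  have "s powr (p - 1) * t \<le> s powr (p - 1) * s" using True by (intro mult_left_mono) auto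
  also have "\<dots> = s powr p" using assms by (simp add: powr_times_self)
  finally show ?thesis by (smt (verit) powr_ge_zero)
next
  case False
  have "s powr (p - 1) * t \<le> t powr (p - 1) * t" using False assms by (intro mult_right_mono powr_mono2) auto
  also have "\<dots> = t powr p" using assms by (simp add: powr_times_self)
  finally show ?thesis by (smt (verit) powr_ge_zero)
qed

lemma powr_pred_le: "s \<ge> 0 \<Longrightarrow> p > 1 \<Longrightarrow> s powr (p - 1) \<le> s powr p + (1::real)"
  using powr_pred_times_le[of s 1 p] by simp

lemma le_one_plus_powr: "t \<ge> 0 \<Longrightarrow> p > 1 \<Longrightarrow> t \<le> 1 + t powr (p::real)"
proof (cases "t \<le> 1")
  case False
  assume "t \<ge> 0" "p > 1"
  then have "t powr 1 \<le> t powr p" using False by (intro powr_mono) auto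
  then show ?thesis using False by simp
qed (smt (verit) powr_ge_zero)

section \<open>Integrability of energy densities and fluxes on compact sets\<close>

lemma set_borel_measurable_p_field:
  fixes X :: "'a::euclidean_space \<Rightarrow> 'b::euclidean_space"
  assumes "set_borel_measurable lebesgue K X" "set_borel_measurable lebesgue K p" 
  shows "set_borel_measurable lebesgue K (\<lambda>x. p_field (p x) (X x))"
    "K \<in> sets lebesgue \<Longrightarrow> set_borel_measurable lebesgue K (\<lambda>x. norm (X x) powr p x)"
proof -
  note m [measurable] = assms[unfolded set_borel_measurable_def]
  have "(\<lambda>x. (norm (indicator K x *\<^sub>R X x) powr (indicator K x *\<^sub>R p x - 2)) *\<^sub>R (indicator K x *\<^sub>R X x)) \<in> borel_measurable lebesgue"
    by measurable
  moreover have "(\<lambda>x. indicator K x *\<^sub>R p_field (p x) (X x)) =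
    (\<lambda>x. (norm (indicator K x *\<^sub>R X x) powr (indicator K x *\<^sub>R p x - 2)) *\<^sub>R (indicator K x *\<^sub>R X x))"
    by (auto simp: p_field_def indicator_def)
  ultimately show "set_borel_measurable lebesgue K (\<lambda>x. p_field (p x) (X x))" by (simp add: set_borel_measurable_def)
  assume [measurable]: "K \<in> sets lebesgue"
  have "(\<lambda>x. indicator K x *\<^sub>R (norm (indicator K x *\<^sub>R X x) powr (indicator K x *\<^sub>R p x))) \<in> borel_measurable lebesgue"
    by measurable
  moreover have "(\<lambda>x. indicator K x *\<^sub>R (norm (X x) powr p x)) =
    (\<lambda>x. indicator K x *\<^sub>R (norm (indicator K x *\<^sub>R X x) powr (indicator K x *\<^sub>R p x)))"
    by (auto simp: indicator_def)
  ultimately show "set_borel_measurable lebesgue K (\<lambda>x. norm (X x) powr p x)" by (simp add: set_borel_measurable_def)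
qed

lemma set_borel_measurable_compact_continuous:
  fixes g :: "'a::euclidean_space \<Rightarrow> 'b::euclidean_space"
  assumes "compact K" "continuous_on K g"
  shows "set_borel_measurable lebesgue K g"
  using borel_measurable_integrable[OF set_integrable_compact_continuous[OF assms, unfolded set_integrable_def]]
  by (simp add: set_borel_measurable_def)

lemma set_integrable_dominated:
  fixes f :: "'a::euclidean_space \<Rightarrow> 'b::euclidean_space" and g :: "'a \<Rightarrow> real"
  assumes "set_borel_measurable lebesgue K f" "set_integrable lebesgue K g" "\<And>x. x \<in> K \<Longrightarrow> norm (f x) \<le> g x"
  shows "set_integrable lebesgue K f"
  unfolding set_integrable_def
proof (rule Bochner_Integration.integrable_bound)
  show "integrable lebesgue (\<lambda>x. indicator K x *\<^sub>R g x)" using assms(2) by (simp add: set_integrable_def)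
  show "(\<lambda>x. indicator K x *\<^sub>R f x) \<in> borel_measurable lebesgue" using assms(1) by (simp add: set_borel_measurable_def)
  show "AE x in lebesgue. norm (indicator K x *\<^sub>R f x) \<le> norm (indicator K x *\<^sub>R g x)"
    using assms(3) by (intro AE_I2) (auto simp: indicator_def intro: order_trans[OF _ abs_ge_self])
qed

lemma set_integrable_const_compact:
  "compact K \<Longrightarrow> set_integrable lebesgue K (\<lambda>x :: 'a::euclidean_space. c :: real)"
  by (rule set_integrable_compact_continuous) (auto intro: continuous_intros)

text \<open>Membership in \<open>Lp_var\<close> gives integrability only after some scaling by
  \<mu>. The exponent is bounded by some P on the compact set, so undoing the scaling costs at most
  the factor max (1, \<mu>)^P.\<close>

lemma set_integrable_p_energy_density:
  fixes X :: "'a::euclidean_space \<Rightarrow> 'b::euclidean_space"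
  assumes K: "compact K" and X: "set_borel_measurable lebesgue K X" and \<mu>: "\<mu> > 0"
    and int: "set_integrable lebesgue K (\<lambda>x. (norm (X x) / \<mu>) powr p x)"
    and p: "continuous_on K p" "\<And>x. x \<in> K \<Longrightarrow> p x > 1"
  shows "set_integrable lebesgue K (\<lambda>x. norm (X x) powr p x)"
proof -
  have "bounded (p ` K)" using K p(1) by (intro compact_imp_bounded compact_continuous_image)
  then obtain P where P: "\<And>x. x \<in> K \<Longrightarrow> p x \<le> P"
    unfolding bounded_iff by (metis abs_le_D1 imageI real_norm_def)
  have mK: "K \<in> sets lebesgue" using K by (simp add: compact_imp_closed)
  show ?thesis
  proof (rule set_integrable_dominated)
    show "set_borel_measurable lebesgue K (\<lambda>x. norm (X x) powr p x)"
      by (rule set_borel_measurable_p_field(2)[OF X set_borel_measurable_compact_continuous[OF K p(1)] mK])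
    show "set_integrable lebesgue K (\<lambda>x. max 1 \<mu> powr P * (norm (X x) / \<mu>) powr p x)"
      using int by simp
    fix x assume x: "x \<in> K"
    have "norm (X x) powr p x = \<mu> powr p x * (norm (X x) / \<mu>) powr p x"
      using \<mu> by (subst powr_mult[symmetric]) auto
    also have "\<mu> powr p x \<le> max 1 \<mu> powr p x" using \<mu> p(2)[OF x] by (intro powr_mono2) auto
    also have "\<dots> \<le> max 1 \<mu> powr P" using P[OF x] by (intro powr_mono) auto
    finally show "norm (norm (X x) powr p x) \<le> max 1 \<mu> powr P * (norm (X x) / \<mu>) powr p x"
      by (simp add: mult_right_mono)
  qed
qed

text \<open>\<open>X\<close> is integrable on the support of \<psi> only; there \<psi> and its
  gradient are bounded, and elsewhere they vanish.\<close>

lemma integrable_test_mult: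
  fixes \<psi> :: "real ^ 'n::finite \<Rightarrow> real" and X :: "real ^ 'n \<Rightarrow> real ^ 'n"
  assumes \<psi>: "\<psi> \<in> test_functions D"
    and X: "set_integrable lebesgue (closure {x. \<psi> x \<noteq> 0}) X"
  shows "set_integrable lebesgue D (\<lambda>x. X x \<bullet> grad \<psi> x)"
    "set_integrable lebesgue D (\<lambda>x. X x $ i * \<psi> x)"
proof -
  define S where "S = closure {x. \<psi> x \<noteq> 0}"
  note t = test_functionsD[OF \<psi>, folded S_def]
  have Xi: "integrable lebesgue (\<lambda>x. indicator S x *\<^sub>R X x $ i)" for i
  proof -
    have "integrable lebesgue (\<lambda>x. (indicator S x *\<^sub>R X x) \<bullet> axis i 1)"
      using X by (intro integrable_inner_left) (simp add: set_integrable_def S_def)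
    then show ?thesis by (simp add: inner_axis)
  qed
  obtain r where r: "\<And>x. x \<in> S \<Longrightarrow> norm x \<le> r" using compact_imp_bounded[OF t(6)] by (auto simp: bounded_iff)
  have out: "x \<notin> S" if "norm x > r" for x using r[of x] that by auto
  have gc: "continuous_on UNIV (\<lambda>x. grad \<psi> x $ i)" for i by (intro continuous_on_component t(3))
  have int: "integrable lebesgue (\<lambda>x. h x * (indicator S x *\<^sub>R X x $ i))"
    if c: "continuous_on UNIV h" and z: "\<And>x. x \<notin> S \<Longrightarrow> h x = 0" for h i
  proof -
    obtain B where "\<And>x. norm (h x) \<le> B"
      using bounded_compact_support[OF c, of r] z out by metis
    then show ?thesis using integrable_bounded_mult(1)[OF Xi c, of B i] by simp
  qed
  have "integrable lebesgue (\<lambda>x. \<Sum>i\<in>UNIV. grad \<psi> x $ i * (indicator S x *\<^sub>R X x $ i))"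
    by (intro Bochner_Integration.integrable_sum int gc) (simp add: t(5))
  moreover have "(\<Sum>i\<in>UNIV. grad \<psi> x $ i * (indicator S x *\<^sub>R X x $ i)) = indicator D x *\<^sub>R (X x \<bullet> grad \<psi> x)" for x
    using t(7) t(5)[of x] by (cases "x \<in> S") (auto simp: inner_vec_def mult.commute)
  ultimately show "set_integrable lebesgue D (\<lambda>x. X x \<bullet> grad \<psi> x)" unfolding set_integrable_def by simp
  have "integrable lebesgue (\<lambda>x. \<psi> x * (indicator S x *\<^sub>R X x $ i))" by (intro int t(2) t(4))
  moreover have "(\<lambda>x. \<psi> x * (indicator S x *\<^sub>R X x $ i)) = (\<lambda>x. indicator D x *\<^sub>R (X x $ i * \<psi> x))"
  proof
    show "\<psi> x * (indicator S x *\<^sub>R X x $ i) = indicator D x *\<^sub>R (X x $ i * \<psi> x)" for x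
      using t(7) t(4)[of x] by (cases "x \<in> S") (auto simp: mult.commute)
  qed
  ultimately show "set_integrable lebesgue D (\<lambda>x. X x $ i * \<psi> x)" unfolding set_integrable_def by simp
qed

lemma integrable_test_mult_scalar:
  fixes \<psi> u :: "real ^ 'n::finite \<Rightarrow> real"
  assumes \<psi>: "\<psi> \<in> test_functions D"
    and u: "set_integrable lebesgue (closure {x. \<psi> x \<noteq> 0}) u"
  shows "set_integrable lebesgue D (\<lambda>x. u x * grad \<psi> x $ i)"
proof -
  have "set_integrable lebesgue (closure {x. \<psi> x \<noteq> 0}) (\<lambda>x. u x *\<^sub>R (axis i 1 :: real ^ 'n))"
    using integrable_scaleR_left[of "axis i 1 :: real ^ 'n" lebesgue "\<lambda>x. indicator (closure {x. \<psi> x \<noteq> 0}) x *\<^sub>R u x"] u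
    by (simp add: set_integrable_def)
  from integrable_test_mult(1)[OF \<psi> this] show ?thesis by (simp add: inner_axis')
qed

lemma set_integral_test_restrict:
  assumes "\<psi> \<in> test_functions D" "D \<subseteq> \<Omega>" "\<And>x. x \<notin> closure {x. \<psi> x \<noteq> 0} \<Longrightarrow> h x = 0"
  shows "set_lebesgue_integral lebesgue \<Omega> h = set_lebesgue_integral lebesgue D h"
  unfolding set_lebesgue_integral_def
proof (rule Bochner_Integration.integral_cong[OF refl])
  fix x
  show "indicator \<Omega> x *\<^sub>R h x = indicator D x *\<^sub>R h x"
    using assms(3)[of x] test_functionsD(7)[OF assms(1)] assms(2) by (cases "x \<in> closure {x. \<psi> x \<noteq> 0}") (auto simp: indicator_def)
qed

text \<open>The passage from almost everywhere to everywhere: on a small ball continuity of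
  \<open>w\<close> turns the hypothesis into an almost sure bound by w(x) plus a small number, and
  the essential upper limit is an infimum over balls. For subharmonic \<open>u\<close> it equals
  u(x).\<close>

lemma ess_limsup_le:
  fixes u w :: "real ^ 'n::finite \<Rightarrow> real"
  assumes "open D" "D \<subseteq> \<Omega>" "x \<in> D" and w: "continuous_on D w"
    and meas: "\<And>K. compact K \<Longrightarrow> K \<subseteq> D \<Longrightarrow> set_borel_measurable lebesgue K u"
    and le: "\<And>\<eta>. \<eta> > 0 \<Longrightarrow> AE y in lebesgue. y \<in> D \<longrightarrow> u y - w y \<le> \<eta>"
  shows "ess_limsup_on \<Omega> u x \<le> ereal (w x)"
proof (rule ereal_le_epsilon2)
  fix \<epsilon> :: real assume "\<epsilon> > 0"
  obtain r1 where r1: "r1 > 0" "cball x r1 \<subseteq> D" using assms(1,3) open_contains_cball by blast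
  obtain r2 where r2: "r2 > 0" "\<And>y. y \<in> D \<Longrightarrow> dist y x < r2 \<Longrightarrow> dist (w y) (w x) < \<epsilon> / 2"
    using w[unfolded continuous_on_iff, rule_format, OF \<open>x \<in> D\<close> half_gt_zero[OF \<open>\<epsilon> > 0\<close>]] by blast
  define r where "r = min r1 r2"
  have r: "r > 0" "ball x r \<subseteq> cball x r1" "ball x r \<subseteq> D" using r1 r2 by (auto simp: r_def)
  have eq: "\<Omega> \<inter> ball x r = ball x r" using r assms(2) by auto
  have "esssup (lebesgue_on (ball x r)) (\<lambda>y. ereal (u y)) \<le> ereal (w x + \<epsilon>)"
  proof (rule esssup_I)
    \<comment> \<open>\<open>esssup_I\<close> asks for measurability, which is available on compact
      sets; hence the closed ball around the open one.\<close>
    have "set_borel_measurable lebesgue (cball x r1) u" using r1 by (intro meas) auto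
    then have "u \<in> borel_measurable (lebesgue_on (cball x r1))"
      by (simp add: set_borel_measurable_def borel_measurable_restrict_space_iff)
    then have "u \<in> borel_measurable (lebesgue_on (ball x r))"
      by (rule measurable_restrict_mono) (rule r)
    then show "(\<lambda>y. ereal (u y)) \<in> borel_measurable (lebesgue_on (ball x r))" by simp
    show "AE y in lebesgue_on (ball x r). ereal (u y) \<le> ereal (w x + \<epsilon>)"
      using le[OF half_gt_zero[OF \<open>\<epsilon> > 0\<close>]]
    proof (subst AE_restrict_space_iff)
      assume "AE y in lebesgue. y \<in> D \<longrightarrow> u y - w y \<le> \<epsilon> / 2"
      then show "AE y in lebesgue. y \<in> ball x r \<longrightarrow> ereal (u y) \<le> ereal (w x + \<epsilon>)"
      proof eventually_elim
        case (elim y)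
        show ?case
        proof
          assume y: "y \<in> ball x r"
          then have "y \<in> D" "dist y x < r2" using r by (auto simp: r_def dist_commute)
          then have "u y - w y \<le> \<epsilon> / 2" "\<bar>w y - w x\<bar> < \<epsilon> / 2"
            using elim r2(2)[of y] by (simp_all add: dist_real_def)
          then have "u y \<le> w x + \<epsilon>" by linarith
          then show "ereal (u y) \<le> ereal (w x + \<epsilon>)" by simp
        qed
      qed
    qed auto
  qed
  moreover have "ess_limsup_on \<Omega> u x \<le> esssup (lebesgue_on (ball x r)) (\<lambda>y. ereal (u y))"
    unfolding ess_limsup_on_def using r by (intro INF_lower2[of r]) (auto simp: eq)
  ultimately show "ess_limsup_on \<Omega> u x \<le> ereal (w x) + ereal \<epsilon>" by simp
qed

text \<open>Boundary values of \<open>w\<close> are avoided: \<open>bdry\<close> asks instead that u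
  exceed w + \<eta> only inside a compact part of D, the form the weak maximum principle takes. As
  \<open>w\<close> is C^1, its gradient is bounded on compact sets and the integrability conditions
  reduce to those known for \<open>u\<close>.\<close>

theorem comparison_principle:
  fixes u w p :: "real ^ 'n::finite \<Rightarrow> real"
  assumes D: "open D" "bounded D" "D \<subseteq> \<Omega>" and u: "px_subharmonic p \<Omega> u"
    and w: "\<And>x. x \<in> D \<Longrightarrow> w differentiable (at x)" "continuous_on D (grad w)"
    and p: "\<And>x. x \<in> D \<Longrightarrow> p x > 1" "L-lipschitz_on D p"
    and super: "\<And>\<psi>. \<psi> \<in> test_functions D \<Longrightarrow> (\<And>x. \<psi> x \<ge> 0) \<Longrightarrow> px_energy p D (grad w) \<psi> \<ge> 0"
    and bdry: "\<And>\<eta>. \<eta> > 0 \<Longrightarrow> \<exists>K. compact K \<and> K \<subseteq> D \<and> (\<forall>x\<in>D - K. u x \<le> w x + \<eta>)"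
    and x: "x \<in> D"
  shows "u x \<le> w x"
proof -
  obtain Du where Du: "W1p_loc p \<Omega> u Du"
    and sub: "\<And>\<psi>. \<psi> \<in> test_functions \<Omega> \<Longrightarrow> (\<And>x. \<psi> x \<ge> 0) \<Longrightarrow> px_energy p \<Omega> Du \<psi> \<le> 0"
    using u unfolding px_subharmonic_def weak_subsolution_def by blast
  define z where "z = (\<lambda>x. u x - w x)"
  define Z where "Z = (\<lambda>x. Du x - grad w x)"
  define F where "F = (\<lambda>x. p_field (p x) (Du x) - p_field (p x) (grad w x))"
  have wc: "continuous_on D w"
    using w(1) by (simp add: continuous_at_imp_continuous_on differentiable_imp_continuous_within)
  have pc: "continuous_on D p" using p(2) by (rule lipschitz_on_continuous_on)
  note wcK = continuous_on_subset[OF wc] and pcK = continuous_on_subset[OF pc] and gcK = continuous_on_subset[OF w(2)]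
  have ui: "set_integrable lebesgue K u" and Dui: "set_integrable lebesgue K Du"
    if "compact K" "K \<subseteq> D" for K
    using Du that D(3) unfolding W1p_loc_def has_weak_gradient_def by (meson order_trans)+
  have um: "set_borel_measurable lebesgue K u" and Dum: "set_borel_measurable lebesgue K Du"
    if "compact K" "K \<subseteq> D" for K
    using ui[OF that] Dui[OF that] unfolding set_integrable_def set_borel_measurable_def by (auto dest: borel_measurable_integrable)
  have Dup: "set_integrable lebesgue K (\<lambda>x. norm (Du x) powr p x)" if K: "compact K" "K \<subseteq> D" for K
  proof -
    have "Du \<in> Lp_var p K" using Du K D(3) unfolding W1p_loc_def Lp_var_loc_def by blast
    then obtain \<mu> where \<mu>: "\<mu> > 0" "set_integrable lebesgue K (\<lambda>x. (norm (Du x) / \<mu>) powr p x)"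
      unfolding Lp_var_def by blast
    show ?thesis
      by (rule set_integrable_p_energy_density[OF K(1) Dum[OF K] \<mu> pcK[OF K(2)]]) (use p(1) K(2) in blast)
  qed
  have bnds: "\<exists>P W. W \<ge> 1 \<and> P \<ge> 1 \<and> (\<forall>x\<in>K. p x \<le> P \<and> norm (grad w x) \<le> W)" if K: "compact K" "K \<subseteq> D" for K
  proof -
    have "bounded (p ` K)" "bounded (grad w ` K)"
      using K pcK gcK by (auto intro!: compact_imp_bounded compact_continuous_image)
    then obtain P W where "\<And>x. x \<in> K \<Longrightarrow> \<bar>p x\<bar> \<le> P" "\<And>x. x \<in> K \<Longrightarrow> norm (grad w x) \<le> W"
      by (force simp: bounded_iff)
    then show ?thesis by (intro exI[of _ "max P 1"] exI[of _ "max W 1"]) (force simp: abs_le_iff)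
  qed
  have field_w: "norm (p_field (p x) (grad w x)) \<le> W powr P" 
    if "x \<in> K" "K \<subseteq> D" "W \<ge> 1" "\<forall>x\<in>K. p x \<le> P \<and> norm (grad w x) \<le> W" for x K W P
  proof -
    have px: "p x > 1" using p(1) that by blast
    have "norm (grad w x) powr (p x - 1) \<le> W powr (p x - 1)" using px that by (intro powr_mono2) auto
    also have "\<dots> \<le> W powr P" using px that by (intro powr_mono) auto
    finally show ?thesis by (simp add: norm_p_field)
  qed
  have pf_Du: "set_integrable lebesgue K (\<lambda>x. p_field (p x) (Du x))"
    and pf_w: "set_integrable lebesgue K (\<lambda>x. p_field (p x) (grad w x))" if K: "compact K" "K \<subseteq> D" for K
  proof -
    show "set_integrable lebesgue K (\<lambda>x. p_field (p x) (Du x))"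
    proof (rule set_integrable_dominated)
      show "set_borel_measurable lebesgue K (\<lambda>x. p_field (p x) (Du x))"
        by (intro set_borel_measurable_p_field(1) Dum K set_borel_measurable_compact_continuous pcK)
      show "set_integrable lebesgue K (\<lambda>x. norm (Du x) powr p x + 1)"
        by (intro set_integral_add(1) Dup K set_integrable_const_compact)
      show "norm (p_field (p x) (Du x)) \<le> norm (Du x) powr p x + 1" if "x \<in> K" for x
        unfolding norm_p_field using p(1)[of x] that K by (intro powr_pred_le) auto
    qed
    obtain P W where PW: "W \<ge> 1" "\<forall>x\<in>K. p x \<le> P \<and> norm (grad w x) \<le> W" using bnds[OF K] by blast
    show "set_integrable lebesgue K (\<lambda>x. p_field (p x) (grad w x))"
    proof (rule set_integrable_dominated)
      show "set_borel_measurable lebesgue K (\<lambda>x. p_field (p x) (grad w x))"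
        by (intro set_borel_measurable_p_field(1) K set_borel_measurable_compact_continuous pcK gcK)
      show "set_integrable lebesgue K (\<lambda>x. W powr P)" by (rule set_integrable_const_compact[OF K(1)])
    qed (use field_w[OF _ K(2) PW] in blast)
  qed
  have AE_le: "AE y in lebesgue. y \<in> D \<longrightarrow> z y \<le> \<eta>" if "\<eta> > 0" for \<eta>
  proof -
    have "\<exists>K. compact K \<and> K \<subseteq> D \<and> (\<forall>x\<in>D - K. z x \<le> \<eta>)"
      using bdry[OF that] unfolding z_def by (simp add: diff_le_eq add.commute)
    then obtain K where K: "compact K" "K \<subseteq> D" "\<And>x. x \<in> D - K \<Longrightarrow> z x \<le> \<eta>" by blast
    show ?thesis
    proof (rule weak_maximum_principle[where Z=Z and F=F and p=p and L=L and K=K, OF D(1,2)])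
      fix \<phi> :: "real ^ 'n \<Rightarrow> real" and i assume \<phi>: "\<phi> \<in> test_functions D"
      note t = test_functionsD[OF \<phi>]
      have 1: "set_lebesgue_integral lebesgue D (\<lambda>y. u y * grad \<phi> y $ i) = - set_lebesgue_integral lebesgue D (\<lambda>y. Du y $ i * \<phi> y)"
      proof -
        have "set_lebesgue_integral lebesgue \<Omega> (\<lambda>y. u y * grad \<phi> y $ i) = - set_lebesgue_integral lebesgue \<Omega> (\<lambda>y. Du y $ i * \<phi> y)"
          using Du test_functions_mono[OF D(3) \<phi>] unfolding W1p_loc_def has_weak_gradient_def by blast
        moreover have "set_lebesgue_integral lebesgue \<Omega> (\<lambda>y. u y * grad \<phi> y $ i) = set_lebesgue_integral lebesgue D (\<lambda>y. u y * grad \<phi> y $ i)"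
          by (rule set_integral_test_restrict[OF \<phi> D(3)]) (simp add: t(5))
        moreover have "set_lebesgue_integral lebesgue \<Omega> (\<lambda>y. Du y $ i * \<phi> y) = set_lebesgue_integral lebesgue D (\<lambda>y. Du y $ i * \<phi> y)"
          by (rule set_integral_test_restrict[OF \<phi> D(3)]) (drule t(4), simp)
        ultimately show ?thesis by simp
      qed
      have 2: "set_lebesgue_integral lebesgue D (\<lambda>y. w y * grad \<phi> y $ i) = - set_lebesgue_integral lebesgue D (\<lambda>y. grad w y $ i * \<phi> y)"
        by (rule set_integral_by_parts[OF D(1) w(1) _ \<phi>]) (auto intro: continuous_on_component w(2))
      have "set_lebesgue_integral lebesgue D (\<lambda>y. z y * grad \<phi> y $ i) =
          set_lebesgue_integral lebesgue D (\<lambda>y. u y * grad \<phi> y $ i) - set_lebesgue_integral lebesgue D (\<lambda>y. w y * grad \<phi> y $ i)"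
        unfolding z_def left_diff_distrib
        by (intro set_integral_diff(2) integrable_test_mult_scalar[OF \<phi>] ui t(6,7) set_integrable_compact_continuous wcK)
      moreover have "set_lebesgue_integral lebesgue D (\<lambda>y. Z y $ i * \<phi> y) =
          set_lebesgue_integral lebesgue D (\<lambda>y. Du y $ i * \<phi> y) - set_lebesgue_integral lebesgue D (\<lambda>y. grad w y $ i * \<phi> y)"
        unfolding Z_def vector_minus_component left_diff_distrib
        by (intro set_integral_diff(2) integrable_test_mult(2)[OF \<phi>] Dui t(6,7) set_integrable_compact_continuous gcK)
      ultimately show "set_lebesgue_integral lebesgue D (\<lambda>y. z y * grad \<phi> y $ i) = - set_lebesgue_integral lebesgue D (\<lambda>y. Z y $ i * \<phi> y)"
        using 1 2 by simp
    next
      fix K :: "(real ^ 'n) set" assume K: "compact K" "K \<subseteq> D"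
      show "set_integrable lebesgue K z" unfolding z_def
        by (intro set_integral_diff(1) ui set_integrable_compact_continuous wcK K)
      show Zi: "set_integrable lebesgue K Z" unfolding Z_def
        by (intro set_integral_diff(1) Dui set_integrable_compact_continuous gcK K)
      have "set_integrable lebesgue K F" unfolding F_def
        by (intro set_integral_diff(1) pf_Du pf_w K)
      then show "set_borel_measurable lebesgue K F"
        unfolding set_integrable_def set_borel_measurable_def by (rule borel_measurable_integrable)
      obtain P W where PW: "W \<ge> 1" "P \<ge> 1" "\<forall>x\<in>K. p x \<le> P \<and> norm (grad w x) \<le> W" using bnds[OF K] by blast
      have mK: "K \<in> sets lebesgue" using K by (simp add: compact_imp_closed)
      show "set_integrable lebesgue K (\<lambda>x. norm (Z x) powr p x)"
      proof (rule set_integrable_dominated)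
        have "set_borel_measurable lebesgue K Z"
          using Zi unfolding set_integrable_def set_borel_measurable_def by (rule borel_measurable_integrable)
        then show "set_borel_measurable lebesgue K (\<lambda>x. norm (Z x) powr p x)"
          by (rule set_borel_measurable_p_field(2)[OF _ set_borel_measurable_compact_continuous[OF K(1) pcK[OF K(2)]] mK])
        show "set_integrable lebesgue K (\<lambda>x. 2 powr P * (norm (Du x) powr p x + W powr P))"
          by (intro set_integrable_mult_right set_integral_add(1) Dup K set_integrable_const_compact)
        fix x assume x: "x \<in> K"
        have px: "p x > 1" "p x \<le> P" "norm (grad w x) \<le> W" using p(1) x K PW by auto
        \<comment> \<open>|Z| is at most 2 m, and m^p is at most the sum of the p-th powers of the
          two numbers; bounding p by P then gives the constant 2^P.\<close>
        define m where "m = max (norm (Du x)) W"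
        have "norm (Z x) \<le> 2 * m" using norm_triangle_ineq4[of "Du x" "grad w x"] px by (simp add: Z_def m_def)
        then have "norm (Z x) powr p x \<le> (2 * m) powr p x" using px by (intro powr_mono2) auto
        also have "\<dots> = 2 powr p x * m powr p x" using PW by (subst powr_mult) (auto simp: m_def)
        also have "\<dots> \<le> 2 powr P * (norm (Du x) powr p x + W powr P)"
        proof (intro mult_mono)
          show "2 powr p x \<le> 2 powr P" using px by simp
          have "W powr p x \<le> W powr P" using px PW by (intro powr_mono) auto
          then show "m powr p x \<le> norm (Du x) powr p x + W powr P"
            by (simp add: m_def max_def add_increasing add_increasing2)
        qed auto
        finally show "norm (norm (Z x) powr p x) \<le> 2 powr P * (norm (Du x) powr p x + W powr P)" by simp
      qed
      show "\<exists>H C. set_integrable lebesgue K H \<and> C \<ge> 0 \<and> (\<forall>x\<in>K. \<forall>t\<ge>0. norm (F x) * t \<le> H x + C * t powr p x)"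
      proof (intro exI conjI ballI allI impI)
        show "set_integrable lebesgue K (\<lambda>x. norm (Du x) powr p x + W powr P)"
          by (intro set_integral_add(1) Dup K set_integrable_const_compact)
        show "0 \<le> 1 + W powr P" by (simp add: add_nonneg_nonneg)
        fix x and t :: real assume x: "x \<in> K" and t: "t \<ge> 0"
        have px: "p x > 1" using p(1) x K by auto
        have "norm (F x) * t \<le> (norm (Du x) powr (p x - 1) + W powr P) * t"
          using norm_triangle_ineq4[of "p_field (p x) (Du x)" "p_field (p x) (grad w x)"]
            field_w[OF x K(2) PW(1,3)] t
          by (intro mult_right_mono) (auto simp: F_def norm_p_field)
        also have "\<dots> = norm (Du x) powr (p x - 1) * t + W powr P * t" by (simp add: distrib_right)
        also have "\<dots> \<le> (norm (Du x) powr p x + t powr p x) + W powr P * (1 + t powr p x)"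
          using px t by (intro add_mono powr_pred_times_le mult_left_mono le_one_plus_powr) auto
        finally show "norm (F x) * t \<le> norm (Du x) powr p x + W powr P + (1 + W powr P) * t powr p x"
          by (simp add: algebra_simps)
      qed
    next
      show "\<bar>p x - p y\<bar> \<le> L * norm (x - y)" if "x \<in> D" "y \<in> D" for x y
        using lipschitz_onD[OF p(2) that] by (simp add: dist_norm)
      fix \<psi> :: "real ^ 'n \<Rightarrow> real" assume \<psi>: "\<psi> \<in> test_functions D" "\<And>x. \<psi> x \<ge> 0"
      note t = test_functionsD[OF \<psi>(1)]
      have "px_energy p \<Omega> Du \<psi> = px_energy p D Du \<psi>"
        unfolding px_energy_def by (rule set_integral_test_restrict[OF \<psi>(1) D(3)]) (simp add: t(5))
      then have "px_energy p D Du \<psi> - px_energy p D (grad w) \<psi> \<le> 0"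
        using sub[OF test_functions_mono[OF D(3) \<psi>(1)] \<psi>(2)] super[OF \<psi>] by simp
      moreover have "set_lebesgue_integral lebesgue D (\<lambda>x. F x \<bullet> grad \<psi> x) = px_energy p D Du \<psi> - px_energy p D (grad w) \<psi>"
        unfolding F_def inner_diff_left px_energy_def p_field_def[symmetric]
        by (intro set_integral_diff(2) integrable_test_mult(1)[OF \<psi>(1)] pf_Du pf_w t(6,7))
      ultimately show "set_lebesgue_integral lebesgue D (\<lambda>x. F x \<bullet> grad \<psi> x) \<le> 0" by simp
    next
      show "F x \<bullet> Z x \<ge> 0" if "x \<in> D" for x
        unfolding F_def Z_def using p(1)[OF that] by (rule p_field_strict_mono)
      show "Z x = 0" if "x \<in> D" "F x \<bullet> Z x = 0" for x
        using p_field_strict_mono(2)[OF p(1)[OF that(1)]] that(2) by (auto simp: F_def Z_def)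
    qed (use p(1) K \<open>\<eta> > 0\<close> in auto)
  qed
  have "ess_limsup_on \<Omega> u x \<le> ereal (w x)"
    by (rule ess_limsup_le[OF D(1,3) x wc um]) (use AE_le in \<open>auto simp: z_def\<close>)
  moreover have "ereal (u x) = ess_limsup_on \<Omega> u x" using u x D(3) unfolding px_subharmonic_def by blast
  ultimately show ?thesis by (metis ereal_less_eq(3))
qed

section \<open>The radial barrier\<close>

lemma integral_diff_Icc:
  fixes f :: "real \<Rightarrow> real"
  assumes "f integrable_on {0..y}" "0 \<le> x" "x \<le> y"
  shows "integral {0..y} f - integral {0..x} f = integral {x..y} f"
  using Henstock_Kurzweil_Integration.integral_combine[OF assms(2,3,1)] by simp

lemma integral_ge_const:
  fixes f :: "real \<Rightarrow> real"
  assumes "f integrable_on {x..y}" "x \<le> y" "\<And>t. t \<in> {x..y} \<Longrightarrow> c \<le> f t"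
  shows "(y - x) * c \<le> integral {x..y} f"
  using integral_le[OF integrable_const_ivl[of c x y] assms(1)] assms(2,3) by simp

lemma integral_le_const:
  fixes f :: "real \<Rightarrow> real"
  assumes "f integrable_on {x..y}" "x \<le> y" "\<And>t. t \<in> {x..y} \<Longrightarrow> f t \<le> c"
  shows "integral {x..y} f \<le> (y - x) * c"
  using integral_le[OF assms(1) integrable_const_ivl[of c x y]] assms(2,3) by simp

lemma has_real_derivative_integral:
  fixes f :: "real \<Rightarrow> real"
  assumes "continuous_on {0..B} f" "0 < s" "s < B"
  shows "((\<lambda>t. integral {0..t} f) has_real_derivative f s) (at s)"
  using integral_has_real_derivative[OF assms(1), of s] assms(2,3) by (simp add: at_within_Icc_at)

text \<open>The radial profile of the barrier has slope \<open>exp g\<close>, where \<open>g = \<epsilon> - (\<epsilon> - ln \<nu>) * exp T\<close>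
  solves \<open>g' = - T' * (\<epsilon> - g)\<close>. Since \<open>a\<close> may jump, \<open>T\<close> is not \<open>\<integral>a\<close> itself
  but an average of it over a short interval to the right, so that \<open>T' \<ge> a\<close> is continuous.\<close>

lemma barrier_profile:
  fixes a :: "real \<Rightarrow> real"
  defines "J \<equiv> \<lambda>t. integral {0..t} a"
  assumes a: "mono_on {0..} a" "\<And>s. s \<ge> 0 \<Longrightarrow> a s > 0" and R: "R > 0" and \<nu>: "0 < \<nu>" "\<nu> \<le> 1"
    and \<epsilon>: "\<epsilon> \<ge> 0" "\<epsilon> * exp (J R) \<le> q"
  obtains \<phi> g \<kappa> :: "real \<Rightarrow> real" where
    "\<phi> 0 = 0" "continuous_on {0..R} \<phi>"
    "\<And>s. 0 < s \<Longrightarrow> s < R \<Longrightarrow> (\<phi> has_real_derivative exp (g s)) (at s)"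
    "\<And>s. 0 < s \<Longrightarrow> s < R \<Longrightarrow> (g has_real_derivative - \<kappa> s * (\<epsilon> - g s)) (at s)"
    "continuous_on {0<..<R} \<kappa>" "\<And>s. 0 < s \<Longrightarrow> s < R \<Longrightarrow> g s \<le> 0" "\<And>s. 0 < s \<Longrightarrow> s < R \<Longrightarrow> a s \<le> \<kappa> s"
    "\<And>s. 0 \<le> s \<Longrightarrow> s \<le> R \<Longrightarrow> \<phi> s \<le> integral {0..s} (\<lambda>t. \<nu> powr exp (J t))"
    "\<And>h. 0 \<le> h \<Longrightarrow> h \<le> R \<Longrightarrow> h * (exp (ln \<nu> - 2 * q) * \<nu> powr exp (J R)) \<le> \<phi> R - \<phi> (R - h)"
    "\<And>s t. 0 \<le> s \<Longrightarrow> s \<le> t \<Longrightarrow> t \<le> R \<Longrightarrow> \<phi> s \<le> \<phi> t"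
proof -
  \<comment> \<open>Room to the right of R: s + \<delta> stays below R + 1 and hence inside the
    interval where J is continuous and its primitive J2 is differentiable.\<close>
  define B where "B = R + 2"
  have a_int: "a integrable_on {0..y}" for y
    using a(1) by (intro integrable_on_mono_on mono_on_subset[OF a(1)]) auto
  have a_int': "a integrable_on {x..y}" if "0 \<le> x" for x y
    using that by (intro integrable_on_mono_on mono_on_subset[OF a(1)]) auto
  have J_diff: "J y - J x = integral {x..y} a" if "0 \<le> x" "x \<le> y" for x y
    unfolding J_def by (rule integral_diff_Icc[OF a_int that])
  have J_ge: "(y - x) * a x \<le> J y - J x" if "0 \<le> x" "x \<le> y" for x y
    unfolding J_diff[OF that]
    using that mono_onD[OF a(1)] by (intro integral_ge_const a_int') auto
  have J_mono: "J x \<le> J y" if "0 \<le> x" "x \<le> y" for x y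
  proof -
    have "0 \<le> (y - x) * a x" using that a(2)[of x] by (intro mult_nonneg_nonneg) auto
    then show ?thesis using J_ge[OF that] by linarith
  qed
  have J0: "J 0 = 0" by (simp add: J_def)
  have J_nonneg: "J s \<ge> 0" if "s \<ge> 0" for s using J_mono[of 0 s] that J0 by simp
  have J_cont: "continuous_on {0..B} J" unfolding J_def by (rule indefinite_integral_continuous_1[OF a_int])

  \<comment> \<open>The averaging length is chosen by continuity so that it raises exp (J R) by at
    most 1; in the final lower bound for the slope this costs only a constant factor.\<close>
  have "\<exists>\<delta>>0. \<delta> < 1 \<and> exp (J (R + \<delta>)) \<le> exp (J R) + 1"
  proof -
    have "continuous_on {0..B} (\<lambda>s. exp (J s))" by (intro continuous_intros J_cont)
    then obtain d where d: "d > 0" "\<And>x. x \<in> {0..B} \<Longrightarrow> dist x R < d \<Longrightarrow> dist (exp (J x)) (exp (J R)) < 1"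
      unfolding continuous_on_iff using R by (metis B_def atLeastAtMost_iff less_eq_real_def less_add_same_cancel1 zero_less_numeral zero_less_one)
    define \<delta> where "\<delta> = min (d / 2) (1 / 2)"
    have "\<delta> > 0" "\<delta> < 1" "dist (R + \<delta>) R < d" using d(1) by (auto simp: \<delta>_def dist_real_def)
    moreover have "R + \<delta> \<in> {0..B}" using R \<open>\<delta> > 0\<close> \<open>\<delta> < 1\<close> by (simp add: B_def)
    ultimately have "dist (exp (J (R + \<delta>))) (exp (J R)) < 1" using d(2) by blast
    then have "exp (J (R + \<delta>)) \<le> exp (J R) + 1" by (simp add: dist_real_def abs_less_iff)
    then show ?thesis using \<open>\<delta> > 0\<close> \<open>\<delta> < 1\<close> by blast
  qed
  then obtain \<delta> where \<delta>: "\<delta> > 0" "\<delta> < 1" "exp (J (R + \<delta>)) \<le> exp (J R) + 1" by blast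

  define J2 where "J2 = (\<lambda>t. integral {0..t} J)"
  have J_int: "J integrable_on {0..y}" if "y \<le> B" for y
    using that by (intro integrable_continuous_interval continuous_on_subset[OF J_cont]) auto
  have J2_cont: "continuous_on {0..B} J2" unfolding J2_def by (rule indefinite_integral_continuous_1[OF J_int]) simp
  define T where "T = (\<lambda>s. (J2 (s + \<delta>) - J2 s) / \<delta>)"
  define \<kappa> where "\<kappa> = (\<lambda>s. (J (s + \<delta>) - J s) / \<delta>)"
  have T_deriv: "(T has_real_derivative \<kappa> s) (at s)" if "0 < s" "s < R" for s
  proof -
    have 1: "(J2 has_real_derivative J s) (at s)" if "0 < s" "s < B" for s
      unfolding J2_def by (rule has_real_derivative_integral[OF J_cont that])
    have "((\<lambda>s. J2 (s + \<delta>)) has_real_derivative J (s + \<delta>)) (at s)"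
      using 1[of "s + \<delta>"] that \<delta> by (simp add: DERIV_shift B_def)
    then show ?thesis unfolding T_def \<kappa>_def using 1[of s] that \<delta>
      by (intro DERIV_cdivide DERIV_diff) (auto simp: B_def)
  qed
  have T_bounds: "J s \<le> T s" "T s \<le> J (s + \<delta>)" if "0 \<le> s" "s \<le> R" for s
  proof -
    have eq: "J2 (s + \<delta>) - J2 s = integral {s..s + \<delta>} J"
      unfolding J2_def using that \<delta> by (intro integral_diff_Icc J_int) (auto simp: B_def)
    have Ts: "T s = integral {s..s + \<delta>} J / \<delta>" by (simp add: T_def eq)
    have i: "J integrable_on {s..s + \<delta>}"
      using that \<delta> by (intro integrable_continuous_interval continuous_on_subset[OF J_cont]) (auto simp: B_def)
    have "(s + \<delta> - s) * J s \<le> integral {s..s + \<delta>} J"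
      using that \<delta> by (intro integral_ge_const i J_mono) auto
    then show "J s \<le> T s" unfolding Ts using \<delta>(1) by (simp add: le_divide_eq mult.commute)
    have "integral {s..s + \<delta>} J \<le> (s + \<delta> - s) * J (s + \<delta>)"
      using that \<delta> by (intro integral_le_const i J_mono) auto
    then show "T s \<le> J (s + \<delta>)" unfolding Ts using \<delta>(1) by (simp add: divide_le_eq mult.commute)
  qed
  have T_cont: "continuous_on {0..R} T"
    unfolding T_def using \<delta>
    by (intro continuous_intros continuous_on_subset[OF J2_cont] continuous_on_compose2[OF J2_cont]) (auto simp: B_def)
  \<comment> \<open>\<kappa>(s) is the mean of the nondecreasing function \<open>a\<close> over
    [s, s + \<delta>], hence at least its left value.\<close>
  have \<kappa>_ge: "a s \<le> \<kappa> s" if "0 \<le> s" for s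
    using J_ge[of s "s + \<delta>"] that \<delta> by (simp add: \<kappa>_def field_simps)
  have \<kappa>_cont: "continuous_on {0<..<R} \<kappa>"
    unfolding \<kappa>_def using \<delta>
    by (intro continuous_intros continuous_on_subset[OF J_cont] continuous_on_compose2[OF J_cont]) (auto simp: B_def)

  define m where "m = - ln \<nu>"
  have m: "m \<ge> 0" using \<nu> by (simp add: m_def)
  have \<nu>_powr: "\<nu> powr y = exp (- m * y)" for y using \<nu> by (simp add: powr_def m_def mult.commute)
  define g where "g = (\<lambda>s. \<epsilon> - (m + \<epsilon>) * exp (T s))"
  have g_cont: "continuous_on {0..R} (\<lambda>s. exp (g s))" unfolding g_def by (intro continuous_intros T_cont)
  have T_nonneg: "T s \<ge> 0" if "0 \<le> s" "s \<le> R" for s using T_bounds(1)[OF that] J_nonneg[OF that(1)] by linarith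
  \<comment> \<open>The correction by \<epsilon> goes the right way: since T \<ge> J \<ge> 0, the
    term \<epsilon> (1 - exp T) is nonpositive and the slope stays below the extremal one.\<close>
  have g_le: "g s \<le> - m * exp (J s)" if s: "0 \<le> s" "s \<le> R" for s
  proof -
    have "m * exp (J s) \<le> m * exp (T s)" using T_bounds(1)[OF s] m by (intro mult_left_mono) auto
    moreover have "\<epsilon> * 1 \<le> \<epsilon> * exp (T s)" using T_nonneg[OF s] \<epsilon>(1) by (intro mult_left_mono) auto
    ultimately show ?thesis by (simp add: g_def algebra_simps)
  qed
  have T_le_TR: "T s \<le> T t" if "0 \<le> s" "s \<le> t" "t \<le> R" for s t
  proof (rule DERIV_nonneg_imp_increasing_open[OF that(2)])
    show "continuous_on {s..t} T" using that by (intro continuous_on_subset[OF T_cont]) auto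
    fix z assume "s < z" "z < t"
    then have z: "0 < z" "z < R" using that by auto
    have "0 \<le> \<kappa> z" using \<kappa>_ge[of z] a(2)[of z] z by linarith
    then show "\<exists>y. (T has_real_derivative y) (at z) \<and> 0 \<le> y" using T_deriv[OF z] by blast
  qed
  have g_ge: "g R \<le> g s" if "0 \<le> s" "s \<le> R" for s
    using T_le_TR[of s R] that m \<epsilon>(1) by (auto simp: g_def intro!: mult_left_mono)
  \<comment> \<open>In (m + \<epsilon>)(exp (J R) + 1) the single m gives the summand ln \<nu>,
    while \<epsilon> exp (J R) and \<epsilon> are each at most q; this is the origin of 2 q.\<close>
  have gR: "exp (ln \<nu> - 2 * q) * \<nu> powr exp (J R) \<le> exp (g R)"
  proof -
    have "exp (T R) \<le> exp (J (R + \<delta>))" using T_bounds(2)[of R] R by simp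
    then have "exp (T R) \<le> exp (J R) + 1" using \<delta>(3) by linarith
    then have "(m + \<epsilon>) * exp (T R) \<le> (m + \<epsilon>) * (exp (J R) + 1)" using m \<epsilon>(1) by (intro mult_left_mono) auto
    moreover have "\<epsilon> * 1 \<le> \<epsilon> * exp (J R)" using J_nonneg[of R] R \<epsilon>(1) by (intro mult_left_mono) auto
    ultimately have "g R \<ge> - m * exp (J R) - m - 2 * q"
      using \<epsilon> by (simp add: g_def algebra_simps)
    then have "exp (- m * exp (J R) - m - 2 * q) \<le> exp (g R)" by simp
    moreover have "exp (ln \<nu> - 2 * q) * \<nu> powr exp (J R) = exp (- m * exp (J R) - m - 2 * q)"
      by (simp add: \<nu>_powr m_def flip: exp_add)
    ultimately show ?thesis by simp
  qed
  define \<phi> where "\<phi> = (\<lambda>s. integral {0..s} (\<lambda>t. exp (g t)))"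
  have e_int: "(\<lambda>t. exp (g t)) integrable_on {0..s}" if "s \<le> R" for s
    using that by (intro integrable_continuous_interval continuous_on_subset[OF g_cont]) auto
  have e_int': "(\<lambda>t. exp (g t)) integrable_on {s..t}" if "0 \<le> s" "t \<le> R" for s t
    using that by (intro integrable_continuous_interval continuous_on_subset[OF g_cont]) auto
  have \<phi>_diff: "\<phi> t - \<phi> s = integral {s..t} (\<lambda>t. exp (g t))" if "0 \<le> s" "s \<le> t" "t \<le> R" for s t
    unfolding \<phi>_def using that by (intro integral_diff_Icc e_int) auto
  show ?thesis
  proof (rule that[of \<phi> g \<kappa>])
    show "\<phi> 0 = 0" by (simp add: \<phi>_def)
    show "continuous_on {0..R} \<phi>" unfolding \<phi>_def by (rule indefinite_integral_continuous_1[OF e_int]) simp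
    show "(\<phi> has_real_derivative exp (g s)) (at s)" if "0 < s" "s < R" for s
      unfolding \<phi>_def by (rule has_real_derivative_integral[OF g_cont that])
    show "(g has_real_derivative - \<kappa> s * (\<epsilon> - g s)) (at s)" if "0 < s" "s < R" for s
      unfolding g_def using T_deriv[OF that] by (auto intro!: derivative_eq_intros)
    show "continuous_on {0<..<R} \<kappa>" by (rule \<kappa>_cont)
    show "g s \<le> 0" if "0 < s" "s < R" for s
    proof -
      have "- m * exp (J s) \<le> 0" using m by (simp add: mult_nonneg_nonneg)
      then show ?thesis using g_le[of s] that by linarith
    qed
    show "a s \<le> \<kappa> s" if "0 < s" "s < R" for s using \<kappa>_ge[of s] that by simp
    show "\<phi> s \<le> integral {0..s} (\<lambda>t. \<nu> powr exp (J t))" if "0 \<le> s" "s \<le> R" for s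
      unfolding \<phi>_def
    proof (rule integral_le[OF e_int[OF that(2)]])
      show "(\<lambda>t. \<nu> powr exp (J t)) integrable_on {0..s}"
        unfolding \<nu>_powr using that
        by (intro integrable_continuous_interval continuous_intros continuous_on_subset[OF J_cont]) (auto simp: B_def)
      show "exp (g t) \<le> \<nu> powr exp (J t)" if "t \<in> {0..s}" for t
        unfolding \<nu>_powr using g_le[of t] that \<open>s \<le> R\<close> by simp
    qed
    show "h * (exp (ln \<nu> - 2 * q) * \<nu> powr exp (J R)) \<le> \<phi> R - \<phi> (R - h)" if "0 \<le> h" "h \<le> R" for h
    proof -
      have "(R - (R - h)) * exp (g R) \<le> integral {R - h..R} (\<lambda>t. exp (g t))"
        using that by (intro integral_ge_const e_int') (auto intro: g_ge)
      moreover have "h * (exp (ln \<nu> - 2 * q) * \<nu> powr exp (J R)) \<le> h * exp (g R)"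
        using gR that by (intro mult_left_mono) auto
      ultimately show ?thesis using \<phi>_diff[of "R - h" R] that by simp
    qed
    show "\<phi> s \<le> \<phi> t" if "0 \<le> s" "s \<le> t" "t \<le> R" for s t
      using integral_ge_const[OF e_int'[OF that(1,3)] that(2), of 0] \<phi>_diff[OF that] by simp
  qed
qed

lemma has_derivative_dist_center:
  assumes "x \<noteq> (c :: real ^ 'n::finite)"
  shows "((\<lambda>x. norm (x - c)) has_derivative (\<lambda>v. sgn (x - c) \<bullet> v)) (at x)"
proof -
  have "((\<lambda>x. x - c) has_derivative (\<lambda>v. v)) (at x)" by (auto intro!: derivative_eq_intros)
  from has_derivative_compose[OF this has_derivative_norm[of "x - c"]] assms
  show ?thesis by (simp add: inner_commute)
qed

text \<open>Continuity of \<kappa> makes the flux a C^1 field, so classical integration by parts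
  turns the weak inequality into the sign of a pointwise divergence. The constant \<open>b\<close>
  does not change the gradient and allows the barrier to be shifted.\<close>

lemma radial_supersolution:
  fixes p :: "real ^ 'n::finite \<Rightarrow> real" and c :: "real ^ 'n" and \<phi> g \<kappa> :: "real \<Rightarrow> real" and G R b \<epsilon> :: real
  defines "\<rho> \<equiv> \<lambda>x. norm (x - c) - G"
  assumes D: "open D" and G: "G > 0" and \<rho>: "\<And>x. x \<in> D \<Longrightarrow> 0 < \<rho> x \<and> \<rho> x < R"
    and \<phi>: "\<And>s. 0 < s \<Longrightarrow> s < R \<Longrightarrow> (\<phi> has_real_derivative exp (g s)) (at s)"
    and g: "\<And>s. 0 < s \<Longrightarrow> s < R \<Longrightarrow> (g has_real_derivative - \<kappa> s * (\<epsilon> - g s)) (at s)"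
      "\<And>s. 0 < s \<Longrightarrow> s < R \<Longrightarrow> g s \<le> 0"
    and \<kappa>: "continuous_on {0<..<R} \<kappa>"
    and p: "C1_on D p" "\<And>x. x \<in> D \<Longrightarrow> p x > 1"
      "\<And>x. x \<in> D \<Longrightarrow> norm (grad p x) \<le> (p x - 1) * \<kappa> (\<rho> x)"
      "\<And>x. x \<in> D \<Longrightarrow> real CARD('n) / G \<le> (p x - 1) * \<kappa> (\<rho> x) * \<epsilon>"
  defines "w \<equiv> \<lambda>x. \<phi> (\<rho> x) + b"
  shows "\<And>x. x \<in> D \<Longrightarrow> w differentiable (at x)" "continuous_on D (grad w)"
    "\<And>\<psi>. \<psi> \<in> test_functions D \<Longrightarrow> (\<And>x. \<psi> x \<ge> 0) \<Longrightarrow> px_energy p D (grad w) \<psi> \<ge> 0"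
proof -
  define e where "e = (\<lambda>x. sgn (x - c))"
  define r where "r = (\<lambda>x. norm (x - c))"
  have r_pos: "r x > G" if "x \<in> D" for x using \<rho>[OF that] by (simp add: \<rho>_def r_def)
  have r0: "r x > 0" if "x \<in> D" for x using r_pos[OF that] G by simp
  have ne: "x \<noteq> c" if "x \<in> D" for x using r0[OF that] by (auto simp: r_def)
  have e_nth: "e x $ i = (x - c) $ i / r x" for x i by (simp add: e_def r_def sgn_div_norm divide_inverse mult.commute)
  have e_norm: "norm (e x) = 1" if "x \<in> D" for x using ne[OF that] by (simp add: e_def norm_sgn)
  have e_sq: "(\<Sum>i\<in>UNIV. e x $ i * e x $ i) = 1" if "x \<in> D" for x
    using e_norm[OF that] by (simp add: norm_eq_1 inner_vec_def)
  have dr: "(r has_derivative (\<lambda>v. e x \<bullet> v)) (at x)" if "x \<in> D" for x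
    unfolding r_def e_def by (rule has_derivative_dist_center[OF ne[OF that]])
  have r_diff: "r differentiable (at x)" "grad r x = e x" if "x \<in> D" for x
    using dr[OF that] by (auto simp: differentiable_def grad_eqI)
  have \<rho>_r: "\<rho> = (\<lambda>x. r x - G)" by (simp add: \<rho>_def r_def)
  have d\<rho>: "(\<rho> has_derivative (\<lambda>v. e x \<bullet> v)) (at x)" if "x \<in> D" for x
    unfolding \<rho>_r using dr[OF that] by (auto intro!: derivative_eq_intros)
  have \<rho>_diff: "\<rho> differentiable (at x)" "grad \<rho> x = e x" if "x \<in> D" for x
    using d\<rho>[OF that] by (auto simp: differentiable_def grad_eqI)
  have grad_const: "grad (\<lambda>_. t) x = 0" for t :: real and x :: "real ^ 'n" by (intro grad_eqI) simp
  have cont_of_diff: "continuous_on D f" if "\<And>x. x \<in> D \<Longrightarrow> f differentiable (at x)" for f :: "real ^ 'n \<Rightarrow> real"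
    using that by (simp add: continuous_at_imp_continuous_on differentiable_imp_continuous_within)
  have rc: "continuous_on D r" by (rule cont_of_diff[OF r_diff(1)])
  have \<rho>c: "continuous_on D \<rho>" by (rule cont_of_diff[OF \<rho>_diff(1)])
  have pd: "p differentiable (at x)" if "x \<in> D" for x using p(1) that by (simp add: C1_on_def)
  have pc: "continuous_on D p" by (rule cont_of_diff[OF pd])
  have gpc: "continuous_on D (\<lambda>x. grad p x $ i)" for i
    using p(1) by (intro continuous_on_component) (simp add: C1_on_def)
  have ec: "continuous_on D (\<lambda>x. e x $ i)" for i
    unfolding e_nth using r0 by (intro continuous_intros rc) (auto simp: less_imp_neq[symmetric])
  have ec': "continuous_on D e"
  proof -
    have "continuous_on D (\<lambda>x. \<chi> i. e x $ i)" by (intro continuous_on_vec_lambda ec)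
    then show ?thesis by simp
  qed
  have g\<rho>: "(\<lambda>x. g (\<rho> x)) differentiable (at x)"
    "grad (\<lambda>x. g (\<rho> x)) x = (- \<kappa> (\<rho> x) * (\<epsilon> - g (\<rho> x))) *\<^sub>R e x" if x: "x \<in> D" for x
    using grad_compose[OF \<rho>_diff(1)[OF x] g(1)] \<rho>[OF x] \<rho>_diff(2)[OF x]
    unfolding differentiable_def by (blast, simp)
  have g\<rho>c: "continuous_on D (\<lambda>x. g (\<rho> x))" by (rule cont_of_diff[OF g\<rho>(1)])
  have \<kappa>\<rho>c: "continuous_on D (\<lambda>x. \<kappa> (\<rho> x))"
    by (rule continuous_on_compose2[OF \<kappa> \<rho>c]) (use \<rho> in auto)
  have \<phi>\<rho>: "(\<lambda>x. \<phi> (\<rho> x)) differentiable (at x)" "grad (\<lambda>x. \<phi> (\<rho> x)) x = exp (g (\<rho> x)) *\<^sub>R e x" if x: "x \<in> D" for x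
    using grad_compose[OF \<rho>_diff(1)[OF x] \<phi>] \<rho>[OF x] \<rho>_diff(2)[OF x]
    unfolding differentiable_def by (blast, simp)
  show w_diff: "w differentiable (at x)" if "x \<in> D" for x
    unfolding w_def using \<phi>\<rho>(1)[OF that] by (intro differentiable_add) auto
  have grad_w: "grad w x = exp (g (\<rho> x)) *\<^sub>R e x" if "x \<in> D" for x
    unfolding w_def using \<phi>\<rho>[OF that] by (subst grad_add) (auto simp: grad_const)
  show "continuous_on D (grad w)"
    by (rule continuous_on_eq[of _ "\<lambda>x. exp (g (\<rho> x)) *\<^sub>R e x"])
       (auto intro!: continuous_intros g\<rho>c ec' simp: grad_w)

  \<comment> \<open>As |Dw| = exp g and e is a unit vector, the flux is E e with E =
    |Dw|^(p-1).\<close>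
  define E where "E = (\<lambda>x. exp ((p x - 1) * g (\<rho> x)))"
  define V where "V = (\<lambda>i x. E x * e x $ i)"
  \<comment> \<open>The product rule for E e_i: the derivative of e_i = (x - c)_i / r is (1 - e_i^2)
    / r, and that of E involves both g' and the derivative of the exponent.\<close>
  define dV where "dV = (\<lambda>i x. E x * (inverse (r x) - e x $ i * e x $ i * inverse (r x))
     + e x $ i * (E x * ((p x - 1) * (- \<kappa> (\<rho> x) * (\<epsilon> - g (\<rho> x)) * e x $ i) + g (\<rho> x) * grad p x $ i)))"
  have E_pos: "E x > 0" for x by (simp add: E_def)
  have pm: "(\<lambda>x. p x - 1) differentiable (at x)" "grad (\<lambda>x. p x - 1) x = grad p x" if "x \<in> D" for x
    using pd[OF that] by (auto simp: grad_diff grad_const intro: differentiable_diff)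
  have E_d: "E differentiable (at x)"
    "grad E x = E x *\<^sub>R ((p x - 1) *\<^sub>R ((- \<kappa> (\<rho> x) * (\<epsilon> - g (\<rho> x))) *\<^sub>R e x) + g (\<rho> x) *\<^sub>R grad p x)" if x: "x \<in> D" for x
  proof -
    have 1: "(\<lambda>x. (p x - 1) * g (\<rho> x)) differentiable (at x)"
      using pm(1)[OF x] g\<rho>(1)[OF x] by (rule differentiable_mult)
    have 2: "grad (\<lambda>x. (p x - 1) * g (\<rho> x)) x = (p x - 1) *\<^sub>R ((- \<kappa> (\<rho> x) * (\<epsilon> - g (\<rho> x))) *\<^sub>R e x) + g (\<rho> x) *\<^sub>R grad p x"
      using grad_mult[OF pm(1)[OF x] g\<rho>(1)[OF x]] by (simp add: pm(2)[OF x] g\<rho>(2)[OF x])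
    show "E differentiable (at x)" unfolding E_def
      using grad_compose(1)[OF 1 DERIV_exp] unfolding differentiable_def by blast
    show "grad E x = E x *\<^sub>R ((p x - 1) *\<^sub>R ((- \<kappa> (\<rho> x) * (\<epsilon> - g (\<rho> x))) *\<^sub>R e x) + g (\<rho> x) *\<^sub>R grad p x)"
      unfolding E_def using grad_compose(2)[OF 1 DERIV_exp] by (simp add: 2)
  qed
  have q_d: "(\<lambda>x. (x - c) $ i * inverse (r x)) differentiable (at x)"
    "grad (\<lambda>x. (x - c) $ i * inverse (r x)) x $ i = inverse (r x) - e x $ i * e x $ i * inverse (r x)" if x: "x \<in> D" for x i
  proof -
    have "((\<lambda>x. (x - c) $ i) has_derivative (\<lambda>v. axis i 1 \<bullet> v)) (at x)"
    proof -
      have "((\<lambda>x. x $ i - c $ i) has_derivative (\<lambda>v. v $ i)) (at x)"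
        by (auto intro!: derivative_eq_intros bounded_linear_imp_has_derivative bounded_linear_vec_nth)
      then show ?thesis by (simp add: inner_axis')
    qed
    then have 1: "(\<lambda>x. (x - c) $ i) differentiable (at x)" "grad (\<lambda>x. (x - c) $ i) x = axis i 1"
      by (auto simp: differentiable_def grad_eqI)
    have "(inverse has_real_derivative - (inverse (r x) * inverse (r x))) (at (r x))"
      using DERIV_inverse[of "r x"] r0[OF x] by (simp add: power2_eq_square)
    from grad_compose[OF r_diff(1)[OF x] this]
    have 2: "(\<lambda>x. inverse (r x)) differentiable (at x)"
      "grad (\<lambda>x. inverse (r x)) x = - (inverse (r x) * inverse (r x)) *\<^sub>R e x"
      unfolding r_diff(2)[OF x] differentiable_def by blast+
    show "(\<lambda>x. (x - c) $ i * inverse (r x)) differentiable (at x)" by (rule differentiable_mult[OF 1(1) 2(1)])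
    show "grad (\<lambda>x. (x - c) $ i * inverse (r x)) x $ i = inverse (r x) - e x $ i * e x $ i * inverse (r x)"
      unfolding grad_mult[OF 1(1) 2(1)] 1(2) 2(2) by (simp add: e_nth divide_inverse axis_def)
  qed
  have q_e: "(x - c) $ i * inverse (r x) = e x $ i" for x i by (simp add: e_nth divide_inverse)
  have V_d: "V i differentiable (at x)" "grad (V i) x $ i = dV i x" if x: "x \<in> D" for x i
  proof -
    note q = q_d[OF x, of i, unfolded q_e]
    show "V i differentiable (at x)" unfolding V_def by (rule differentiable_mult[OF E_d(1)[OF x] q(1)])
    show "grad (V i) x $ i = dV i x"
      unfolding V_def grad_mult[OF E_d(1)[OF x] q(1)] dV_def
      by (simp add: q(2) E_d(2)[OF x] algebra_simps)
  qed
  have Ec: "continuous_on D E" by (rule cont_of_diff[OF E_d(1)])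
  have irc: "continuous_on D (\<lambda>x. inverse (r x))" using r0 by (intro continuous_intros rc) (auto simp: less_imp_neq[symmetric])
  have dVc: "continuous_on D (dV i)" for i
    unfolding dV_def by (intro continuous_intros Ec irc ec pc gpc \<kappa>\<rho>c g\<rho>c)
  have div_le: "(\<Sum>i\<in>UNIV. dV i x) \<le> 0" if x: "x \<in> D" for x
  proof -
    define s where "s = \<rho> x"
    have s: "0 < s" "s < R" using \<rho>[OF x] by (auto simp: s_def)
    define n where "n = real CARD('n)"
    \<comment> \<open>Since the squares of the e_i sum to 1, the first terms add up to the curvature
      (n - 1) / r and the others to (p - 1) g' and g (e . Dp).\<close>
    have "(\<Sum>i\<in>UNIV. dV i x) = E x * inverse (r x) * (n - (\<Sum>i\<in>UNIV. e x $ i * e x $ i))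
       + E x * (p x - 1) * (- \<kappa> s * (\<epsilon> - g s)) * (\<Sum>i\<in>UNIV. e x $ i * e x $ i)
       + E x * g s * (\<Sum>i\<in>UNIV. e x $ i * grad p x $ i)"
      by (simp add: dV_def s_def n_def sum.distrib sum_subtractf sum_distrib_left sum_distrib_right algebra_simps)
    also have "\<dots> = E x * (inverse (r x) * (n - 1) + (p x - 1) * (- \<kappa> s * (\<epsilon> - g s)) + g s * (e x \<bullet> grad p x))"
      by (simp add: e_sq[OF x] inner_vec_def algebra_simps)
    also have "\<dots> \<le> 0"
    proof (intro mult_nonneg_nonpos less_imp_le[OF E_pos])
      \<comment> \<open>Here g \<le> 0 is used: multiplying by -g bounds the exponent term by the
        part of (p - 1) g' proportional to g. The part of g' containing \<epsilon> is left to pay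
        for the curvature.\<close>
      have "- (e x \<bullet> grad p x) \<le> norm (grad p x)"
        using Cauchy_Schwarz_ineq2[of "e x" "grad p x"] e_norm[OF x] by simp
      also have "\<dots> \<le> (p x - 1) * \<kappa> s" using p(3)[OF x] by (simp add: s_def)
      finally have "- g s * (- (e x \<bullet> grad p x)) \<le> - g s * ((p x - 1) * \<kappa> s)"
        using g(2)[OF s] by (intro mult_left_mono) auto
      moreover have "inverse (r x) * (n - 1) \<le> n / G"
      proof -
        have "inverse (r x) \<le> inverse G" using r_pos[OF x] G by (intro le_imp_inverse_le) auto
        moreover have "n \<ge> 1" by (simp add: n_def Suc_le_eq)
        ultimately have "inverse (r x) * (n - 1) \<le> inverse G * n" using G r0[OF x] by (intro mult_mono) auto
        then show ?thesis by (simp add: divide_inverse mult.commute)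
      qed
      moreover have "n / G \<le> (p x - 1) * \<kappa> s * \<epsilon>" using p(4)[OF x] by (simp add: s_def n_def)
      ultimately show "inverse (r x) * (n - 1) + (p x - 1) * (- \<kappa> s * (\<epsilon> - g s)) + g s * (e x \<bullet> grad p x) \<le> 0"
        by (simp add: algebra_simps)
    qed
    finally show ?thesis .
  qed
  fix \<psi> :: "real ^ 'n \<Rightarrow> real" assume \<psi>: "\<psi> \<in> test_functions D" "\<And>x. \<psi> x \<ge> 0"
  note t = test_functionsD[OF \<psi>(1)]
  have gz: "grad \<psi> x $ i = 0" if "x \<in> D - closure {x. \<psi> x \<noteq> 0}" for x i using t(5) that by simp
  have z: "\<psi> x = 0" if "x \<in> D - closure {x. \<psi> x \<noteq> 0}" for x using t(4)[of x] that by blast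
  have Vc: "continuous_on D (V i)" for i by (rule cont_of_diff[OF V_d(1)])
  have px: "(norm (grad w x) powr (p x - 2)) *\<^sub>R grad w x \<bullet> grad \<psi> x = (\<Sum>i\<in>UNIV. V i x * grad \<psi> x $ i)" if x: "x \<in> D" for x
  proof -
    have "norm (grad w x) = exp (g (\<rho> x))" using e_norm[OF x] by (simp add: grad_w[OF x])
    then have "(norm (grad w x) powr (p x - 2)) * exp (g (\<rho> x)) = exp ((p x - 2) * g (\<rho> x)) * exp (g (\<rho> x))"
      by (simp add: powr_def)
    also have "\<dots> = E x" by (simp add: E_def flip: exp_add) (simp add: algebra_simps)
    finally have "(norm (grad w x) powr (p x - 2)) *\<^sub>R grad w x = E x *\<^sub>R e x" by (simp add: grad_w[OF x])
    then show ?thesis by (simp add: inner_vec_def V_def)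
  qed
  have int1: "set_integrable lebesgue D (\<lambda>x. V i x * grad \<psi> x $ i)" for i
    by (rule set_integrable_compact_support[OF t(6,7)])
       (auto simp: gz intro!: continuous_intros continuous_on_subset[OF Vc t(7)] continuous_on_subset[OF t(3)] continuous_on_component)
  have int2: "set_integrable lebesgue D (\<lambda>x. dV i x * \<psi> x)" for i
  proof (rule set_integrable_compact_support[OF t(6,7)])
    show "continuous_on (closure {x. \<psi> x \<noteq> 0}) (\<lambda>x. dV i x * \<psi> x)"
      by (intro continuous_intros continuous_on_subset[OF dVc t(7)] continuous_on_subset[OF t(2)]) auto
    show "dV i x * \<psi> x = 0" if "x \<in> D - closure {x. \<psi> x \<noteq> 0}" for x using z[OF that] by simp
  qed
  have parts: "set_lebesgue_integral lebesgue D (\<lambda>x. V i x * grad \<psi> x $ i) = - set_lebesgue_integral lebesgue D (\<lambda>x. dV i x * \<psi> x)" for i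
  proof -
    have "set_lebesgue_integral lebesgue D (\<lambda>x. V i x * grad \<psi> x $ i) = - set_lebesgue_integral lebesgue D (\<lambda>x. grad (V i) x $ i * \<psi> x)"
      by (rule set_integral_by_parts[OF D V_d(1) _ \<psi>(1)])
         (auto intro: continuous_on_eq[OF dVc] simp: V_d(2))
    also have "set_lebesgue_integral lebesgue D (\<lambda>x. grad (V i) x $ i * \<psi> x) = set_lebesgue_integral lebesgue D (\<lambda>x. dV i x * \<psi> x)"
      unfolding set_lebesgue_integral_def
      by (rule Bochner_Integration.integral_cong[OF refl]) (auto simp: indicator_def V_d(2))
    finally show ?thesis .
  qed
  have "px_energy p D (grad w) \<psi> = set_lebesgue_integral lebesgue D (\<lambda>x. \<Sum>i\<in>UNIV. V i x * grad \<psi> x $ i)"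
    unfolding px_energy_def set_lebesgue_integral_def
    by (rule Bochner_Integration.integral_cong[OF refl]) (use px in \<open>auto simp: indicator_def\<close>)
  also have "\<dots> = (\<Sum>i\<in>UNIV. set_lebesgue_integral lebesgue D (\<lambda>x. V i x * grad \<psi> x $ i))"
    using int1 unfolding set_lebesgue_integral_def set_integrable_def scaleR_sum_right
    by (rule Bochner_Integration.integral_sum)
  also have "\<dots> = - (\<Sum>i\<in>UNIV. set_lebesgue_integral lebesgue D (\<lambda>x. dV i x * \<psi> x))"
    by (simp add: parts sum_negf)
  also have "(\<Sum>i\<in>UNIV. set_lebesgue_integral lebesgue D (\<lambda>x. dV i x * \<psi> x)) = set_lebesgue_integral lebesgue D (\<lambda>x. \<Sum>i\<in>UNIV. dV i x * \<psi> x)"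
    using int2 unfolding set_lebesgue_integral_def set_integrable_def scaleR_sum_right
    by (rule Bochner_Integration.integral_sum[symmetric])
  finally have eq: "px_energy p D (grad w) \<psi> = - set_lebesgue_integral lebesgue D (\<lambda>x. \<Sum>i\<in>UNIV. dV i x * \<psi> x)" .
  have "0 \<le> (\<integral>x. - (indicator D x *\<^sub>R (\<Sum>i\<in>UNIV. dV i x * \<psi> x)) \<partial>lebesgue)"
  proof (intro Bochner_Integration.integral_nonneg)
    fix x
    have "(\<Sum>i\<in>UNIV. dV i x) * \<psi> x \<le> 0" if "x \<in> D"
      using div_le[OF that] \<psi>(2) by (simp add: mult_nonpos_nonneg)
    then show "0 \<le> - (indicator D x *\<^sub>R (\<Sum>i\<in>UNIV. dV i x * \<psi> x))"
      by (auto simp: indicator_def sum_distrib_right)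
  qed
  then show "px_energy p D (grad w) \<psi> \<ge> 0" by (simp add: eq set_lebesgue_integral_def)
qed

section \<open>Growth of subharmonic functions\<close>

definition D_center :: "'n::finite \<Rightarrow> (real \<Rightarrow> real) \<Rightarrow> real \<Rightarrow> real ^ 'n" where
  "D_center k \<gamma> R = - (\<gamma> R *\<^sub>R axis k 1)"

lemma norm_minus_D_center:
  "(norm (x - D_center k \<gamma> R))\<^sup>2 = (\<Sum>i\<in>UNIV - {k}. (x $ i)\<^sup>2) + (x $ k + \<gamma> R)\<^sup>2"
proof -
  have "(norm (x - D_center k \<gamma> R))\<^sup>2 = (\<Sum>i\<in>UNIV. ((x - D_center k \<gamma> R) $ i)\<^sup>2)"
    by (simp add: norm_vec_def L2_set_def sum_nonneg)
  also have "\<dots> = ((x - D_center k \<gamma> R) $ k)\<^sup>2 + (\<Sum>i\<in>UNIV - {k}. ((x - D_center k \<gamma> R) $ i)\<^sup>2)"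
    by (rule sum.remove) auto
  also have "(\<Sum>i\<in>UNIV - {k}. ((x - D_center k \<gamma> R) $ i)\<^sup>2) = (\<Sum>i\<in>UNIV - {k}. (x $ i)\<^sup>2)"
    by (rule sum.cong) (auto simp: D_center_def axis_def)
  finally show ?thesis by (simp add: D_center_def axis_def)
qed

lemma D_set_eq:
  assumes "R > 0" "\<gamma> R > 0"
  shows "D_set k \<gamma> R = half_space k \<inter> ball (D_center k \<gamma> R) (R + \<gamma> R)"
proof -
  have "(norm (x - D_center k \<gamma> R))\<^sup>2 < (R + \<gamma> R)\<^sup>2 \<longleftrightarrow> norm (x - D_center k \<gamma> R) < R + \<gamma> R" for x
    using assms power2_less_imp_less[of "norm (x - D_center k \<gamma> R)" "R + \<gamma> R"]
      power_strict_mono[of "norm (x - D_center k \<gamma> R)" "R + \<gamma> R" 2] by auto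
  moreover have "x \<in> ball c M \<longleftrightarrow> norm (x - c) < M" for x c :: "real ^ 'a" and M
    by (metis dist_commute dist_norm mem_ball)
  ultimately show ?thesis unfolding D_set_def norm_minus_D_center[symmetric] by blast
qed

lemma open_half_space: "open (half_space k)"
  unfolding half_space_def by (intro open_Collect_less continuous_intros continuous_on_component)

lemma closure_half_space_nonneg: "y \<in> closure (half_space k) \<Longrightarrow> y $ k \<ge> 0"
proof -
  have "closed {x :: real ^ 'a. 0 \<le> x $ k}" by (intro closed_Collect_le continuous_intros continuous_on_component)
  then have "closure (half_space k) \<subseteq> {x. 0 \<le> x $ k}" by (intro closure_minimal) (auto simp: half_space_def)
  then show "y \<in> closure (half_space k) \<Longrightarrow> y $ k \<ge> 0" by auto
qed

lemma frontier_half_spaceI: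
  assumes "y $ k = 0"
  shows "y \<in> frontier (half_space k)"
proof -
  have "\<exists>x\<in>half_space k. dist x y < e" if "e > 0" for e
    using assms that
    by (intro bexI[of _ "y + (e / 2) *\<^sub>R axis k 1"]) (auto simp: half_space_def dist_norm norm_axis_1)
  then have "y \<in> closure (half_space k)" by (simp add: closure_approachable)
  moreover have "y \<notin> interior (half_space k)" using assms interior_subset[of "half_space k"] by (auto simp: half_space_def)
  ultimately show ?thesis by (simp add: frontier_def)
qed

lemma D_center_nth [simp]: "D_center k \<gamma> R $ k = - \<gamma> R"
  by (simp add: D_center_def)

text \<open>The reason why a radial barrier is possible: subtracting \<open>\<gamma> R\<close> gives
  x_k \<le> \<rho>(x), and since \<open>lam\<close> is nonincreasing, the bound on Dp in terms of
  \<open>lam\<close> at x_k implies the one at the radial variable.\<close>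

lemma nth_le_dist_D_center: "x $ k + \<gamma> R \<le> norm (x - D_center k \<gamma> R)"
  using component_le_norm_cart[of "x - D_center k \<gamma> R" k] by simp

lemma closure_D_set:
  assumes "R > 0" "\<gamma> R > 0" "y \<in> closure (D_set k \<gamma> R)" "y \<notin> D_set k \<gamma> R"
  shows "y $ k \<ge> 0" "norm (y - D_center k \<gamma> R) \<le> R + \<gamma> R" "y $ k = 0 \<or> norm (y - D_center k \<gamma> R) = R + \<gamma> R"
proof -
  have "y \<in> closure (half_space k)" using assms(3) closure_mono[of "D_set k \<gamma> R" "half_space k"] by (auto simp: D_set_eq[where R=R and \<gamma>=\<gamma>, OF assms(1,2)])
  then show 1: "y $ k \<ge> 0" by (rule closure_half_space_nonneg)
  have "y \<in> closure (ball (D_center k \<gamma> R) (R + \<gamma> R))"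
    using assms(3) closure_mono[of "D_set k \<gamma> R" "ball (D_center k \<gamma> R) (R + \<gamma> R)"] by (auto simp: D_set_eq[where R=R and \<gamma>=\<gamma>, OF assms(1,2)])
  then have "y \<in> cball (D_center k \<gamma> R) (R + \<gamma> R)" using closure_minimal[OF ball_subset_cball closed_cball] by blast
  then show 2: "norm (y - D_center k \<gamma> R) \<le> R + \<gamma> R" by (simp add: dist_norm norm_minus_commute)
  show "y $ k = 0 \<or> norm (y - D_center k \<gamma> R) = R + \<gamma> R"
    using assms(4) 1 2 by (auto simp: D_set_eq[where R=R and \<gamma>=\<gamma>, OF assms(1,2)] half_space_def dist_norm norm_minus_commute)
qed

lemma frontier_D_set_iff:
  assumes "R > 0" "\<gamma> R > 0"
  shows "y \<in> frontier (D_set k \<gamma> R) \<longleftrightarrow> y \<in> closure (D_set k \<gamma> R) \<and> y \<notin> D_set k \<gamma> R"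
proof -
  have "open (D_set k \<gamma> R)" by (auto simp: D_set_eq[where R=R and \<gamma>=\<gamma>, OF assms] intro: open_half_space)
  then show ?thesis by (simp add: frontier_def interior_open)
qed

lemma sphere_in_frontier_D_set:
  assumes "R > 0" "\<gamma> R > 0" "y \<in> half_space k" "norm (y - D_center k \<gamma> R) = R + \<gamma> R"
  shows "y \<in> frontier (D_set k \<gamma> R)"
proof -
  have "y \<in> closure (ball (D_center k \<gamma> R) (R + \<gamma> R))"
    using assms by (simp add: dist_norm norm_minus_commute)
  then have "y \<in> closure (D_set k \<gamma> R)"
    using open_Int_closure_subset[OF open_half_space, of k "ball (D_center k \<gamma> R) (R + \<gamma> R)"] assms(3)
    by (auto simp: D_set_eq[where R=R and \<gamma>=\<gamma>, OF assms(1,2)])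
  moreover have "y \<notin> D_set k \<gamma> R" using assms(4) by (simp add: D_set_eq[where R=R and \<gamma>=\<gamma>, OF assms(1,2)] dist_norm norm_minus_commute)
  ultimately show ?thesis using frontier_D_set_iff[where R=R and \<gamma>=\<gamma>, OF assms(1,2)] by blast
qed

text \<open>Interior points are covered by upper semicontinuity, boundary points by the definition
  of the extension. \<open>Limsup\<close> at y ignores the value at y, which is therefore checked
  separately.\<close>

lemma bdry_ext_less_imp_nbhd:
  assumes usc: "usc_on (half_space k) u" and less: "bdry_ext k u y < ereal ub"
  obtains r where "r > 0" "\<And>x. x \<in> half_space k \<Longrightarrow> dist x y < r \<Longrightarrow> u x < ub"
proof -
  have "Limsup (at y within half_space k) (\<lambda>x. ereal (u x)) < ereal ub"
    using usc less unfolding usc_on_def bdry_ext_def by (auto split: if_splits intro: le_less_trans)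
  then have "\<forall>\<^sub>F x in at y within half_space k. ereal (u x) < ereal ub" by (rule Limsup_lessD)
  then obtain r where r: "r > 0" "\<And>x. x \<in> half_space k \<Longrightarrow> x \<noteq> y \<Longrightarrow> dist x y < r \<Longrightarrow> u x < ub"
    unfolding eventually_at by auto
  have "u y < ub" if "y \<in> half_space k" using less that by (simp add: bdry_ext_def)
  then show ?thesis using that[of r] r by blast
qed

text \<open>An infinite norm would make the lower quotient 0, contradicting positivity of
  \<open>lam\<close>. So the norm is a positive real, and the later estimates can be carried out in
  the reals.\<close>

lemma Dp_norm_real:
  assumes x: "x \<in> half_space k" and lam: "lam (x $ k) > 0"
    and ne: "Dp_norm k p x \<noteq> 0"
    and lower: "ereal (lam (x $ k)) \<le> ereal (min 1 (p x - 1)) / Dp_norm k p x"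
    and upper: "ereal (max 1 (p x - 1)) / Dp_norm k p x \<le> ereal (Lam (x $ k))"
  obtains N where "N > 0" "norm (grad p x) \<le> N" "lam (x $ k) * N \<le> min 1 (p x - 1)" "1 \<le> Lam (x $ k) * N"
proof -
  have ge: "ereal (norm (grad p x)) \<le> Dp_norm k p x"
    unfolding Dp_norm_def using x by (intro SUP_upper) auto
  show ?thesis
  proof (cases "Dp_norm k p x")
    case (real N)
    have N: "norm (grad p x) \<le> N" using ge real by simp
    have "N \<noteq> 0" using ne real by simp
    then have N0: "N > 0" using N norm_ge_zero[of "grad p x"] by linarith
    have div: "ereal s / ereal N = ereal (s / N)" for s using N0 by simp
    have "lam (x $ k) \<le> min 1 (p x - 1) / N" using lower unfolding real div ereal_less_eq(3) .
    then have 1: "lam (x $ k) * N \<le> min 1 (p x - 1)" using N0 by (simp only: le_divide_eq if_True)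
    have "max 1 (p x - 1) / N \<le> Lam (x $ k)" using upper unfolding real div ereal_less_eq(3) .
    then have "max 1 (p x - 1) \<le> Lam (x $ k) * N" using N0 by (simp only: divide_le_eq if_True)
    then have "1 \<le> Lam (x $ k) * N" by simp
    then show ?thesis using that N N0 1 by blast
  next
    case PInf
    then show ?thesis using lower lam by simp
  next
    case MInf
    then show ?thesis using ge by simp
  qed
qed

text \<open>Local upper bounds around each point and compactness of the frontier. Finiteness is
  needed because M(R) will serve as a real shift of the barrier.\<close>

lemma M_sup_finite:
  assumes usc: "usc_on (half_space k) u" and R: "R > 0" "\<gamma> R > 0"
    and flat: "\<And>y. y $ k = 0 \<Longrightarrow> bdry_ext k u y \<le> 0"
  obtains B where "M_sup k \<gamma> u R \<le> ereal B"
proof -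
  let ?F = "frontier (D_set k \<gamma> R)"
  have "bounded (D_set k \<gamma> R)" by (auto simp: D_set_eq[where R=R and \<gamma>=\<gamma>, OF R] intro: bounded_subset[OF bounded_ball])
  then have F: "compact ?F" by (rule compact_frontier_bounded)
  have "\<exists>r B. r > 0 \<and> (\<forall>x\<in>half_space k. dist x y < r \<longrightarrow> u x < B)" for y
  proof (cases "bdry_ext k u y = \<infinity>")
    case True
    \<comment> \<open>A vacuous case: y lies strictly below the half space, and no point of the half
      space is closer to y than -y_k.\<close>
    then have "y \<notin> half_space k" "y $ k \<noteq> 0" using flat[of y] by (simp add: bdry_ext_def split: if_splits, auto)
    then have "y $ k < 0" by (auto simp: half_space_def)
    have "u x < 0" if "x \<in> half_space k" "dist x y < - (y $ k)" for x
      using that component_le_norm_cart[of "x - y" k] by (auto simp: half_space_def dist_norm)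
    then show ?thesis using \<open>y $ k < 0\<close> by (intro exI[of _ "- (y $ k)"] exI[of _ 0]) auto
  next
    case False
    obtain ub where "bdry_ext k u y < ereal ub"
    proof (cases "bdry_ext k u y")
      case (real s)
      then show ?thesis using that[of "s + 1"] by simp
    qed (use False that[of 0] in simp_all)
    then show ?thesis using bdry_ext_less_imp_nbhd[OF usc] by metis
  qed
  then obtain r B where rB: "\<And>y. r y > 0" "\<And>y x. x \<in> half_space k \<Longrightarrow> dist x y < r y \<Longrightarrow> u x < B y"
    by metis
  obtain Y where Y: "Y \<subseteq> ?F" "finite Y" "?F \<subseteq> (\<Union>y\<in>Y. ball y (r y))"
    by (rule compactE_image[OF F, of ?F "\<lambda>y. ball y (r y)"]) (use rB(1) in auto)
  \<comment> \<open>A sum of absolute values instead of a maximum: it dominates every local bound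
    and is nonnegative, which settles the flat part of the frontier.\<close>
  define M where "M = (\<Sum>y\<in>Y. \<bar>B y\<bar>)"
  have M: "M \<ge> 0" by (simp add: M_def sum_nonneg)
  have "bdry_ext k u x \<le> ereal M" if x: "x \<in> ?F" for x
  proof (cases "x \<in> half_space k")
    case True
    obtain y where y: "y \<in> Y" "dist x y < r y" using Y(3) x by (auto simp: dist_commute)
    have "u x < B y" using rB(2)[OF True y(2)] .
    also have "\<dots> \<le> \<bar>B y\<bar>" by simp
    also have "\<dots> \<le> M" unfolding M_def using y Y by (intro member_le_sum) auto
    finally show ?thesis using True by (simp add: bdry_ext_def)
  next
    case False
    have "x \<in> closure (D_set k \<gamma> R)" "x \<notin> D_set k \<gamma> R" using x frontier_D_set_iff[where R=R and \<gamma>=\<gamma>, OF R] by auto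
    then have "x $ k \<ge> 0" by (rule closure_D_set(1)[where R=R and \<gamma>=\<gamma>, OF R])
    then have "x $ k = 0" using False by (simp add: half_space_def)
    then have "bdry_ext k u x \<le> 0" by (rule flat)
    then show ?thesis using M by (meson ereal_less_eq(5) order_trans)
  qed
  then show ?thesis using that unfolding M_sup_def by (metis SUP_least)
qed

text \<open>The shift \<open>b\<close> is kept general because two values are used later: 0 to
  exclude M(R) \<le> \<phi>(R), and M(R) - \<phi>(R) to estimate u inside D(R). Only the spherical
  part of the frontier needs a hypothesis on u depending on the barrier; on the flat part a
  nonnegative barrier suffices.\<close>

theorem barrier_comparison:
  fixes p u :: "real ^ 'n::finite \<Rightarrow> real" and \<gamma> Lam lam :: "real \<Rightarrow> real" and \<phi> g \<kappa> :: "real \<Rightarrow> real"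
    and k :: 'n
  defines "\<rho> \<equiv> \<lambda>R x. norm (x - D_center k \<gamma> R) - \<gamma> R"
  assumes lam: "antimono_on {0..} lam" "\<And>s. s \<ge> 0 \<Longrightarrow> lam s > 0"
    and p: "C1_on (half_space k) p" "\<And>x. x \<in> half_space k \<Longrightarrow> p x > 1"
    and Dp: "\<And>x. x \<in> half_space k \<Longrightarrow> \<exists>N>0. norm (grad p x) \<le> N \<and> lam (x $ k) * N \<le> min 1 (p x - 1) \<and> 1 \<le> Lam (x $ k) * N"
    and Lam: "mono_on {0..} Lam" and u: "px_subharmonic p (half_space k) u"
    and flat: "\<And>y. y $ k = 0 \<Longrightarrow> bdry_ext k u y \<le> 0"
    and R: "R > 0" "\<gamma> R > 0"
    and \<phi>: "\<phi> 0 = 0" "continuous_on {0..R} \<phi>" "\<And>s. 0 < s \<Longrightarrow> s < R \<Longrightarrow> (\<phi> has_real_derivative exp (g s)) (at s)"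
      "\<And>s t. 0 \<le> s \<Longrightarrow> s \<le> t \<Longrightarrow> t \<le> R \<Longrightarrow> \<phi> s \<le> \<phi> t"
    and g: "\<And>s. 0 < s \<Longrightarrow> s < R \<Longrightarrow> (g has_real_derivative - \<kappa> s * (real CARD('n) * Lam R / \<gamma> R - g s)) (at s)"
      "\<And>s. 0 < s \<Longrightarrow> s < R \<Longrightarrow> g s \<le> 0"
    and \<kappa>: "continuous_on {0<..<R} \<kappa>" "\<And>s. 0 < s \<Longrightarrow> s < R \<Longrightarrow> 1 / lam s \<le> \<kappa> s"
    and b: "b \<ge> 0" and sphere: "\<And>y. y \<in> frontier (D_set k \<gamma> R) \<Longrightarrow> y \<in> half_space k \<Longrightarrow> u y \<le> \<phi> R + b"
    and x: "x \<in> D_set k \<gamma> R"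
  shows "u x \<le> \<phi> (\<rho> R x) + b"
proof -
  define D where "D = D_set k \<gamma> R"
  define c where "c = D_center k \<gamma> R"
  have D_eq: "D = half_space k \<inter> ball c (R + \<gamma> R)" unfolding D_def c_def by (rule D_set_eq[where R=R and \<gamma>=\<gamma>, OF R])
  have D: "open D" "bounded D" "D \<subseteq> half_space k" "convex D"
  proof -
    show "open D" "D \<subseteq> half_space k" by (auto simp: D_eq intro: open_half_space)
    show "bounded D" by (auto simp: D_eq intro: bounded_subset[OF bounded_ball])
    have "half_space k = {x :: real ^ 'n. axis k 1 \<bullet> x > 0}" by (simp add: half_space_def inner_axis')
    then have "convex (half_space k)" by (simp add: convex_halfspace_gt)
    then show "convex D" by (simp add: D_eq convex_Int)
  qed
  have \<rho>R: "\<rho> R = (\<lambda>x. norm (x - c) - \<gamma> R)" by (simp add: \<rho>_def c_def)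
  have \<rho>: "0 < y $ k" "y $ k \<le> \<rho> R y" "\<rho> R y < R" if "y \<in> D" for y
    using that nth_le_dist_D_center[of y k \<gamma> R]
    by (auto simp: D_eq half_space_def \<rho>R c_def dist_norm norm_minus_commute)
  have lam_le: "lam t \<le> lam s" if "0 \<le> s" "s \<le> t" for s t using that monotone_onD[OF lam(1)] by auto
  have p1: "p y > 1" if "y \<in> D" for y using p(2) D(3) that by blast
  \<comment> \<open>With N the norm of Dp on the slice, the bound \<open>lam\<close> N \<le> p - 1
    gives the first estimate, adding 1 \<le> \<open>Lam R\<close> N gives the second, and
    \<open>lam\<close> N \<le> 1 gives the third, whose bound is uniform over D.\<close>
  have est: "norm (grad p y) \<le> (p y - 1) * \<kappa> (\<rho> R y)"
    "real CARD('n) / \<gamma> R \<le> (p y - 1) * \<kappa> (\<rho> R y) * (real CARD('n) * Lam R / \<gamma> R)"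
    "norm (grad p y) \<le> 1 / lam R" if y: "y \<in> D" for y
  proof -
    obtain N where N: "N > 0" "norm (grad p y) \<le> N" "lam (y $ k) * N \<le> min 1 (p y - 1)" "1 \<le> Lam (y $ k) * N"
      using Dp y D(3) by blast
    note \<rho>y = \<rho>[OF y]
    have l: "lam (\<rho> R y) > 0" "lam R > 0" using \<rho>y R lam(2) by auto
    have "lam (\<rho> R y) * N \<le> lam (y $ k) * N" using \<rho>y N(1) by (intro mult_right_mono lam_le) auto
    then have "lam (\<rho> R y) * N \<le> p y - 1" using N(3) by simp
    then have "N \<le> (p y - 1) * (1 / lam (\<rho> R y))" using l by (simp add: le_divide_eq mult.commute)
    also have "\<dots> \<le> (p y - 1) * \<kappa> (\<rho> R y)" using \<rho>y p1[OF y] by (intro mult_left_mono \<kappa>(2)) auto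
    finally have N\<kappa>: "N \<le> (p y - 1) * \<kappa> (\<rho> R y)" .
    then show "norm (grad p y) \<le> (p y - 1) * \<kappa> (\<rho> R y)" using N(2) by linarith
    have "Lam (y $ k) * N \<le> Lam R * N"
      using \<rho>y R N(1) mono_onD[OF Lam] by (intro mult_right_mono) auto
    then have LN: "1 \<le> Lam R * N" using N(4) by linarith
    then have "0 < Lam R" using N(1) by (smt (verit) mult_nonpos_nonneg)
    then have "Lam R * N \<le> Lam R * ((p y - 1) * \<kappa> (\<rho> R y))" using N\<kappa> by (intro mult_left_mono) auto
    then have 1: "1 \<le> (p y - 1) * \<kappa> (\<rho> R y) * Lam R" using LN by (simp only: mult.commute[of "Lam R"] order_trans)
    have "real CARD('n) / \<gamma> R * 1 \<le> real CARD('n) / \<gamma> R * ((p y - 1) * \<kappa> (\<rho> R y) * Lam R)"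
      using 1 R by (intro mult_left_mono) auto
    then show "real CARD('n) / \<gamma> R \<le> (p y - 1) * \<kappa> (\<rho> R y) * (real CARD('n) * Lam R / \<gamma> R)"
      by (simp add: mult_ac)
    have "lam R * N \<le> lam (y $ k) * N" using \<rho>y N(1) by (intro mult_right_mono lam_le) auto
    then have "N \<le> 1 / lam R" using N(3) l by (simp add: le_divide_eq mult.commute)
    then show "norm (grad p y) \<le> 1 / lam R" using N(2) by linarith
  qed
  have p_diff: "p differentiable (at y)" if "y \<in> D" for y using p(1) that D(3) by (auto simp: C1_on_def)
  have C1: "C1_on D p" using p(1) D(3) by (auto simp: C1_on_def intro: continuous_on_subset)
  \<comment> \<open>On the convex set D the uniform gradient bound becomes a Lipschitz bound, the
    form in which the mollification estimates need it.\<close>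
  have lip: "(1 / lam R)-lipschitz_on D p"
  proof (rule lipschitz_onI)
    show "0 \<le> 1 / lam R" using lam(2)[of R] R by simp
    fix y z assume yz: "y \<in> D" "z \<in> D"
    have "norm (p y - p z) \<le> 1 / lam R * norm (y - z)"
    proof (rule differentiable_bound[OF D(4) _ _ yz, where f'="\<lambda>y v. grad p y \<bullet> v"])
      fix y assume y: "y \<in> D"
      show "(p has_derivative (\<lambda>v. grad p y \<bullet> v)) (at y within D)"
        using has_derivative_grad[OF p_diff[OF y]] by (rule has_derivative_at_withinI)
      show "onorm (\<lambda>v. grad p y \<bullet> v) \<le> 1 / lam R"
      proof (rule onorm_bound)
        show "0 \<le> 1 / lam R" using lam(2)[of R] R by simp
        show "norm (grad p y \<bullet> v) \<le> 1 / lam R * norm v" for v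
          using Cauchy_Schwarz_ineq2[of "grad p y" v] mult_right_mono[OF est(3)[OF y] norm_ge_zero[of v]] by simp
      qed
    qed
    then show "dist (p y) (p z) \<le> 1 / lam R * dist y z" by (simp add: dist_norm)
  qed
  define w where "w = (\<lambda>x. \<phi> (norm (x - c) - \<gamma> R) + b)"
  have \<rho>': "0 < norm (y - c) - \<gamma> R \<and> norm (y - c) - \<gamma> R < R" if "y \<in> D" for y
    using \<rho>[OF that] by (simp add: \<rho>R)
  note super = radial_supersolution[where c=c and G="\<gamma> R" and R=R and D=D and p=p and b=b and g=g and \<kappa>=\<kappa> and \<phi>=\<phi>,
      OF D(1) R(2) \<rho>' \<phi>(3) g \<kappa>(1) C1 p1 est(1)[unfolded \<rho>R] est(2)[unfolded \<rho>R], folded w_def]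
  have usc: "usc_on (half_space k) u" using u by (simp add: px_subharmonic_def)
  have bdry: "\<exists>K. compact K \<and> K \<subseteq> D \<and> (\<forall>x\<in>D - K. u x \<le> w x + \<eta>)" if \<eta>: "\<eta> > 0" for \<eta>
  proof -
    \<comment> \<open>The compact set is the closure of the set where the inequality fails. A limit
      point outside D would lie on the flat part, where u has upper limit at most 0 \<le> w, or on
      the sphere, where \<phi>(\<rho>) tends to \<phi>(R).\<close>
    define S where "S = {y \<in> D. u y > w y + \<eta>}"
    have "closure S \<subseteq> D"
    proof (rule ccontr)
      assume "\<not> closure S \<subseteq> D"
      then obtain y where y: "y \<in> closure S" "y \<notin> D" by blast
      have yD: "y \<in> closure D" using y(1) closure_mono[of S D] by (auto simp: S_def)
      note cl = closure_D_set[where R=R and \<gamma>=\<gamma>, OF R yD[unfolded D_def] y(2)[unfolded D_def]]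
      show False
      proof (cases "y $ k = 0")
        case True
        then have "bdry_ext k u y \<le> 0" by (rule flat)
        also have "\<dots> < ereal \<eta>" using \<eta> by simp
        finally obtain r where r: "r > 0" "\<And>x. x \<in> half_space k \<Longrightarrow> dist x y < r \<Longrightarrow> u x < \<eta>"
          using bdry_ext_less_imp_nbhd[OF usc] by metis
        obtain z where z: "z \<in> S" "dist z y < r" using y(1) r(1) by (auto simp: closure_approachable)
        have zD: "z \<in> D" using z by (simp add: S_def)
        have "0 \<le> w z" unfolding w_def using \<rho>'[OF zD] \<phi>(4)[of 0 "norm (z - c) - \<gamma> R"] \<phi>(1) b by simp
        then show False using r(2)[of z] z zD D(3) by (auto simp: S_def)
      next
        case False
        then have ny: "norm (y - c) = R + \<gamma> R" and yH: "y \<in> half_space k" using cl by (auto simp: c_def half_space_def)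
        have "y \<in> frontier (D_set k \<gamma> R)" by (rule sphere_in_frontier_D_set[where R=R and \<gamma>=\<gamma>, OF R yH ny[unfolded c_def]])
        then have "u y \<le> \<phi> R + b" using sphere yH by blast
        then have "bdry_ext k u y < ereal (\<phi> R + b + \<eta> / 2)" using yH \<eta> by (simp add: bdry_ext_def)
        then obtain r where r: "r > 0" "\<And>x. x \<in> half_space k \<Longrightarrow> dist x y < r \<Longrightarrow> u x < \<phi> R + b + \<eta> / 2"
          using bdry_ext_less_imp_nbhd[OF usc] by metis
        obtain d where d: "d > 0" "\<And>s. s \<in> {0..R} \<Longrightarrow> dist s R < d \<Longrightarrow> dist (\<phi> s) (\<phi> R) < \<eta> / 2"
          using \<phi>(2) R(1) half_gt_zero[OF \<eta>] unfolding continuous_on_iff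
          by (metis atLeastAtMost_iff less_eq_real_def)
        obtain z where z: "z \<in> S" "dist z y < min r d" using y(1) r(1) d(1) closure_approachable[of y S] by (metis min_less_iff_conj)
        have zD: "z \<in> D" using z by (simp add: S_def)
        define s where "s = norm (z - c) - \<gamma> R"
        have "\<bar>norm (z - c) - norm (y - c)\<bar> \<le> norm ((z - c) - (y - c))" by (rule norm_triangle_ineq3)
        then have "\<bar>s - R\<bar> \<le> dist z y" using ny by (simp add: s_def dist_norm algebra_simps)
        then have "dist s R < d" using z(2) by (simp add: dist_real_def)
        then have "dist (\<phi> s) (\<phi> R) < \<eta> / 2" using \<rho>'[OF zD] by (intro d(2)) (auto simp: s_def)
        then have "\<phi> R - \<phi> s < \<eta> / 2" unfolding dist_real_def by linarith
        moreover have "w z = \<phi> s + b" by (simp add: w_def s_def)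
        moreover have "u z < \<phi> R + b + \<eta> / 2" using r(2)[of z] z zD D(3) by auto
        ultimately have "u z < w z + \<eta>" by linarith
        then show False using z by (simp add: S_def)
      qed
    qed
    moreover have "bounded S" using D(2) by (rule bounded_subset) (auto simp: S_def)
    then have "compact (closure S)" by (simp add: compact_closure)
    moreover have "u x \<le> w x + \<eta>" if "x \<in> D - closure S" for x
      using that closure_subset[of S] by (force simp: S_def)
    ultimately show ?thesis by blast
  qed
  have "u x \<le> w x"
    by (rule comparison_principle[OF D(1-3) u super(1,2) p1 lip super(3) bdry]) (use x in \<open>auto simp: D_def\<close>)
  then show ?thesis by (simp add: w_def \<rho>R)
qed

text \<open>The lower bound does not depend on R: the growth condition on \<gamma> gives \<epsilon>
  exp (J R) \<le> n C, and n C is the constant q of \<open>barrier_profile\<close>.\<close>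

theorem growth_lower_bound:
  fixes p u :: "real ^ 'n::finite \<Rightarrow> real" and \<gamma> Lam lam :: "real \<Rightarrow> real" and k :: 'n and \<nu> :: real
  defines "J \<equiv> \<lambda>t. integral {0..t} (\<lambda>s. 1 / lam s)"
  assumes lam: "antimono_on {0..} lam" "\<And>s. s \<ge> 0 \<Longrightarrow> lam s > 0" and \<nu>: "0 < \<nu>" "\<nu> \<le> 1"
    and p: "C1_on (half_space k) p" "\<And>x. x \<in> half_space k \<Longrightarrow> p x > 1"
    and Dp: "\<And>x. x \<in> half_space k \<Longrightarrow> \<exists>N>0. norm (grad p x) \<le> N \<and> lam (x $ k) * N \<le> min 1 (p x - 1) \<and> 1 \<le> Lam (x $ k) * N"
    and Lam: "mono_on {0..} Lam" "\<And>t. t \<ge> 0 \<Longrightarrow> Lam t > 0"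
    and \<gamma>: "\<And>R. R > 0 \<Longrightarrow> \<gamma> R > 0" "mono_on {0<..} \<gamma>"
    and C: "\<And>R. R > 0 \<Longrightarrow> Lam R * exp (J R) \<le> C * \<gamma> R"
    and u: "px_subharmonic p (half_space k) u"
    and flat: "\<And>y. y $ k = 0 \<Longrightarrow> bdry_ext k u y \<le> 0"
    and t: "t > 0" "u (axis k t) > integral {0..t} (\<lambda>s. \<nu> powr exp (J s))"
    and R: "R > t"
  shows "ereal (exp (ln \<nu> - 2 * (real CARD('n) * C))) \<le> M_deriv k \<gamma> u R / ereal (\<nu> powr exp (J R))"
proof -
  define n where "n = real CARD('n)"
  define \<epsilon> where "\<epsilon> = n * Lam R / \<gamma> R"
  have R0: "R > 0" "\<gamma> R > 0" using R t \<gamma>(1) by auto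
  have n: "n \<ge> 1" by (simp add: n_def Suc_le_eq)
  have mono: "mono_on {0..} (\<lambda>s. 1 / lam s)"
  proof (rule mono_onI)
    fix r s :: real assume rs: "r \<in> {0..}" "s \<in> {0..}" "r \<le> s"
    then have "lam s \<le> lam r" using monotone_onD[OF lam(1)] by auto
    then show "1 / lam r \<le> 1 / lam s" using rs lam(2)[of s] by (intro divide_left_mono) auto
  qed
  have \<epsilon>0: "\<epsilon> \<ge> 0" using n Lam(2)[of R] R0 by (simp add: \<epsilon>_def)
  have \<epsilon>q: "\<epsilon> * exp (J R) \<le> n * C"
  proof -
    have "n * (Lam R * exp (J R)) \<le> n * (C * \<gamma> R)" using C[OF R0(1)] n by (intro mult_left_mono) auto
    then show ?thesis using R0 by (simp add: \<epsilon>_def divide_le_eq mult_ac)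
  qed
  have a_pos: "1 / lam s > 0" if "s \<ge> 0" for s using lam(2)[OF that] by simp
  have J_eq: "integral {0..t} (\<lambda>s. 1 / lam s) = J t" for t by (simp add: J_def)
  obtain \<phi> g \<kappa> where \<phi>: "\<phi> 0 = 0" "continuous_on {0..R} \<phi>"
      "\<And>s. 0 < s \<Longrightarrow> s < R \<Longrightarrow> (\<phi> has_real_derivative exp (g s)) (at s)"
    and g: "\<And>s. 0 < s \<Longrightarrow> s < R \<Longrightarrow> (g has_real_derivative - \<kappa> s * (\<epsilon> - g s)) (at s)"
    and \<kappa>: "continuous_on {0<..<R} \<kappa>" and g0: "\<And>s. 0 < s \<Longrightarrow> s < R \<Longrightarrow> g s \<le> 0"
    and \<kappa>a: "\<And>s. 0 < s \<Longrightarrow> s < R \<Longrightarrow> 1 / lam s \<le> \<kappa> s"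
    and \<phi>_le: "\<And>s. 0 \<le> s \<Longrightarrow> s \<le> R \<Longrightarrow> \<phi> s \<le> integral {0..s} (\<lambda>t. \<nu> powr exp (J t))"
    and \<phi>_ge: "\<And>h. 0 \<le> h \<Longrightarrow> h \<le> R \<Longrightarrow> h * (exp (ln \<nu> - 2 * (n * C)) * \<nu> powr exp (J R)) \<le> \<phi> R - \<phi> (R - h)"
    and \<phi>_mono: "\<And>s t. 0 \<le> s \<Longrightarrow> s \<le> t \<Longrightarrow> t \<le> R \<Longrightarrow> \<phi> s \<le> \<phi> t"
    by (rule barrier_profile[OF mono a_pos R0(1) \<nu> \<epsilon>0, unfolded J_eq, OF _ \<epsilon>q], assumption) (rule that)
  define c where "c = D_center k \<gamma>"
  have usc: "usc_on (half_space k) u" using u by (simp add: px_subharmonic_def)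
  note cmp = barrier_comparison[where k=k and p=p and u=u and \<gamma>=\<gamma> and Lam=Lam and lam=lam and R=R and \<phi>=\<phi> and g=g and \<kappa>=\<kappa>,
      OF lam p Dp Lam(1) u flat R0 \<phi> \<phi>_mono g[unfolded \<epsilon>_def n_def] g0 \<kappa> \<kappa>a, folded c_def]
  have u_le_M: "ereal (u y) \<le> M_sup k \<gamma> u R" if "y \<in> frontier (D_set k \<gamma> R)" "y \<in> half_space k" for y
    unfolding M_sup_def using that by (intro SUP_upper2[of y]) (auto simp: bdry_ext_def)
  have \<phi>0: "0 \<le> \<phi> s" if "0 \<le> s" "s \<le> R" for s using \<phi>_mono[of 0 s] \<phi>(1) that by simp
  \<comment> \<open>On the axis \<rho> takes the value t, so the comparison with shift 0 would give
    u \<le> \<phi>(t) at the point where u exceeds the extremal function, although \<phi> lies below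
    it.\<close>
  have M_gt: "ereal (\<phi> R) < M_sup k \<gamma> u R"
  proof (rule ccontr)
    assume "\<not> ereal (\<phi> R) < M_sup k \<gamma> u R"
    then have M: "M_sup k \<gamma> u R \<le> ereal (\<phi> R)" by simp
    have dist: "norm (axis k t - c R) = t + \<gamma> R"
    proof -
      have "axis k t - c R = (t + \<gamma> R) *\<^sub>R axis k 1"
        by (auto simp: vec_eq_iff c_def D_center_def axis_def)
      then show ?thesis using t R0 by (simp add: norm_axis_1)
    qed
    have "u (axis k t) \<le> \<phi> (norm (axis k t - c R) - \<gamma> R) + 0"
    proof (rule cmp)
      show "u y \<le> \<phi> R + 0" if "y \<in> frontier (D_set k \<gamma> R)" "y \<in> half_space k" for y
        using order_trans[OF u_le_M[OF that] M] by simp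
      have "axis k t \<in> ball (c R) (R + \<gamma> R)" using dist R by (metis add_less_cancel_right dist_commute dist_norm mem_ball)
      then show "axis k t \<in> D_set k \<gamma> R"
        using t by (simp add: D_set_eq[where R=R and \<gamma>=\<gamma>, OF R0] half_space_def c_def)
    qed simp_all
    also have "\<dots> \<le> integral {0..t} (\<lambda>s. \<nu> powr exp (J s))" using \<phi>_le[of t] t R dist by simp
    finally show False using t(2) by simp
  qed
  obtain B where "M_sup k \<gamma> u R \<le> ereal B" by (rule M_sup_finite[where \<gamma>=\<gamma> and R=R, OF usc R0 flat])
  then obtain m where m: "M_sup k \<gamma> u R = ereal m" using M_gt by (cases "M_sup k \<gamma> u R") auto
  have m_gt: "m > \<phi> R" using M_gt m by simp
  have u_le: "u x \<le> \<phi> (norm (x - c R) - \<gamma> R) + (m - \<phi> R)" if "x \<in> D_set k \<gamma> R" for x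
  proof (rule cmp)
    show "u y \<le> \<phi> R + (m - \<phi> R)" if "y \<in> frontier (D_set k \<gamma> R)" "y \<in> half_space k" for y
      using u_le_M[OF that] m by simp
  qed (use m_gt that in auto)
  \<comment> \<open>The centres of D(R) and D(R') with R' = R - h differ by the nonnegative number
    \<open>\<gamma> R - \<gamma> R'\<close>. The triangle inequality then gives \<rho> \<le> R' < R
    on the frontier of D(R'), so off the flat part its points lie in D(R), where the shifted barrier
    bounds u.\<close>
  have M_le: "M_sup k \<gamma> u (R - h) \<le> ereal (\<phi> (R - h) + (m - \<phi> R))" if h: "0 < h" "h < R" for h
    unfolding M_sup_def
  proof (rule SUP_least)
    define R' where "R' = R - h"
    have R': "R' > 0" "\<gamma> R' > 0" "R' < R" using h \<gamma>(1) by (auto simp: R'_def)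
    fix y assume "y \<in> frontier (D_set k \<gamma> (R - h))"
    then have y: "y \<in> closure (D_set k \<gamma> R')" "y \<notin> D_set k \<gamma> R'"
      unfolding R'_def[symmetric] frontier_D_set_iff[where R=R' and \<gamma>=\<gamma>, OF R'(1,2)] by auto
    note cl = closure_D_set[where R=R' and \<gamma>=\<gamma>, OF R'(1,2) y]
    show "bdry_ext k u y \<le> ereal (\<phi> (R - h) + (m - \<phi> R))"
    proof (cases "y $ k = 0")
      case True
      have "bdry_ext k u y \<le> 0" using True by (rule flat)
      also have "0 \<le> ereal (\<phi> (R - h) + (m - \<phi> R))" using \<phi>0[of "R - h"] m_gt h by simp
      finally show ?thesis .
    next
      case False
      then have yH: "y \<in> half_space k" using cl(1) by (simp add: half_space_def)
      have cc: "norm (c R' - c R) = \<gamma> R - \<gamma> R'"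
      proof -
        have "c R' - c R = (\<gamma> R - \<gamma> R') *\<^sub>R axis k 1" by (simp add: c_def D_center_def algebra_simps)
        moreover have "\<gamma> R' \<le> \<gamma> R" using mono_onD[OF \<gamma>(2), of R' R] R' R0 by auto
        ultimately show ?thesis by (simp add: norm_axis_1)
      qed
      have "norm (y - c R) \<le> norm (y - c R') + norm (c R' - c R)"
        using norm_triangle_ineq[of "y - c R'" "c R' - c R"] by simp
      also have "\<dots> \<le> R' + \<gamma> R" using cl(2) cc by (simp add: c_def)
      finally have le: "norm (y - c R) \<le> R' + \<gamma> R" .
      then have "norm (y - c R) < R + \<gamma> R" using R' by simp
      then have yD: "y \<in> D_set k \<gamma> R"
        using yH by (simp add: D_set_eq[where R=R and \<gamma>=\<gamma>, OF R0] c_def dist_norm norm_minus_commute)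
      have "0 \<le> norm (y - c R) - \<gamma> R"
        using nth_le_dist_D_center[of y k \<gamma> R] yH by (simp add: half_space_def c_def)
      then have "\<phi> (norm (y - c R) - \<gamma> R) \<le> \<phi> R'" using le R' by (intro \<phi>_mono) auto
      then have "u y \<le> \<phi> (R - h) + (m - \<phi> R)" using u_le[OF yD] by (simp add: R'_def)
      then show ?thesis using yH by (simp add: bdry_ext_def)
    qed
  qed
  define f where "f = \<nu> powr exp (J R)"
  have f: "f > 0" using \<nu> by (simp add: f_def)
  define K where "K = exp (ln \<nu> - 2 * (n * C))"
  have "ereal (K * f) \<le> M_deriv k \<gamma> u R"
    unfolding M_deriv_def
  proof (rule Liminf_bounded)
    have "\<forall>\<^sub>F h in at_right 0. h \<in> {0<..<R}" using R0(1) by (rule eventually_at_right_real)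
    then show "\<forall>\<^sub>F h in at_right 0. ereal (K * f) \<le> (M_sup k \<gamma> u R - M_sup k \<gamma> u (R - h)) / ereal h"
    proof eventually_elim
      case (elim h)
      then have h: "0 < h" "h < R" by auto
      \<comment> \<open>The shift cancels: m - (\<phi>(R - h) + m - \<phi>(R)) is the increment of
        \<phi> over [R - h, R].\<close>
      have "ereal (h * (K * f)) \<le> ereal (m - (\<phi> (R - h) + (m - \<phi> R)))"
        using \<phi>_ge[of h] h by (simp add: K_def f_def)
      also have "\<dots> = M_sup k \<gamma> u R - ereal (\<phi> (R - h) + (m - \<phi> R))" by (simp add: m)
      also have "\<dots> \<le> M_sup k \<gamma> u R - M_sup k \<gamma> u (R - h)" by (intro ereal_minus_mono M_le h order_refl)
      finally have le: "ereal (h * (K * f)) \<le> M_sup k \<gamma> u R - M_sup k \<gamma> u (R - h)" .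
      have "ereal (K * f) = ereal (h * (K * f)) / ereal h" using h by simp
      also have "\<dots> \<le> (M_sup k \<gamma> u R - M_sup k \<gamma> u (R - h)) / ereal h"
        using le h by (intro ereal_divide_right_mono) auto
      finally show ?case .
    qed
  qed
  then have "ereal (K * f) / ereal f \<le> M_deriv k \<gamma> u R / ereal f" using f by (intro ereal_divide_right_mono) auto
  then show ?thesis using f by (simp add: K_def f_def n_def)
qed

section \<open>The extremal function\<close>

lemma set_integrable_powr_continuous:
  fixes X :: "'a::euclidean_space \<Rightarrow> 'b::euclidean_space"
  assumes K: "compact K" and X: "continuous_on K X" and p: "continuous_on K p" "\<And>x. x \<in> K \<Longrightarrow> p x > 1"
  shows "set_integrable lebesgue K (\<lambda>x. norm (X x) powr p x)"
proof -
  have "bounded (p ` K)" "bounded (X ` K)"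
    using K X p by (auto intro!: compact_imp_bounded compact_continuous_image)
  then obtain P B where PB: "\<And>x. x \<in> K \<Longrightarrow> \<bar>p x\<bar> \<le> P" "\<And>x. x \<in> K \<Longrightarrow> norm (X x) \<le> B"
    by (force simp: bounded_iff)
  show ?thesis
  proof (rule set_integrable_dominated)
    show "set_borel_measurable lebesgue K (\<lambda>x. norm (X x) powr p x)"
      using K by (intro set_borel_measurable_p_field(2) set_borel_measurable_compact_continuous X p)
        (auto simp: compact_imp_closed)
    show "set_integrable lebesgue K (\<lambda>x. max B 1 powr P)" by (rule set_integrable_const_compact[OF K])
    fix x assume x: "x \<in> K"
    have "norm (X x) powr p x \<le> max B 1 powr p x" using PB(2)[OF x] p(2)[OF x] by (intro powr_mono2) auto
    also have "\<dots> \<le> max B 1 powr P" using PB(1)[OF x] by (intro powr_mono) (auto simp: abs_le_iff)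
    finally show "norm (norm (X x) powr p x) \<le> max B 1 powr P" by simp
  qed
qed

lemma continuous_on_half_space_nth:
  fixes h :: "real \<Rightarrow> real" and k :: "'n::finite"
  assumes "\<And>B. continuous_on {0..B} h"
  shows "continuous_on (half_space k) (\<lambda>x. h (x $ k))"
proof (rule continuous_at_imp_continuous_on, rule ballI)
  fix x :: "real ^ 'n" assume x: "x \<in> half_space k"
  have "continuous_on {0<..<x $ k + 1} h" using assms[of "x $ k + 1"] by (rule continuous_on_subset) auto
  then have "isCont h (x $ k)" using x by (simp add: continuous_on_eq_continuous_at half_space_def)
  moreover have "isCont (\<lambda>x. x $ k) x" by (intro continuous_component continuous_ident)
  ultimately show "isCont (\<lambda>x. h (x $ k)) x" by (rule isCont_o2[rotated])
qed

context
  fixes C lam :: "real \<Rightarrow> real" and \<nu> :: real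
  assumes C_pos: "\<forall>t\<ge>0. C t > 0" and lam_pos: "\<forall>t\<ge>0. lam t > 0"
    and lam_mono: "antimono_on {0..} lam"
    and C_cont: "continuous_on {0..} C"
    and nu_pos: "\<nu> > 0"
begin

text \<open>The quotient need be neither monotone nor continuous. It is the product of the monotone,
  hence integrable, function 1 / \<open>lam\<close> with the bounded measurable function
  \<open>C\<close>.\<close>

lemma A_integrable: "(\<lambda>s. C s / lam s) integrable_on {0..t}"
proof -
  have cC: "continuous_on {0..t} C" using C_cont by (rule continuous_on_subset) auto
  have "mono_on {0..t} (\<lambda>s. 1 / lam s)"
  proof (rule mono_onI)
    fix r s :: real assume rs: "r \<in> {0..t}" "s \<in> {0..t}" "r \<le> s"
    then have "lam s \<le> lam r" using monotone_onD[OF lam_mono] by auto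
    then show "1 / lam r \<le> 1 / lam s" using rs lam_pos by (intro divide_left_mono) auto
  qed
  then have "integrable (lebesgue_on {0..t}) (\<lambda>s. 1 / lam s)" by (rule integrable_mono_on)
  then have "set_integrable lebesgue {0..t} (\<lambda>s. 1 / lam s)"
    by (simp add: integrable_restrict_space set_integrable_def)
  moreover have "C \<in> borel_measurable (lebesgue_on {0..t})"
    using cC by (simp add: continuous_imp_measurable_on_sets_lebesgue)
  moreover have "bounded (C ` {0..t})" using cC by (intro compact_imp_bounded compact_continuous_image) auto
  ultimately have "(\<lambda>s. C s * (1 / lam s)) absolutely_integrable_on {0..t}"
    by (intro absolutely_integrable_bounded_measurable_product_real) auto
  then show ?thesis using set_lebesgue_integral_eq_integral(1) by fastforce
qed

lemma continuous_A_int: "continuous_on {0..B} (A_int C lam)"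
  unfolding A_int_def by (rule indefinite_integral_continuous_1[OF A_integrable])

lemma continuous_f_nu: "continuous_on {0..B} (f_nu C lam \<nu>)"
  unfolding f_nu_def using nu_pos
  by (cases "\<nu> \<le> 1") (auto intro!: continuous_intros continuous_A_int)

lemma f_nu_pos: "f_nu C lam \<nu> t > 0"
  using nu_pos by (simp add: f_nu_def)

lemma u_check_differentiable:
  assumes "x \<in> half_space k"
  shows "u_check k C lam \<nu> differentiable (at x)"
    "grad (u_check k C lam \<nu>) x = f_nu C lam \<nu> (x $ k) *\<^sub>R axis k 1"
proof -
  have D: "((\<lambda>t. integral {0..t} (f_nu C lam \<nu>)) has_real_derivative f_nu C lam \<nu> (x $ k)) (at (x $ k))"
    using assms by (intro has_real_derivative_integral[OF continuous_f_nu, where B="x $ k + 1"]) (auto simp: half_space_def)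
  have diff: "(\<lambda>x. x $ k) differentiable (at x)"
    using has_derivative_nth unfolding differentiable_def by blast
  have u: "u_check k C lam \<nu> = (\<lambda>x. integral {0..x $ k} (f_nu C lam \<nu>))" by (simp add: u_check_def fun_eq_iff)
  show "u_check k C lam \<nu> differentiable (at x)"
    unfolding u using grad_compose(1)[OF diff D] unfolding differentiable_def by blast
  show "grad (u_check k C lam \<nu>) x = f_nu C lam \<nu> (x $ k) *\<^sub>R axis k 1"
    unfolding u using grad_compose(2)[OF diff D] by (simp add: grad_eqI[OF has_derivative_nth])
qed

text \<open>This identity dictates the form of \<open>p_check\<close>: the factor exp (A) or exp
  (-A) in the exponent of \<open>f_nu\<close> is cancelled by its reciprocal in p - 1, so |Du|^(p-1)
  does not depend on x.\<close>

lemma f_nu_powr_p_check: 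
  "f_nu C lam \<nu> (x $ k) powr (p_check k C lam \<nu> M\<^sub>0 x - 1) = \<nu> powr M\<^sub>0"
proof -
  have e: "exp a * (M\<^sub>0 * exp (- a)) = M\<^sub>0" "exp (- a) * (M\<^sub>0 * exp a) = M\<^sub>0" for a :: real
    by (simp_all add: exp_minus)
  show ?thesis by (simp add: f_nu_def p_check_def powr_powr e)
qed

lemma px_harmonic_u_check:
  assumes M: "M\<^sub>0 > 0"
  shows "px_harmonic (p_check k C lam \<nu> M\<^sub>0) (half_space k) (u_check k C lam \<nu>)"
proof -
  define H where "H = half_space k"
  define u where "u = u_check k C lam \<nu>"
  define p where "p = p_check k C lam \<nu> M\<^sub>0"
  define f where "f = f_nu C lam \<nu>"
  define Du where "Du = (\<lambda>x. f (x $ k) *\<^sub>R (axis k 1 :: real ^ 'a))"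
  note ud = u_check_differentiable[of _ k, folded u_def f_def H_def]
  have uc: "continuous_on H u"
    using ud(1) by (simp add: continuous_at_imp_continuous_on differentiable_imp_continuous_within)
  have fc: "continuous_on H (\<lambda>x. f (x $ k))"
    unfolding f_def H_def by (rule continuous_on_half_space_nth[OF continuous_f_nu])
  have Duc: "continuous_on H Du" unfolding Du_def by (intro continuous_intros fc)
  have pc: "continuous_on H p"
  proof -
    have 1: "continuous_on H (\<lambda>x. A_int C lam (x $ k))"
      unfolding H_def by (rule continuous_on_half_space_nth[OF continuous_A_int])
    show ?thesis unfolding p_def p_check_def by (cases "\<nu> \<le> 1") (auto intro!: continuous_intros 1)
  qed
  have p1: "p x > 1" for x using M by (simp add: p_def p_check_def)
  \<comment> \<open>Continuous functions are bounded on compact sets and so is the exponent, so the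
    scale \<mu> = 1 suffices.\<close>
  have Lp: "X \<in> Lp_var_loc p H" if "continuous_on H X" for X :: "real ^ 'a \<Rightarrow> 'b::euclidean_space"
    unfolding Lp_var_loc_def Lp_var_def
  proof (intro CollectI allI impI conjI exI[of _ "1::real"])
    fix K assume K: "compact K \<and> K \<subseteq> H"
    then have Xc: "continuous_on K X" using that by (blast intro: continuous_on_subset)
    show "set_borel_measurable lebesgue K X" using K Xc by (intro set_borel_measurable_compact_continuous) auto
    show "set_integrable lebesgue K (\<lambda>x. (norm (X x) / 1) powr p x)"
      using set_integrable_powr_continuous[OF _ Xc continuous_on_subset[OF pc] p1] K by simp
  qed simp
  have W: "W1p_loc p H u Du"
    unfolding W1p_loc_def has_weak_gradient_def
  proof (intro conjI allI impI ballI Lp uc Duc)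
    show "set_integrable lebesgue K u" "set_integrable lebesgue K Du" if "compact K \<and> K \<subseteq> H" for K
      using that by (auto intro!: set_integrable_compact_continuous continuous_on_subset[OF uc] continuous_on_subset[OF Duc])
    fix \<phi> :: "real ^ 'a \<Rightarrow> real" and i assume \<phi>: "\<phi> \<in> test_functions H"
    have "set_lebesgue_integral lebesgue H (\<lambda>x. u x * grad \<phi> x $ i) = - set_lebesgue_integral lebesgue H (\<lambda>x. grad u x $ i * \<phi> x)"
    proof (rule set_integral_by_parts[OF _ ud(1) _ \<phi>])
      show "open H" unfolding H_def by (rule open_half_space)
      show "continuous_on H (\<lambda>x. grad u x $ i)"
        by (rule continuous_on_eq[of _ "\<lambda>x. Du x $ i"]) (auto simp: Du_def ud(2) intro!: continuous_intros fc)
    qed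
    also have "set_lebesgue_integral lebesgue H (\<lambda>x. grad u x $ i * \<phi> x) = set_lebesgue_integral lebesgue H (\<lambda>x. Du x $ i * \<phi> x)"
      unfolding set_lebesgue_integral_def
      by (rule Bochner_Integration.integral_cong[OF refl]) (auto simp: indicator_def ud(2) Du_def)
    finally show "set_lebesgue_integral lebesgue H (\<lambda>x. u x * grad \<phi> x $ i) = - set_lebesgue_integral lebesgue H (\<lambda>x. Du x $ i * \<phi> x)" .
  qed
  have "px_energy p H Du \<psi> = 0" if \<psi>: "\<psi> \<in> test_functions H" for \<psi>
  proof -
    have "(norm (Du x) powr (p x - 2)) *\<^sub>R Du x \<bullet> grad \<psi> x = \<nu> powr M\<^sub>0 * (1 * grad \<psi> x $ k)" for x
    proof -
      have f0: "f (x $ k) > 0" unfolding f_def by (rule f_nu_pos)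
      have "f (x $ k) powr (p x - 2) * f (x $ k) = f (x $ k) powr (p x - 1)"
        using powr_times_self[of "f (x $ k)" "p x - 1"] f0 by simp
      also have "\<dots> = \<nu> powr M\<^sub>0" unfolding f_def p_def by (rule f_nu_powr_p_check)
      finally show ?thesis using f0 by (simp add: Du_def norm_axis_1 inner_axis')
    qed
    then have "px_energy p H Du \<psi> = \<nu> powr M\<^sub>0 * set_lebesgue_integral lebesgue H (\<lambda>x. 1 * grad \<psi> x $ k)"
      unfolding px_energy_def by (simp add: set_lebesgue_integral_def mult.left_commute)
    \<comment> \<open>Integration by parts against the constant function 1, whose gradient is
      zero.\<close>
    also have "set_lebesgue_integral lebesgue H (\<lambda>x. 1 * grad \<psi> x $ k) = 0"
    proof -
      have g0: "grad (\<lambda>_. 1) x = 0" for x :: "real ^ 'a" by (intro grad_eqI) simp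
      have "set_lebesgue_integral lebesgue H (\<lambda>x. 1 * grad \<psi> x $ k) = - set_lebesgue_integral lebesgue H (\<lambda>x. grad (\<lambda>_. 1) x $ k * \<psi> x)"
        by (rule set_integral_by_parts[OF _ _ _ \<psi>]) (auto simp: H_def open_half_space g0)
      then show ?thesis by (simp add: g0 set_lebesgue_integral_def)
    qed
    finally show ?thesis by simp
  qed
  then show ?thesis
    using W uc unfolding px_harmonic_def weak_solution_def H_def u_def p_def by blast
qed

end

section \<open>The exponential integral\<close>

text \<open>exp is integrable near minus infinity, and 1 / |t| \<le> 1 / |z| for t \<le> z <
  0.\<close>

lemma set_integrable_exp_div:
  assumes "z < 0"
  shows "set_integrable lborel {..z} (\<lambda>t::real. exp t / t)"
proof -
  have "set_integrable lborel (einterval (-\<infinity>) (ereal 0)) (exp :: real \<Rightarrow> real)"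
  proof (rule interval_integral_FTC_nonneg[where F="exp :: real \<Rightarrow> real" and A=0 and B=1])
    show "((exp \<circ> real_of_ereal) \<longlongrightarrow> (0::real)) (at_right (-\<infinity>))"
      unfolding ereal_tendsto_simps by (rule exp_at_bot)
    have "(exp \<longlongrightarrow> exp 0) (at_left (0::real))" by (intro tendsto_intros)
    then show "((exp \<circ> real_of_ereal) \<longlongrightarrow> (1::real)) (at_left (ereal 0))"
      unfolding ereal_tendsto_simps by simp
  qed (auto intro!: AE_I2)
  then have exp_int: "set_integrable lborel {..z} (exp :: real \<Rightarrow> real)"
    by (rule set_integrable_subset) (use assms in \<open>auto simp: einterval_def\<close>)
  have "integrable lborel (\<lambda>t. (1 / (- z)) * (indicator {..z} t *\<^sub>R exp t))"
    using exp_int by (intro integrable_mult_right) (simp add: set_integrable_def)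
  then show ?thesis unfolding set_integrable_def
  proof (rule Bochner_Integration.integrable_bound)
    show "AE t in lborel. norm (indicator {..z} t *\<^sub>R (exp t / t)) \<le> norm ((1 / (- z)) * (indicator {..z} t *\<^sub>R exp t))"
    proof (rule AE_I2)
      fix t :: real
      show "norm (indicator {..z} t *\<^sub>R (exp t / t)) \<le> norm ((1 / (- z)) * (indicator {..z} t *\<^sub>R exp t))"
      proof (cases "t \<le> z")
        case True
        then have "exp t / \<bar>t\<bar> \<le> exp t / \<bar>z\<bar>" using assms by (intro divide_left_mono) (auto simp: zero_less_mult_iff)
        then show ?thesis using True assms by simp
      qed simp
    qed
  qed simp
qed

text \<open>For negative z the range of integration stays away from the singularity: as soon as
  \<epsilon> < -z nothing is excised, and the principal value is an ordinary integral.\<close>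

lemma Ei_neg:
  assumes "z < 0"
  shows "Ei z = set_lebesgue_integral lborel {..z} (\<lambda>t. exp t / t)"
  unfolding Ei_def
proof (rule tendsto_Lim)
  show "at_right (0::real) \<noteq> bot" by simp
  have "\<forall>\<^sub>F \<epsilon> in at_right 0. \<epsilon> \<in> {0<..<- z}" using assms by (intro eventually_at_right_real) simp
  then have "\<forall>\<^sub>F \<epsilon> in at_right 0. set_lebesgue_integral lborel {..z} (\<lambda>t. exp t / t)
     = set_lebesgue_integral lborel {t. t \<le> z \<and> \<bar>t\<bar> \<ge> \<epsilon>} (\<lambda>t. exp t / t)"
  proof eventually_elim
    case (elim \<epsilon>)
    then have "{t. t \<le> z \<and> \<bar>t\<bar> \<ge> \<epsilon>} = {..z}" by auto
    then show ?case by simp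
  qed
  then show "((\<lambda>\<epsilon>. set_lebesgue_integral lborel {t. t \<le> z \<and> \<bar>t\<bar> \<ge> \<epsilon>} (\<lambda>t. exp t / t)) \<longlongrightarrow>
      set_lebesgue_integral lborel {..z} (\<lambda>t. exp t / t)) (at_right 0)"
    by (rule Lim_transform_eventually[OF tendsto_const])
qed

text \<open>Splitting at c = z - 1 leaves a constant tail and an integral with variable upper end;
  the choice b = z/2 keeps the neighbourhood on the negative axis, where the integrand is
  continuous.\<close>

lemma Ei_has_derivative:
  assumes "z < 0"
  shows "(Ei has_real_derivative exp z / z) (at z)"
proof -
  define c b where "c = z - 1" and "b = z / 2"
  have cb: "c < z" "z < b" "b < 0" using assms by (auto simp: c_def b_def)
  let ?f = "\<lambda>t::real. exp t / t"
  have cont: "continuous_on {c..b} ?f" using cb by (intro continuous_intros) auto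
  have eq: "Ei y = set_lebesgue_integral lborel {..<c} ?f + integral {c..y} ?f" if "y \<in> {c<..<b}" for y
  proof -
    have y: "c < y" "y < 0" using that cb by auto
    have int: "set_integrable lborel {..y} ?f" using y by (intro set_integrable_exp_div)
    have i1: "set_integrable lborel {..<c} ?f" and i2: "set_integrable lborel {c..y} ?f"
      using y by (auto intro: set_integrable_subset[OF int])
    have "{..y} = {..<c} \<union> {c..y}" using y by auto
    then have "Ei y = set_lebesgue_integral lborel ({..<c} \<union> {c..y}) ?f" using Ei_neg[OF y(2)] by simp
    also have "\<dots> = set_lebesgue_integral lborel {..<c} ?f + set_lebesgue_integral lborel {c..y} ?f"
      by (rule set_integral_Un[OF _ i1 i2]) auto
    finally show ?thesis using set_borel_integral_eq_integral(2)[OF i2] by simp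
  qed
  have "((\<lambda>y. integral {c..y} ?f) has_real_derivative exp z / z) (at z within {c..b})"
    using cb by (intro integral_has_real_derivative[OF cont]) auto
  then have "((\<lambda>y. integral {c..y} ?f) has_real_derivative exp z / z) (at z)"
    using cb by (simp add: at_within_Icc_at)
  then have "((\<lambda>y. set_lebesgue_integral lborel {..<c} ?f + integral {c..y} ?f) has_real_derivative exp z / z) (at z)"
    by (auto intro!: derivative_eq_intros)
  then show ?thesis
    by (rule has_field_derivative_transform_within_open[where S="{c<..<b}"]) (use cb eq in auto)
qed

text \<open>l Ei (e^(s/l) m) is an antiderivative: the inner derivative e^(s/l) m / l cancels the
  denominator in the derivative exp z / z of Ei, and the factor l removes the rest.\<close>

lemma integral_double_exp_Ei:
  assumes l: "l > 0" and m: "m < 0" and T: "T \<ge> 0"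
  shows "integral {0..T} (\<lambda>s. exp (exp (s / l) * m)) = l * (- Ei m + Ei (exp (T / l) * m))"
proof -
  have "((\<lambda>s. exp (exp (s / l) * m)) has_integral (l * Ei (exp (T / l) * m) - l * Ei (exp (0 / l) * m))) {0..T}"
  proof (rule fundamental_theorem_of_calculus[OF T])
    fix s :: real
    have neg: "exp (s / l) * m < 0" using m by (simp add: mult_pos_neg)
    have "((\<lambda>s. exp (s / l) * m) has_real_derivative exp (s / l) * (1 / l) * m) (at s)"
      using l by (auto intro!: derivative_eq_intros)
    from DERIV_chain2[OF Ei_has_derivative[OF neg] this]
    have "((\<lambda>s. l * Ei (exp (s / l) * m)) has_real_derivative
        l * (exp (exp (s / l) * m) / (exp (s / l) * m) * (exp (s / l) * (1 / l) * m))) (at s)"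
      by (rule DERIV_cmult)
    then have "((\<lambda>s. l * Ei (exp (s / l) * m)) has_real_derivative exp (exp (s / l) * m)) (at s)"
      using l m by simp
    then show "((\<lambda>s. l * Ei (exp (s / l) * m)) has_vector_derivative exp (exp (s / l) * m)) (at s within {0..T})"
      by (simp add: has_real_derivative_iff_has_vector_derivative has_vector_derivative_at_within)
  qed
  then show ?thesis by (simp add: integral_unique algebra_simps)
qed

section \<open>Assembly of the three assertions\<close>

lemma A_int_C_one:
  assumes "\<forall>s\<ge>0. C s = 1"
  shows "A_int C lam t = integral {0..t} (\<lambda>s. 1 / lam s)"
  unfolding A_int_def by (rule Henstock_Kurzweil_Integration.integral_cong) (use assms in auto)

theorem mainTheorem4:
  fixes C lam :: "real \<Rightarrow> real" and \<nu> :: real and k :: "'n::finite"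
  assumes C_pos: "\<forall>t\<ge>0. C t > 0" and lam_pos: "\<forall>t\<ge>0. lam t > 0"
    and C_mono: "antimono_on {0..} C" and lam_mono: "antimono_on {0..} lam"
    and C_cont: "continuous_on {0..} C"
    and nu_pos: "\<nu> > 0"
  shows
    "(\<forall>M\<^sub>0>0. px_harmonic (p_check k C lam \<nu> M\<^sub>0) (half_space k) (u_check k C lam \<nu>))
     \<and>
     (\<nu> \<le> 1 \<and> (\<forall>t\<ge>0. C t = 1) \<longrightarrow>
       (\<forall>(p :: real ^ 'n \<Rightarrow> real) (Lam :: real \<Rightarrow> real) (\<gamma> :: real \<Rightarrow> real) (u :: real ^ 'n \<Rightarrow> real).
          C1_on (half_space k) p \<and>
          (\<forall>x\<in>half_space k. 1 < p x) \<and>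
          (\<forall>x\<in>half_space k. Dp_norm k p x \<noteq> 0) \<and>
          (\<forall>x\<in>half_space k. ereal (lam (x $ k)) \<le> ereal (min 1 (p x - 1)) / Dp_norm k p x) \<and>
          (\<forall>x\<in>half_space k. ereal (max 1 (p x - 1)) / Dp_norm k p x \<le> ereal (Lam (x $ k))) \<and>
          (\<forall>t\<ge>0. Lam t > 0) \<and> mono_on {0..} Lam \<and>
          (\<forall>R>0. \<gamma> R > 0) \<and> mono_on {0<..} \<gamma> \<and>
          (\<exists>c>0. \<forall>R>0. Lam R * exp (integral {0..R} (\<lambda>s. 1 / lam s)) \<le> c * \<gamma> R) \<and>
          px_subharmonic p (half_space k) u \<and>
          (\<forall>y\<in>frontier (half_space k).
             Limsup (at y within half_space k) (\<lambda>x. ereal (u x)) \<le> 0) \<and>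
          (\<exists>t>0. u (axis k t) > u_check k C lam \<nu> (axis k t))
          \<longrightarrow>
          Liminf at_top (\<lambda>R::real. M_deriv k \<gamma> u R
             / ereal (\<nu> powr exp (integral {0..R} (\<lambda>s. 1 / lam s)))) > 0))
     \<and>
     (\<nu> \<le> 1 \<and> (\<forall>t\<ge>0. C t = 1) \<longrightarrow>
       (\<forall>lam\<^sub>0. (\<forall>t\<ge>0. lam t = lam\<^sub>0) \<longrightarrow>
          (\<nu> < 1 \<longrightarrow> (\<forall>x\<in>half_space k. u_check k C lam \<nu> x
             = lam\<^sub>0 * (- Ei (ln \<nu>) + Ei (exp (x $ k / lam\<^sub>0) * ln \<nu>)))) \<and>
          (\<nu> = 1 \<longrightarrow> (\<forall>x\<in>half_space k. u_check k C lam \<nu> x = x $ k))))"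
proof (intro conjI allI impI)
  show "px_harmonic (p_check k C lam \<nu> M\<^sub>0) (half_space k) (u_check k C lam \<nu>)" if "M\<^sub>0 > 0" for M\<^sub>0
    using px_harmonic_u_check[OF C_pos lam_pos lam_mono C_cont nu_pos that] .
next
  fix p u :: "real ^ 'n \<Rightarrow> real" and Lam \<gamma> :: "real \<Rightarrow> real"
  assume one: "\<nu> \<le> 1 \<and> (\<forall>t\<ge>0. C t = 1)" and H: "C1_on (half_space k) p \<and>
          (\<forall>x\<in>half_space k. 1 < p x) \<and>
          (\<forall>x\<in>half_space k. Dp_norm k p x \<noteq> 0) \<and>
          (\<forall>x\<in>half_space k. ereal (lam (x $ k)) \<le> ereal (min 1 (p x - 1)) / Dp_norm k p x) \<and>
          (\<forall>x\<in>half_space k. ereal (max 1 (p x - 1)) / Dp_norm k p x \<le> ereal (Lam (x $ k))) \<and>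
          (\<forall>t\<ge>0. Lam t > 0) \<and> mono_on {0..} Lam \<and>
          (\<forall>R>0. \<gamma> R > 0) \<and> mono_on {0<..} \<gamma> \<and>
          (\<exists>c>0. \<forall>R>0. Lam R * exp (integral {0..R} (\<lambda>s. 1 / lam s)) \<le> c * \<gamma> R) \<and>
          px_subharmonic p (half_space k) u \<and>
          (\<forall>y\<in>frontier (half_space k).
             Limsup (at y within half_space k) (\<lambda>x. ereal (u x)) \<le> 0) \<and>
          (\<exists>t>0. u (axis k t) > u_check k C lam \<nu> (axis k t))"
  have p: "C1_on (half_space k) p" "\<forall>x\<in>half_space k. 1 < p x"
    and Dp0: "\<forall>x\<in>half_space k. Dp_norm k p x \<noteq> 0"
      "\<forall>x\<in>half_space k. ereal (lam (x $ k)) \<le> ereal (min 1 (p x - 1)) / Dp_norm k p x"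
      "\<forall>x\<in>half_space k. ereal (max 1 (p x - 1)) / Dp_norm k p x \<le> ereal (Lam (x $ k))"
    and Lam: "\<forall>t\<ge>0. Lam t > 0" "mono_on {0..} Lam"
    and \<gamma>: "\<forall>R>0. \<gamma> R > 0" "mono_on {0<..} \<gamma>"
    and ex_c: "\<exists>c>0. \<forall>R>0. Lam R * exp (integral {0..R} (\<lambda>s. 1 / lam s)) \<le> c * \<gamma> R"
    and u: "px_subharmonic p (half_space k) u"
    and u_flat: "\<forall>y\<in>frontier (half_space k). Limsup (at y within half_space k) (\<lambda>x. ereal (u x)) \<le> 0"
    and ex_t: "\<exists>t>0. u (axis k t) > u_check k C lam \<nu> (axis k t)"
    using H by - (elim conjE, assumption)+
  obtain c where c: "\<And>R. R > 0 \<Longrightarrow> Lam R * exp (integral {0..R} (\<lambda>s. 1 / lam s)) \<le> c * \<gamma> R"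
    using ex_c by blast
  obtain t where t: "t > 0" "u (axis k t) > u_check k C lam \<nu> (axis k t)" using ex_t by blast
  define J where "J = (\<lambda>t. integral {0..t} (\<lambda>s. 1 / lam s))"
  have u_check: "u_check k C lam \<nu> (axis k t) = integral {0..t} (\<lambda>s. \<nu> powr exp (J s))"
  proof -
    have "f_nu C lam \<nu> = (\<lambda>s. \<nu> powr exp (J s))" using one by (auto simp: f_nu_def A_int_C_one J_def)
    then show ?thesis by (simp add: u_check_def)
  qed
  have flat: "bdry_ext k u y \<le> 0" if "y $ k = 0" for y
    using u_flat frontier_half_spaceI[OF that] that by (simp add: bdry_ext_def half_space_def)
  have Dp: "\<exists>N>0. norm (grad p x) \<le> N \<and> lam (x $ k) * N \<le> min 1 (p x - 1) \<and> 1 \<le> Lam (x $ k) * N"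
    if x: "x \<in> half_space k" for x
  proof -
    have "lam (x $ k) > 0" using x lam_pos by (simp add: half_space_def)
    from Dp_norm_real[where lam=lam and Lam=Lam and p=p and x=x, OF x this bspec[OF Dp0(1) x] bspec[OF Dp0(2) x] bspec[OF Dp0(3) x]]
    show ?thesis by blast
  qed
  \<comment> \<open>\<open>K\<close> is independent of R, so the bound valid for all R > t passes to
    the lower limit, which is then positive as K is an exponential.\<close>
  define K where "K = exp (ln \<nu> - 2 * (real CARD('n) * c))"
  have "\<forall>\<^sub>F R in at_top. ereal K \<le> M_deriv k \<gamma> u R / ereal (\<nu> powr exp (integral {0..R} (\<lambda>s. 1 / lam s)))"
    using eventually_gt_at_top[of t]
  proof eventually_elim
    case (elim R)
    show ?case
      unfolding K_def
    proof (rule growth_lower_bound[where p=p and Lam=Lam and lam=lam and t=t])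
      show "integral {0..t} (\<lambda>s. \<nu> powr exp (integral {0..s} (\<lambda>s. 1 / lam s))) < u (axis k t)"
        using t(2) by (simp add: u_check J_def)
      show "\<exists>N>0. norm (grad p x) \<le> N \<and> lam (x $ k) * N \<le> min 1 (p x - 1) \<and> 1 \<le> Lam (x $ k) * N"
        if "x \<in> half_space k" for x using that by (rule Dp)
      show "bdry_ext k u y \<le> 0" if "y $ k = 0" for y using that by (rule flat)
      show "Lam R * exp (integral {0..R} (\<lambda>s. 1 / lam s)) \<le> c * \<gamma> R" if "R > 0" for R using that by (rule c)
    qed (use lam_mono lam_pos nu_pos one u t(1) elim p Lam \<gamma> in \<open>blast+\<close>)
  qed
  then have "ereal K \<le> Liminf at_top (\<lambda>R. M_deriv k \<gamma> u R / ereal (\<nu> powr exp (integral {0..R} (\<lambda>s. 1 / lam s))))"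
    by (rule Liminf_bounded)
  then show "Liminf at_top (\<lambda>R. M_deriv k \<gamma> u R / ereal (\<nu> powr exp (integral {0..R} (\<lambda>s. 1 / lam s)))) > 0"
    by (rule less_le_trans[rotated]) (simp add: K_def)
next
  fix lam\<^sub>0 :: real
  assume one: "\<nu> \<le> 1 \<and> (\<forall>t\<ge>0. C t = 1)" and l: "\<forall>t\<ge>0. lam t = lam\<^sub>0"
  have l0: "lam\<^sub>0 > 0" using lam_pos l by force
  have A: "A_int C lam s = s / lam\<^sub>0" if "s \<ge> 0" for s
  proof -
    have "A_int C lam s = integral {0..s} (\<lambda>s. 1 / lam\<^sub>0)"
      unfolding A_int_def by (rule Henstock_Kurzweil_Integration.integral_cong) (use one l in auto)
    then show ?thesis using that by simp
  qed
  show "\<forall>x\<in>half_space k. u_check k C lam \<nu> x = lam\<^sub>0 * (- Ei (ln \<nu>) + Ei (exp (x $ k / lam\<^sub>0) * ln \<nu>))" if "\<nu> < 1"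
  proof
    fix x :: "real ^ 'n" assume "x \<in> half_space k"
    then have x: "x $ k \<ge> 0" by (simp add: half_space_def)
    have "u_check k C lam \<nu> x = integral {0..x $ k} (\<lambda>s. exp (exp (s / lam\<^sub>0) * ln \<nu>))"
      unfolding u_check_def
      by (rule Henstock_Kurzweil_Integration.integral_cong) (use one nu_pos in \<open>auto simp: f_nu_def A powr_def\<close>)
    also have "\<dots> = lam\<^sub>0 * (- Ei (ln \<nu>) + Ei (exp (x $ k / lam\<^sub>0) * ln \<nu>))"
      using that nu_pos by (intro integral_double_exp_Ei l0 x) simp
    finally show "u_check k C lam \<nu> x = lam\<^sub>0 * (- Ei (ln \<nu>) + Ei (exp (x $ k / lam\<^sub>0) * ln \<nu>))" .
  qed
  show "\<forall>x\<in>half_space k. u_check k C lam \<nu> x = x $ k" if "\<nu> = 1"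
  proof -
    \<comment> \<open>The case \<nu> = 1 is separate because ln \<nu> = 0 would place the argument
      of \<open>Ei\<close> at the singularity; powers of 1 are simply 1.\<close>
    have "f_nu C lam \<nu> = (\<lambda>s. 1)" using that by (auto simp: f_nu_def)
    then show ?thesis by (simp add: u_check_def half_space_def)
  qed
qed

end
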